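(* Let $F$ be a field of characteristic $0$, let $H$ be a Hopf algebra over $F$ with an $\mathrm{ad}$-invariant left integral $t\in H^*$ such that $t(1)=1$, let $L$ be a finite dimensional semisimple Lie algebra over $F$ that is an $H$-comodule Lie algebra, and let $(V,\psi)$ be a finite dimensional $(H,L)$-module. Then $V=V_1\oplus V_2\oplus\dots\oplus V_s$ for some irreducible $(H,L)$-submodules $V_i$.
   Context: Here $H$ may be infinite dimensional, $H^*=\mathrm{Hom}_F(H,F)$, and Sweedler notation is used: $\Delta(a)=a_{(1)}\otimes a_{(2)}$ for the comultiplication; $\varepsilon$ and $S$ are the counit and antipode of $H$. An element $t\in H^*$ is a left integral on $H$ if $t(a_{(2)})a_{(1)}=t(a)1$ for all $a\in H$. A left integral $t$ is $\mathrm{ad}$-invariant if $t(a_{(1)}\,b\,S(a_{(2)}))=\varepsilon(a)t(b)$ for all $a,b\in H$. All comodules are right comodules, with coaction written $\rho(v)=v_{(0)}\otimes v_{(1)}$. A Lie algebra $L$ that is an $H$-comodule is an $H$-comodule Lie algebra if $\rho([a,b])=[a_{(0)},b_{(0)}]\otimes a_{(1)}b_{(1)}$ for all $a,b\in L$. Given a representation $\psi\colon L\to\mathfrak{gl}(V)$, the pair $(V,\psi)$ is an $(H,L)$-module if $V$ is an $H$-comodule with comodule map $\rho_V\colon V\to V\otimes H$ and $\rho_V(\psi(a)v)=\psi(a_{(0)})v_{(0)}\otimes a_{(1)}v_{(1)}$ for all $a\in L$, $v\in V$. An $(H,L)$-submodule is an $L$-submodule that is also an $H$-subcomodule (a subspace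 $W$ with $\rho_V(W)\subseteq W\otimes H$). An $(H,L)$-module is irreducible if it has no nontrivial $L$-submodules that are $H$-subcomodules at the same time. *)

theory Defs
  imports Complex_Main "HOL-Library.Function_Algebras" "HOL-Library.FuncSet"
begin

section \<open>Tensor products of vector spaces over a field\<close>

text \<open>
  Vector spaces over a field type are given by their scalar multiplication, as in
  \<^theory>\<open>HOL.Vector_Spaces\<close>.  The tensor product of \<open>A\<close> and \<open>B\<close> is realised inside the dual
  of the space of bilinear forms on \<open>A \<times> B\<close>: a pure tensor is evaluation at a pair of vectors,
  and \<open>A \<otimes> B\<close> is the set of finite sums of pure tensors.  Lemmas \<open>bilinear_map_tensor\<close>,
  \<open>sweedler_sum\<close> and \<open>tensor_universal\<close> below are the universal property of the tensor product.
\<close>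

type_synonym ('f, 'a, 'b) tensor = "('a \<Rightarrow> 'b \<Rightarrow> 'f) \<Rightarrow> 'f"

definition tensor_scale :: "'f::field \<Rightarrow> ('f, 'a, 'b) tensor \<Rightarrow> ('f, 'a, 'b) tensor"
  where "tensor_scale c T = (\<lambda>\<beta>. c * T \<beta>)"

definition bilinear_map ::
  "('f::field \<Rightarrow> 'a::ab_group_add \<Rightarrow> 'a) \<Rightarrow> ('f \<Rightarrow> 'b::ab_group_add \<Rightarrow> 'b) \<Rightarrow>
   ('f \<Rightarrow> 'c::ab_group_add \<Rightarrow> 'c) \<Rightarrow> ('a \<Rightarrow> 'b \<Rightarrow> 'c) \<Rightarrow> bool"
  where "bilinear_map sA sB sC f \<longleftrightarrow>
    (\<forall>x. Vector_Spaces.linear sB sC (\<lambda>y. f x y)) \<and>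
    (\<forall>y. Vector_Spaces.linear sA sC (\<lambda>x. f x y))"

definition tensor ::
  "('f::field \<Rightarrow> 'a::ab_group_add \<Rightarrow> 'a) \<Rightarrow> ('f \<Rightarrow> 'b::ab_group_add \<Rightarrow> 'b) \<Rightarrow>
   'a \<Rightarrow> 'b \<Rightarrow> ('f, 'a, 'b) tensor"
  where "tensor sA sB x y = (\<lambda>\<beta>. if bilinear_map sA sB (*) \<beta> then \<beta> x y else 0)"

text \<open>
  For subspaces \<open>U\<close>, \<open>W\<close>, the set below is the image of \<open>U \<otimes> W\<close>; over a field the map from
  \<open>U \<otimes> W\<close> into the tensor product of the ambient spaces is injective.
\<close>

definition tensor_product ::
  "('f::field \<Rightarrow> 'a::ab_group_add \<Rightarrow> 'a) \<Rightarrow> ('f \<Rightarrow> 'b::ab_group_add \<Rightarrow> 'b) \<Rightarrow>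
   'a set \<Rightarrow> 'b set \<Rightarrow> ('f, 'a, 'b) tensor set"
  where "tensor_product sA sB U W =
    {(\<Sum>i<n. tensor sA sB (x i) (y i)) | (n::nat) x y. \<forall>i<n. x i \<in> U \<and> y i \<in> W}"

text \<open>
  Sweedler notation: if \<open>T = \<Sum>\<^sub>i x\<^sub>i \<otimes> y\<^sub>i\<close>, then \<open>sweedler sA sB f T = \<Sum>\<^sub>i f x\<^sub>i y\<^sub>i\<close>, so that
  an expression \<open>f(a\<^sub>(\<^sub>1\<^sub>), a\<^sub>(\<^sub>2\<^sub>))\<close> becomes \<open>sweedler sA sB f (\<Delta> a)\<close>.  For bilinear \<open>f\<close> the value
  does not depend on the decomposition (lemma \<open>sweedler_sum\<close>).
\<close>

definition sweedler ::
  "('f::field \<Rightarrow> 'a::ab_group_add \<Rightarrow> 'a) \<Rightarrow> ('f \<Rightarrow> 'b::ab_group_add \<Rightarrow> 'b) \<Rightarrow>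
   ('a \<Rightarrow> 'b \<Rightarrow> 'c::ab_group_add) \<Rightarrow> ('f, 'a, 'b) tensor \<Rightarrow> 'c"
  where "sweedler sA sB f T =
    (THE z. \<exists>(n::nat) x y. T = (\<Sum>i<n. tensor sA sB (x i) (y i)) \<and> z = (\<Sum>i<n. f (x i) (y i)))"

lemma sum_fun_apply: "(\<Sum>i\<in>A. g i) \<beta> = (\<Sum>i\<in>A. g i \<beta>)"
  by (induction A rule: infinite_finite_induct) auto

lemma vector_space_field: "vector_space ((*) :: 'f::field \<Rightarrow> 'f \<Rightarrow> 'f)"
  by unfold_locales (auto simp: algebra_simps)

lemma vector_space_tensor_scale:
  "vector_space (tensor_scale :: 'f::field \<Rightarrow> ('f, 'a, 'b) tensor \<Rightarrow> ('f, 'a, 'b) tensor)"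
  by unfold_locales (auto simp: tensor_scale_def fun_eq_iff algebra_simps)

lemma linear_iff_add_scale:
  "Vector_Spaces.linear s1 s2 f \<longleftrightarrow> vector_space s1 \<and> vector_space s2 \<and>
    (\<forall>x y. f (x + y) = f x + f y) \<and> (\<forall>c x. f (s1 c x) = s2 c (f x))"
  by (auto simp: Vector_Spaces.linear_def module_hom_def module_hom_axioms_def module_iff_vector_space)

lemma bilinear_map_tensor:
  assumes "vector_space sA" "vector_space sB"
  shows "bilinear_map sA sB tensor_scale (tensor sA sB)"
  unfolding bilinear_map_def linear_iff_add_scale
proof (intro allI conjI)
  show "tensor sA sB x (y + z) = tensor sA sB x y + tensor sA sB x z" for x y z
    by (rule ext) (simp add: tensor_def bilinear_map_def linear_iff_add_scale)
  show "tensor sA sB (x + z) y = tensor sA sB x y + tensor sA sB z y" for x y z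
    by (rule ext) (simp add: tensor_def bilinear_map_def linear_iff_add_scale)
  show "tensor sA sB x (sB c y) = tensor_scale c (tensor sA sB x y)" for x y c
    by (rule ext) (simp add: tensor_def tensor_scale_def bilinear_map_def linear_iff_add_scale)
  show "tensor sA sB (sA c x) y = tensor_scale c (tensor sA sB x y)" for x y c
    by (rule ext) (simp add: tensor_def tensor_scale_def bilinear_map_def linear_iff_add_scale)
qed (use assms vector_space_tensor_scale in auto)

lemma linear_functional_nonzero:
  assumes "vector_space sC" "z \<noteq> 0"
  obtains \<phi> where "Vector_Spaces.linear sC (*) \<phi>" "\<phi> z = 1"
proof -
  interpret c: vector_space sC by fact
  interpret p: vector_space_pair sC "(*)"
    by (intro vector_space_pair.intro vector_space_field assms)
  have "c.independent {z}"
    using assms(2) by simp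
  from p.linear_independent_extend[OF this, of "\<lambda>_. 1"] that show ?thesis
    by auto
qed

lemma bilinear_sum_unique:
  fixes n m :: nat
  assumes f: "bilinear_map sA sB sC f"
    and eq: "(\<Sum>i<n. tensor sA sB (x i) (y i)) = (\<Sum>i<m. tensor sA sB (x' i) (y' i))"
  shows "(\<Sum>i<n. f (x i) (y i)) = (\<Sum>i<m. f (x' i) (y' i))"
proof (rule ccontr)
  let ?u = "\<Sum>i<n. f (x i) (y i)" and ?v = "\<Sum>i<m. f (x' i) (y' i)"
  assume "?u \<noteq> ?v"
  then have ne: "?u - ?v \<noteq> 0" by simp
  have "vector_space sC"
    using f unfolding bilinear_map_def linear_iff_add_scale by blast
  from linear_functional_nonzero[OF this ne] obtain \<phi>
    where \<phi>: "Vector_Spaces.linear sC (*) \<phi>" "\<phi> (?u - ?v) = 1" .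
  interpret \<phi>: Vector_Spaces.linear sC "(*)" \<phi> by fact
  let ?\<beta> = "\<lambda>x y. \<phi> (f x y)"
  have \<beta>: "bilinear_map sA sB (*) ?\<beta>"
    using f \<phi>(1) unfolding bilinear_map_def
    by (auto simp: linear_iff_add_scale)
  have "(\<Sum>i<n. ?\<beta> (x i) (y i)) = (\<Sum>i<m. ?\<beta> (x' i) (y' i))"
    using fun_cong[OF eq, of ?\<beta>] \<beta> by (simp add: sum_fun_apply tensor_def)
  then have "\<phi> ?u = \<phi> ?v"
    by (simp add: \<phi>.sum)
  then show False
    using \<phi>(2) by (simp add: \<phi>.diff)
qed

lemma sweedler_sum:
  fixes n :: nat
  assumes "bilinear_map sA sB sC f"
  shows "sweedler sA sB f (\<Sum>i<n. tensor sA sB (x i) (y i)) = (\<Sum>i<n. f (x i) (y i))"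
  unfolding sweedler_def
proof (rule the_equality)
  fix z
  assume "\<exists>(m::nat) x' y'. (\<Sum>i<n. tensor sA sB (x i) (y i)) = (\<Sum>i<m. tensor sA sB (x' i) (y' i)) \<and>
    z = (\<Sum>i<m. f (x' i) (y' i))"
  then obtain m :: nat and x' y' where
    eq: "(\<Sum>i<n. tensor sA sB (x i) (y i)) = (\<Sum>i<m. tensor sA sB (x' i) (y' i))"
    and z: "z = (\<Sum>i<m. f (x' i) (y' i))" by blast
  show "z = (\<Sum>i<n. f (x i) (y i))"
    unfolding z by (rule bilinear_sum_unique[OF assms eq, symmetric])
qed (intro exI conjI, rule refl, rule refl)

lemma sweedler_tensor:
  assumes "bilinear_map sA sB sC f"
  shows "sweedler sA sB f (tensor sA sB x y) = f x y"
  using sweedler_sum[OF assms, where n = 1 and x = "\<lambda>_. x" and y = "\<lambda>_. y"] by simp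

lemma tensor_product_eq_span:
  assumes "vector_space sA" "vector_space sB"
  shows "tensor_product sA sB UNIV UNIV =
    module.span tensor_scale (range (\<lambda>(x, y). tensor sA sB x y))"
proof -
  interpret t: vector_space "tensor_scale :: 'a \<Rightarrow> ('a, 'b, 'c) tensor \<Rightarrow> _"
    by (rule vector_space_tensor_scale)
  have scale: "tensor_scale c (tensor sA sB x y) = tensor sA sB (sA c x) y" for c x y
    using bilinear_map_tensor[OF assms]
    unfolding bilinear_map_def linear_iff_add_scale by simp
  show ?thesis
  proof (intro set_eqI iffI)
    fix T assume "T \<in> tensor_product sA sB UNIV UNIV"
    then obtain n :: nat and x y where T: "T = (\<Sum>i<n. tensor sA sB (x i) (y i))"
      unfolding tensor_product_def by blast
    show "T \<in> t.span (range (\<lambda>(x, y). tensor sA sB x y))"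
      unfolding T by (intro t.span_sum t.span_base) auto
  next
    fix T assume "T \<in> t.span (range (\<lambda>(x, y). tensor sA sB x y))"
    then show "T \<in> tensor_product sA sB UNIV UNIV"
    proof (induction rule: t.span_induct_alt)
      case base
      show ?case
        unfolding tensor_product_def by (auto intro!: exI[of _ 0])
    next
      case (step c u T)
      then obtain x y n xs ys where u: "u = tensor sA sB x y"
        and T: "T = (\<Sum>i<n::nat. tensor sA sB (xs i) (ys i))"
        unfolding tensor_product_def by auto
      have "tensor_scale c u + T =
        (\<Sum>i<Suc n. tensor sA sB ((xs(n := sA c x)) i) ((ys(n := y)) i))"
        unfolding u T scale by (simp add: add.commute)
      then show ?case
        unfolding tensor_product_def by blast
    qed
  qed
qed

lemma tensor_universal:
  assumes f: "bilinear_map sA sB sC f"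
  shows "\<exists>g. Vector_Spaces.linear tensor_scale sC g \<and>
    (\<forall>x y. g (tensor sA sB x y) = f x y) \<and>
    (\<forall>T\<in>tensor_product sA sB UNIV UNIV. g T = sweedler sA sB f T)"
proof -
  have vs: "vector_space sA" "vector_space sB" "vector_space sC"
    using f unfolding bilinear_map_def linear_iff_add_scale by blast+
  interpret t: vector_space "tensor_scale :: 'a \<Rightarrow> ('a, 'b, 'c) tensor \<Rightarrow> _"
    by (rule vector_space_tensor_scale)
  interpret p: vector_space_pair "tensor_scale :: 'a \<Rightarrow> ('a, 'b, 'c) tensor \<Rightarrow> _" sC
    by (intro vector_space_pair.intro vector_space_tensor_scale vs)
  let ?P = "range (\<lambda>(x, y). tensor sA sB x y)"
  obtain B where B: "B \<subseteq> ?P" "t.independent B" "?P \<subseteq> t.span B"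
    using t.maximal_independent_subset by blast
  obtain g where g: "Vector_Spaces.linear tensor_scale sC g"
    and gB: "\<forall>b\<in>B. g b = sweedler sA sB f b"
    using p.linear_independent_extend[OF B(2), of "sweedler sA sB f"] by blast
  interpret g: Vector_Spaces.linear tensor_scale sC g by fact
  interpret c: vector_space sC by (fact vs)
  have bt: "bilinear_map sA sB tensor_scale (tensor sA sB)"
    by (rule bilinear_map_tensor) (use vs in auto)
  have fs: "f (sA k x) y = sC k (f x y)" for k x y
    using f unfolding bilinear_map_def linear_iff_add_scale by simp
  have ts: "tensor sA sB (sA k x) y = tensor_scale k (tensor sA sB x y)" for k x y
    using bt unfolding bilinear_map_def linear_iff_add_scale by simp
  have ex: "\<exists>n x y. T = (\<Sum>i<n::nat. tensor sA sB (x i) (y i)) \<and> g T = (\<Sum>i<n. f (x i) (y i))"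
    if "T \<in> t.span B" for T
    using that
  proof (induction rule: t.span_induct_alt)
    case base
    show ?case by (rule exI[of _ 0]) (simp only: lessThan_0 sum.empty g.zero, simp)
  next
    case (step k b T)
    from step(1) B(1) obtain x y where b: "b = tensor sA sB x y" by auto
    from step obtain n xs ys where T: "T = (\<Sum>i<n::nat. tensor sA sB (xs i) (ys i))"
      and gT: "g T = (\<Sum>i<n. f (xs i) (ys i))" by blast
    have gb: "g b = f x y"
      using gB step(1) sweedler_tensor[OF f] b by auto
    have "tensor_scale k b + T =
        (\<Sum>i<Suc n. tensor sA sB ((xs(n := sA k x)) i) ((ys(n := y)) i))"
      unfolding b T by (simp add: add.commute ts)
    moreover have "g (tensor_scale k b + T) =
        (\<Sum>i<Suc n. f ((xs(n := sA k x)) i) ((ys(n := y)) i))"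
      by (simp add: g.add g.scale gb gT fs add.commute)
    ultimately show ?case by blast
  qed
  have "t.span ?P = t.span B"
    using B by (meson subset_antisym t.span_minimal t.span_mono t.subspace_span)
  then have all: "g T = sweedler sA sB f T" if "T \<in> tensor_product sA sB UNIV UNIV" for T
    using that ex[of T] sweedler_sum[OF f] tensor_product_eq_span[OF vs(1,2)] by auto
  have "g (tensor sA sB x y) = f x y" for x y
  proof -
    have "tensor sA sB x y \<in> tensor_product sA sB UNIV UNIV"
      unfolding tensor_product_eq_span[OF vs(1,2)] by (auto intro!: t.span_base)
    from all[OF this] show ?thesis by (simp add: sweedler_tensor[OF f])
  qed
  with g all show ?thesis by blast
qed


section \<open>Hopf algebras and integrals\<close>

text \<open>
  An \<open>F\<close>-algebra is a \<^class>\<open>ring_1\<close> with a compatible scalar multiplication.  Requiring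
  \<open>0 \<noteq> 1\<close> excludes no Hopf algebra, because \<open>\<epsilon>(1) = 1\<close>.  Iterated tensor products are
  bracketed to the right.
\<close>

locale hopf_algebra = vector_space scale
  for scale :: "'f::field \<Rightarrow> 'h::ring_1 \<Rightarrow> 'h" +
  fixes comult :: "'h \<Rightarrow> ('f, 'h, 'h) tensor"
    and counit :: "'h \<Rightarrow> 'f"
    and antipode :: "'h \<Rightarrow> 'h"
  assumes scale_mult_left: "scale c (a * b) = scale c a * b"
    and scale_mult_right: "scale c (a * b) = a * scale c b"
    and comult_in: "comult a \<in> tensor_product scale scale UNIV UNIV"
    and comult_linear: "Vector_Spaces.linear scale tensor_scale comult"
    and counit_linear: "Vector_Spaces.linear scale (*) counit"
    and coassoc:
      "sweedler scale scale (\<lambda>x y. sweedler scale scale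
          (\<lambda>x1 x2. tensor scale tensor_scale x1 (tensor scale scale x2 y)) (comult x)) (comult a) =
       sweedler scale scale (\<lambda>x y. tensor scale tensor_scale x (comult y)) (comult a)"
    and counit_left: "sweedler scale scale (\<lambda>x y. scale (counit x) y) (comult a) = a"
    and counit_right: "sweedler scale scale (\<lambda>x y. scale (counit y) x) (comult a) = a"
    and comult_one: "comult 1 = tensor scale scale 1 1"
    and comult_mult:
      "comult (a * b) =
       sweedler scale scale (\<lambda>a1 a2. sweedler scale scale
          (\<lambda>b1 b2. tensor scale scale (a1 * b1) (a2 * b2)) (comult b)) (comult a)"
    and counit_one: "counit 1 = 1"
    and counit_mult: "counit (a * b) = counit a * counit b"
    and antipode_linear: "Vector_Spaces.linear scale scale antipode"
    and antipode_left:
      "sweedler scale scale (\<lambda>x y. antipode x * y) (comult a) = scale (counit a) 1"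
    and antipode_right:
      "sweedler scale scale (\<lambda>x y. x * antipode y) (comult a) = scale (counit a) 1"

definition left_integral ::
  "('f::field \<Rightarrow> 'h::ring_1 \<Rightarrow> 'h) \<Rightarrow> ('h \<Rightarrow> ('f, 'h, 'h) tensor) \<Rightarrow> ('h \<Rightarrow> 'f) \<Rightarrow> bool"
  where "left_integral sH \<Delta> t \<longleftrightarrow> Vector_Spaces.linear sH (*) t \<and>
    (\<forall>a. sweedler sH sH (\<lambda>a1 a2. sH (t a2) a1) (\<Delta> a) = sH (t a) 1)"

definition ad_invariant ::
  "('f::field \<Rightarrow> 'h::ring_1 \<Rightarrow> 'h) \<Rightarrow> ('h \<Rightarrow> ('f, 'h, 'h) tensor) \<Rightarrow> ('h \<Rightarrow> 'f) \<Rightarrow>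
   ('h \<Rightarrow> 'h) \<Rightarrow> ('h \<Rightarrow> 'f) \<Rightarrow> bool"
  where "ad_invariant sH \<Delta> \<epsilon> S t \<longleftrightarrow>
    (\<forall>a b. sweedler sH sH (\<lambda>a1 a2. t (a1 * b * S a2)) (\<Delta> a) = \<epsilon> a * t b)"


section \<open>Right comodules\<close>

locale hopf_comodule = hopf_algebra sH \<Delta> \<epsilon> S + V: vector_space sV
  for sH :: "'f::field \<Rightarrow> 'h::ring_1 \<Rightarrow> 'h"
    and \<Delta> :: "'h \<Rightarrow> ('f, 'h, 'h) tensor"
    and \<epsilon> :: "'h \<Rightarrow> 'f"
    and S :: "'h \<Rightarrow> 'h"
    and sV :: "'f \<Rightarrow> 'v::ab_group_add \<Rightarrow> 'v" +
  fixes \<rho> :: "'v \<Rightarrow> ('f, 'v, 'h) tensor"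
  assumes coact_in: "\<rho> v \<in> tensor_product sV sH UNIV UNIV"
    and coact_linear: "Vector_Spaces.linear sV tensor_scale \<rho>"
    and coact_coassoc:
      "sweedler sV sH (\<lambda>w h. sweedler sV sH
          (\<lambda>w0 w1. tensor sV tensor_scale w0 (tensor sH sH w1 h)) (\<rho> w)) (\<rho> v) =
       sweedler sV sH (\<lambda>w h. tensor sV tensor_scale w (\<Delta> h)) (\<rho> v)"
    and coact_counit: "sweedler sV sH (\<lambda>w h. sV (\<epsilon> h) w) (\<rho> v) = v"


section \<open>Lie algebras\<close>

definition finite_dimensional ::
  "('f::field \<Rightarrow> 'v::ab_group_add \<Rightarrow> 'v) \<Rightarrow> bool"
  where "finite_dimensional s \<longleftrightarrow> (\<exists>B. finite_dimensional_vector_space s B)"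

locale lie_algebra = vector_space scale
  for scale :: "'f::field \<Rightarrow> 'l::ab_group_add \<Rightarrow> 'l" +
  fixes bracket :: "'l \<Rightarrow> 'l \<Rightarrow> 'l"
  assumes bracket_bilinear: "bilinear_map scale scale scale bracket"
    and bracket_alternating: "bracket x x = 0"
    and jacobi: "bracket x (bracket y z) + bracket y (bracket z x) + bracket z (bracket x y) = 0"

definition lie_ideal ::
  "('f::field \<Rightarrow> 'l::ab_group_add \<Rightarrow> 'l) \<Rightarrow> ('l \<Rightarrow> 'l \<Rightarrow> 'l) \<Rightarrow> 'l set \<Rightarrow> bool"
  where "lie_ideal sL br I \<longleftrightarrow> module.subspace sL I \<and> (\<forall>x. \<forall>y\<in>I. br x y \<in> I)"

fun derived_series ::
  "('f::field \<Rightarrow> 'l::ab_group_add \<Rightarrow> 'l) \<Rightarrow> ('l \<Rightarrow> 'l \<Rightarrow> 'l) \<Rightarrow> 'l set \<Rightarrow> nat \<Rightarrow> 'l set"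
  where
    "derived_series sL br I 0 = I"
  | "derived_series sL br I (Suc n) =
      module.span sL {br x y | x y. x \<in> derived_series sL br I n \<and> y \<in> derived_series sL br I n}"

definition lie_solvable ::
  "('f::field \<Rightarrow> 'l::ab_group_add \<Rightarrow> 'l) \<Rightarrow> ('l \<Rightarrow> 'l \<Rightarrow> 'l) \<Rightarrow> 'l set \<Rightarrow> bool"
  where "lie_solvable sL br I \<longleftrightarrow> (\<exists>n. derived_series sL br I n = {0})"

text \<open>Semisimple means that the solvable radical is zero; the zero algebra is semisimple.\<close>

definition lie_semisimple ::
  "('f::field \<Rightarrow> 'l::ab_group_add \<Rightarrow> 'l) \<Rightarrow> ('l \<Rightarrow> 'l \<Rightarrow> 'l) \<Rightarrow> bool"
  where "lie_semisimple sL br \<longleftrightarrow>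
    (\<forall>I. lie_ideal sL br I \<and> lie_solvable sL br I \<longrightarrow> I = {0})"

locale comodule_lie_algebra =
  hopf_comodule sH \<Delta> \<epsilon> S sL \<rho>L + L: lie_algebra sL br
  for sH :: "'f::field \<Rightarrow> 'h::ring_1 \<Rightarrow> 'h"
    and \<Delta> :: "'h \<Rightarrow> ('f, 'h, 'h) tensor"
    and \<epsilon> :: "'h \<Rightarrow> 'f"
    and S :: "'h \<Rightarrow> 'h"
    and sL :: "'f \<Rightarrow> 'l::ab_group_add \<Rightarrow> 'l"
    and br :: "'l \<Rightarrow> 'l \<Rightarrow> 'l"
    and \<rho>L :: "'l \<Rightarrow> ('f, 'l, 'h) tensor" +
  assumes coact_bracket:
    "\<rho>L (br a b) =
     sweedler sL sH (\<lambda>a0 a1. sweedler sL sH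
        (\<lambda>b0 b1. tensor sL sH (br a0 b0) (a1 * b1)) (\<rho>L b)) (\<rho>L a)"


section \<open>Modules with compatible coaction\<close>

locale lie_representation = L: lie_algebra sL br + V: vector_space sV
  for sL :: "'f::field \<Rightarrow> 'l::ab_group_add \<Rightarrow> 'l"
    and br :: "'l \<Rightarrow> 'l \<Rightarrow> 'l"
    and sV :: "'f \<Rightarrow> 'v::ab_group_add \<Rightarrow> 'v" +
  fixes \<psi> :: "'l \<Rightarrow> 'v \<Rightarrow> 'v"
  assumes rep_bilinear: "bilinear_map sL sV sV \<psi>"
    and rep_bracket: "\<psi> (br a b) v = \<psi> a (\<psi> b v) - \<psi> b (\<psi> a v)"

locale HL_module =
  L: comodule_lie_algebra sH \<Delta> \<epsilon> S sL br \<rho>L +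
  V: hopf_comodule sH \<Delta> \<epsilon> S sV \<rho>V +
  rep: lie_representation sL br sV \<psi>
  for sH :: "'f::field \<Rightarrow> 'h::ring_1 \<Rightarrow> 'h"
    and \<Delta> :: "'h \<Rightarrow> ('f, 'h, 'h) tensor"
    and \<epsilon> :: "'h \<Rightarrow> 'f"
    and S :: "'h \<Rightarrow> 'h"
    and sL :: "'f \<Rightarrow> 'l::ab_group_add \<Rightarrow> 'l"
    and br :: "'l \<Rightarrow> 'l \<Rightarrow> 'l"
    and \<rho>L :: "'l \<Rightarrow> ('f, 'l, 'h) tensor"
    and sV :: "'f \<Rightarrow> 'v::ab_group_add \<Rightarrow> 'v"
    and \<rho>V :: "'v \<Rightarrow> ('f, 'v, 'h) tensor"
    and \<psi> :: "'l \<Rightarrow> 'v \<Rightarrow> 'v" +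
  assumes coact_rep:
    "\<rho>V (\<psi> a v) =
     sweedler sL sH (\<lambda>a0 a1. sweedler sV sH
        (\<lambda>v0 v1. tensor sV sH (\<psi> a0 v0) (a1 * v1)) (\<rho>V v)) (\<rho>L a)"

definition HL_submodule ::
  "('f::field \<Rightarrow> 'h::ring_1 \<Rightarrow> 'h) \<Rightarrow> ('f \<Rightarrow> 'v::ab_group_add \<Rightarrow> 'v) \<Rightarrow>
   ('v \<Rightarrow> ('f, 'v, 'h) tensor) \<Rightarrow> ('l \<Rightarrow> 'v \<Rightarrow> 'v) \<Rightarrow> 'v set \<Rightarrow> bool"
  where "HL_submodule sH sV \<rho>V \<psi> W \<longleftrightarrow> module.subspace sV W \<and>
    (\<forall>a. \<forall>w\<in>W. \<psi> a w \<in> W) \<and>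
    (\<forall>w\<in>W. \<rho>V w \<in> tensor_product sV sH W UNIV)"

text \<open>
  As usual, an irreducible module is required to be nonzero.  The submodules of the module \<open>W\<close>
  are the submodules of the ambient module that are contained in \<open>W\<close>.
\<close>

definition irreducible_HL_submodule ::
  "('f::field \<Rightarrow> 'h::ring_1 \<Rightarrow> 'h) \<Rightarrow> ('f \<Rightarrow> 'v::ab_group_add \<Rightarrow> 'v) \<Rightarrow>
   ('v \<Rightarrow> ('f, 'v, 'h) tensor) \<Rightarrow> ('l \<Rightarrow> 'v \<Rightarrow> 'v) \<Rightarrow> 'v set \<Rightarrow> bool"
  where "irreducible_HL_submodule sH sV \<rho>V \<psi> W \<longleftrightarrow>
    HL_submodule sH sV \<rho>V \<psi> W \<and> W \<noteq> {0} \<and>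
    (\<forall>U. U \<subseteq> W \<and> HL_submodule sH sV \<rho>V \<psi> U \<longrightarrow> U = {0} \<or> U = W)"

text \<open>The whole space is the (internal) direct sum of a finite family; for \<open>s = 0\<close> it is zero.\<close>

definition direct_sum :: "nat \<Rightarrow> (nat \<Rightarrow> 'v::ab_group_add set) \<Rightarrow> bool"
  where "direct_sum s W \<longleftrightarrow> (\<forall>v. \<exists>!w. w \<in> (\<Pi>\<^sub>E i\<in>{..<s}. W i) \<and> v = (\<Sum>i<s. w i))"

end

theory Submission
  imports Defs "HOL-Algebra.Algebraic_Closure_Type"
begin

text \<open>
  Weyl's theorem gives an \<open>L\<close>-linear projection \<open>P\<close> of \<open>V\<close> onto a given \<open>(H,L)\<close>-submodule \<open>W\<close>.  If \<open>c\<close> is the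
  matrix of coefficients of the comodule \<open>V\<close>, with entries in \<open>H\<close>, then \<open>S(c)\<close> is its inverse, and applying
  \<open>t\<close> to the entries of \<open>c P S(c)\<close> gives a projection onto \<open>W\<close> which is a comodule map because \<open>t\<close> is
  a left integral, and still \<open>L\<close>-linear because \<open>t\<close> is ad-invariant.  So \<open>W\<close> has a complement.

  Weyl's theorem holds over every field of characteristic \<open>0\<close>: the Casimir element of the trace form is
  not nilpotent, and its generalised kernel is used in place of a decomposition into irreducible modules.
  Nondegeneracy of the form is Cartan's criterion, for which operators are extended to the algebraic
  closure \<open>K\<close>.  There an operator \<open>x\<close> with eigenvalues \<open>a\<close> is compared with the operator \<open>y\<close> which is \<open>f a\<close> on
  the generalised eigenspace of \<open>a\<close>, for a \<open>\<rat>\<close>-linear \<open>f : K \<rightarrow> \<rat>\<close>: since \<open>ad y\<close> is a polynomial in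
  \<open>ad x\<close>, one gets \<open>tr (x y) = 0\<close> and thus \<open>f a = 0\<close>.
\<close>

section \<open>Linear algebra\<close>

text \<open>Weyl's theorem is derived from modules made of operators, which lie in the possibly
  infinite dimensional space of all maps. Hence subspaces and modules are sets, the trace is set up
  for finite rank operators on any space, and a projection onto a module extends its action to the
  whole type. Over a field that is not algebraically closed a Casimir element need not act as a
  scalar on an irreducible module, so only its nonzero trace is used. The functionals f are rational
  valued because the final identity is a sum of terms \<open>f a * f a\<close> times a rank, and
  positivity makes each term vanish. Why averaging works: on \<open>W\<close> the product c P S(c)
  is c S(c) = 1, since P fixes \<open>W\<close> and c preserves it, so t(1) = 1 gives the identity
  on \<open>W\<close>. Let d be the coefficient matrix of \<open>L\<close>. Compatibility of the
  coactions exchanges the action with c at the cost of entries of d on the left, and with S(c) at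
  the cost of entries of S(d) on the right, because S reverses products. Ad-invariance collapses t(d
  x S(d)) to t(x).\<close>

text \<open>A copy of \<^locale>\<open>vector_space\<close>: definitions made in the original would be propagated to its
  global interpretations and shadow themselves there.\<close>
locale vec_space = vector_space scale
  for scale :: "'a::field \<Rightarrow> 'b::ab_group_add \<Rightarrow> 'b"
begin

abbreviation lin :: "('b \<Rightarrow> 'b) \<Rightarrow> bool"
  where "lin \<equiv> Vector_Spaces.linear scale scale"

abbreviation functional :: "('b \<Rightarrow> 'a) \<Rightarrow> bool"
  where "functional \<equiv> Vector_Spaces.linear scale (*)"

lemma lin_iff: "lin T \<longleftrightarrow> (\<forall>x y. T (x + y) = T x + T y) \<and> (\<forall>c x. T (scale c x) = scale c (T x))"
  by (simp add: linear_iff_add_scale vector_space_axioms)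

lemma functional_iff: "functional \<phi> \<longleftrightarrow>
    (\<forall>x y. \<phi> (x + y) = \<phi> x + \<phi> y) \<and> (\<forall>c x. \<phi> (scale c x) = c * \<phi> x)"
  by (simp add: linear_iff_add_scale vector_space_axioms vector_space_field)

lemma lin_0: "lin T \<Longrightarrow> T 0 = 0"
  by (metis add_cancel_right_right lin_iff)

lemma lin_diff: "lin T \<Longrightarrow> T (x - y) = T x - T y"
  by (metis diff_eq_eq lin_iff)

lemma lin_sum: "lin T \<Longrightarrow> T (sum f A) = (\<Sum>a\<in>A. T (f a))"
  by (induction A rule: infinite_finite_induct) (auto simp: lin_0 lin_iff)

lemma functional_0: "functional T \<Longrightarrow> T 0 = 0"
  by (metis add_cancel_right_right functional_iff)

lemma functional_sum: "functional T \<Longrightarrow> T (sum f A) = (\<Sum>a\<in>A. T (f a))"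
  by (induction A rule: infinite_finite_induct) (auto simp: functional_0 functional_iff)

definition fin_dim :: "'b set \<Rightarrow> bool"
  where "fin_dim U \<longleftrightarrow> (\<exists>S. finite S \<and> U \<subseteq> span S)"

lemma fin_dim_subset: "fin_dim W \<Longrightarrow> U \<subseteq> W \<Longrightarrow> fin_dim U"
  unfolding fin_dim_def by blast

lemma fin_dim_Un: "fin_dim U \<Longrightarrow> fin_dim W \<Longrightarrow> fin_dim (U \<union> W)"
proof -
  assume "fin_dim U" "fin_dim W"
  then obtain S S' where S: "finite S" "U \<subseteq> span S" "finite S'" "W \<subseteq> span S'"
    unfolding fin_dim_def by blast
  have "U \<union> W \<subseteq> span (S \<union> S')"
    using S(2,4) span_mono[of S "S \<union> S'"] span_mono[of S' "S \<union> S'"] by blast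
  with S(1,3) show ?thesis unfolding fin_dim_def by blast
qed

lemma fin_dim_span: "fin_dim U \<Longrightarrow> fin_dim (span U)"
  unfolding fin_dim_def by (meson span_minimal subspace_span)

lemma fin_dim_independent:
  assumes "fin_dim U" "independent B" "B \<subseteq> U"
  shows "finite B"
  using assms unfolding fin_dim_def by (meson independent_span_bound order_trans)

lemma fin_dim_basis:
  assumes "fin_dim U" "subspace U"
  obtains B where "finite B" "independent B" "span B = U" "B \<subseteq> U" "card B = dim U"
proof -
  from basis_exists[of U] obtain B where B: "B \<subseteq> U" "independent B" "U \<subseteq> span B" "card B = dim U"
    by blast
  then have "span B = U"
    using assms(2) by (simp add: span_minimal subset_antisym)
  with B fin_dim_independent[OF assms(1) B(2,1)] that show ?thesis by blast
qed

lemma dim_mono_fin: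
  assumes "fin_dim W" "U \<subseteq> W"
  shows "dim U \<le> dim W"
proof -
  obtain C where C: "C \<subseteq> W" "independent C" "W \<subseteq> span C" "card C = dim W"
    by (rule basis_exists)
  show ?thesis
    using dim_le_card[of U C] C assms fin_dim_independent[OF assms(1) C(2,1)] by simp
qed

lemma subspace_dim_less:
  assumes "fin_dim W" "subspace U" "subspace W" "U \<subset> W"
  shows "dim U < dim W"
proof -
  from assms(4) obtain w where w: "w \<in> W" "w \<notin> U" by blast
  obtain B where B: "finite B" "independent B" "span B = U" "B \<subseteq> U" "card B = dim U"
    using fin_dim_basis[OF fin_dim_subset[OF assms(1)] assms(2)] assms(4) by blast
  have ind: "independent (insert w B)" using w B by (simp add: independent_insertI)
  have "dim (insert w B) = Suc (dim U)"
  proof -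
    have "w \<notin> B" using w B span_base by blast
    then show ?thesis using B(1,5) by (subst dim_eq_card_independent[OF ind]) simp
  qed
  moreover have "dim (insert w B) \<le> dim W"
    by (rule dim_mono_fin[OF assms(1)]) (use w B assms(4) in auto)
  ultimately show ?thesis by simp
qed

lemma exists_projection:
  assumes "subspace U"
  obtains e where "lin e" "\<forall>v. e v \<in> U" "\<forall>u\<in>U. e u = u"
proof -
  obtain B where B: "B \<subseteq> U" "independent B" "U \<subseteq> span B" "card B = dim U"
    by (rule basis_exists)
  interpret p: vector_space_pair scale scale by unfold_locales
  let ?e = "p.construct B (\<lambda>b. b)"
  have l: "lin ?e" by (rule p.linear_construct[OF B(2)])
  have "?e v \<in> U" for v
    using p.construct_in_span[OF B(2), of "\<lambda>b. b" v] span_minimal[OF B(1) assms] by auto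
  moreover have "?e u = u" if "u \<in> U" for u
  proof -
    have "u \<in> span B" using that B by blast
    then show ?thesis
    proof (induction rule: span_induct_alt)
      case base show ?case by (rule lin_0[OF l])
    next
      case (step c x y)
      then show ?case
        using p.construct_basis[OF B(2), of x "\<lambda>b. b"] l by (simp add: lin_iff)
    qed
  qed
  ultimately show ?thesis using that l by blast
qed

section \<open>Finite rank operators and their trace\<close>

definition finrank :: "('b \<Rightarrow> 'b) \<Rightarrow> bool"
  where "finrank T \<longleftrightarrow> lin T \<and> fin_dim (range T)"

text \<open>Coordinates in one fixed basis of the whole space; \<open>extend_basis {}\<close> is
  such a basis and may be infinite.\<close>

definition coord :: "'b \<Rightarrow> 'b \<Rightarrow> 'a"
  where "coord b v = representation (extend_basis {}) v b"

text \<open>The sum of the diagonal entries in that fixed basis. For finite rank only finitely many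
  are nonzero (\<open>finrank_coord_support\<close>), and \<open>trace_basis\<close> gives
  independence of the basis; an infinite sum would default to 0.\<close>

definition trace :: "('b \<Rightarrow> 'b) \<Rightarrow> 'a"
  where "trace T = (\<Sum>b | coord b (T b) \<noteq> 0. coord b (T b))"

lemma finrankI: "lin T \<Longrightarrow> (\<And>v. T v \<in> U) \<Longrightarrow> fin_dim U \<Longrightarrow> finrank T"
  unfolding finrank_def by (metis fin_dim_subset image_subsetI)

lemma basis_UNIV: "independent (extend_basis {})" "span (extend_basis {}) = UNIV"
  using independent_extend_basis[of "{}"] span_extend_basis[of "{}"] by (auto simp: independent_empty)

lemma functional_coord: "functional (coord b)"
  unfolding functional_iff coord_def
  using representation_add[OF basis_UNIV(1)] representation_scale[OF basis_UNIV(1)]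
  by (simp add: basis_UNIV)

lemma finite_coord: "finite {b. coord b v \<noteq> 0}"
  unfolding coord_def by (rule finite_representation)

lemma sum_coord:
  assumes "finite D" "{b. coord b v \<noteq> 0} \<subseteq> D"
  shows "(\<Sum>b\<in>D. scale (coord b v) b) = v"
proof -
  have "(\<Sum>b\<in>D. scale (coord b v) b) = (\<Sum>b | coord b v \<noteq> 0. scale (coord b v) b)"
    by (rule sum.mono_neutral_right) (use assms in auto)
  also have "\<dots> = v"
    using sum_nonzero_representation_eq[OF basis_UNIV(1), of v]
    by (simp add: basis_UNIV coord_def)
  finally show ?thesis .
qed

lemma trace_superset:
  assumes "finite D" "{b. coord b (T b) \<noteq> 0} \<subseteq> D"
  shows "trace T = (\<Sum>b\<in>D. coord b (T b))"
  unfolding trace_def by (rule sum.mono_neutral_left) (use assms in auto)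

text \<open>The contraction of a sum of functional-vector pairs: expand each \<open>w i\<close> in
  the fixed basis and exchange the two sums. This frees the trace from the chosen basis.\<close>

lemma trace_dyads:
  assumes "finite I" "\<And>i. i \<in> I \<Longrightarrow> functional (\<phi> i)"
  shows "trace (\<lambda>v. \<Sum>i\<in>I. scale (\<phi> i v) (w i)) = (\<Sum>i\<in>I. \<phi> i (w i))"
proof -
  define D where "D = (\<Union>i\<in>I. {b. coord b (w i) \<noteq> 0})"
  have D: "finite D" unfolding D_def using assms(1) finite_coord by auto
  have co: "coord b (\<Sum>i\<in>I. scale (\<phi> i v) (w i)) = (\<Sum>i\<in>I. \<phi> i v * coord b (w i))" for b v
    using functional_coord[of b] by (simp add: functional_sum functional_iff)
  have "trace (\<lambda>v. \<Sum>i\<in>I. scale (\<phi> i v) (w i)) = (\<Sum>b\<in>D. \<Sum>i\<in>I. \<phi> i b * coord b (w i))"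
    unfolding co[symmetric]
  proof (rule trace_superset[OF D])
    show "{b. coord b (\<Sum>i\<in>I. scale (\<phi> i b) (w i)) \<noteq> 0} \<subseteq> D"
    proof
      fix b assume "b \<in> {b. coord b (\<Sum>i\<in>I. scale (\<phi> i b) (w i)) \<noteq> 0}"
      then have "(\<Sum>i\<in>I. \<phi> i b * coord b (w i)) \<noteq> 0" by (simp add: co)
      then obtain i where "i \<in> I" "\<phi> i b * coord b (w i) \<noteq> 0" using sum.not_neutral_contains_not_neutral by blast
      then show "b \<in> D" unfolding D_def by auto
    qed
  qed
  also have "\<dots> = (\<Sum>i\<in>I. \<Sum>b\<in>D. \<phi> i b * coord b (w i))" by (rule sum.swap)
  also have "\<dots> = (\<Sum>i\<in>I. \<phi> i (w i))"
  proof (rule sum.cong[OF refl])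
    fix i assume i: "i \<in> I"
    have "\<phi> i (w i) = \<phi> i (\<Sum>b\<in>D. scale (coord b (w i)) b)"
      by (subst sum_coord[OF D]) (use i D_def in auto)
    also have "\<dots> = (\<Sum>b\<in>D. \<phi> i b * coord b (w i))"
      using assms(2)[OF i] by (simp add: functional_sum functional_iff mult.commute)
    finally show "(\<Sum>b\<in>D. \<phi> i b * coord b (w i)) = \<phi> i (w i)" by simp
  qed
  finally show ?thesis .
qed

lemma functional_representation:
  assumes "independent S" "lin T" "\<And>v. T v \<in> span S"
  shows "functional (\<lambda>v. representation S (T v) s)"
  using assms representation_add[OF assms(1)] representation_scale[OF assms(1)]
  unfolding functional_iff lin_iff by simp

lemma finrank_dyads:
  assumes "finite S" "independent S" "\<And>v. T v \<in> span S"
  shows "T = (\<lambda>v. \<Sum>s\<in>S. scale (representation S (T v) s) s)"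
  using sum_representation_eq[OF assms(2,3,1)] by auto

lemma trace_basis:
  assumes "finite S" "independent S" "lin T" "\<And>v. T v \<in> span S"
  shows "trace T = (\<Sum>s\<in>S. representation S (T s) s)"
  by (subst finrank_dyads[OF assms(1,2,4)], rule trace_dyads[OF assms(1)])
    (rule functional_representation[OF assms(2-4)])

lemma finrank_basis:
  assumes "finrank T"
  obtains S where "finite S" "independent S" "span S = range T"
proof -
  interpret T: Vector_Spaces.linear scale scale T using assms finrank_def by blast
  from T.subspace_image[OF subspace_UNIV] fin_dim_basis[of "range T"] assms finrank_def
  show ?thesis using that by metis
qed

text \<open>With \<open>T\<close> written as a sum of dyads over a basis of its range, both products
  are again sums of dyads and have the same contraction.\<close>

lemma trace_commute:
  assumes "lin A" "finrank T"
  shows "trace (\<lambda>v. A (T v)) = trace (\<lambda>v. T (A v))"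
proof -
  obtain S where S': "finite S" "independent S" "span S = range T"
    by (rule finrank_basis[OF assms(2)])
  then have S: "finite S" "independent S" "\<And>v. T v \<in> span S" by simp_all
  let ?\<phi> = "\<lambda>s v. representation S (T v) s"
  have lT: "lin T" using assms(2) finrank_def by blast
  have f: "functional (?\<phi> s)" for s
    by (rule functional_representation) (use S lT in auto)
  have T: "T = (\<lambda>v. \<Sum>s\<in>S. scale (?\<phi> s v) s)" by (rule finrank_dyads[OF S(1-3)])
  have "(\<lambda>v. A (T v)) = (\<lambda>v. \<Sum>s\<in>S. scale (?\<phi> s v) (A s))"
    by (subst T) (use assms(1) in \<open>simp add: lin_sum lin_iff fun_eq_iff\<close>)
  then have 1: "trace (\<lambda>v. A (T v)) = (\<Sum>s\<in>S. ?\<phi> s (A s))"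
    using trace_dyads[OF S(1), of ?\<phi> A] f by simp
  have "(\<lambda>v. T (A v)) = (\<lambda>v. \<Sum>s\<in>S. scale (?\<phi> s (A v)) s)"
    by (subst T) simp
  moreover have "functional (\<lambda>v. ?\<phi> s (A v))" for s
    using f[of s] assms(1) unfolding functional_iff lin_iff by simp
  ultimately have "trace (\<lambda>v. T (A v)) = (\<Sum>s\<in>S. ?\<phi> s (A s))"
    using trace_dyads[OF S(1), of "\<lambda>s v. ?\<phi> s (A v)" "\<lambda>s. s"] by simp
  with 1 show ?thesis by simp
qed

lemma finrank_add: "finrank A \<Longrightarrow> finrank B \<Longrightarrow> finrank (\<lambda>v. A v + B v)"
  unfolding finrank_def
proof (intro conjI)
  assume *: "lin A \<and> fin_dim (range A)" "lin B \<and> fin_dim (range B)"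
  then show "lin (\<lambda>v. A v + B v)" by (simp add: lin_iff scale_right_distrib)
  have "fin_dim (span (range A \<union> range B))" using * by (intro fin_dim_span fin_dim_Un) auto
  then show "fin_dim (range (\<lambda>v. A v + B v))"
    by (rule fin_dim_subset) (auto intro!: span_add intro: span_base)
qed

lemma finrank_scale: "finrank A \<Longrightarrow> finrank (\<lambda>v. scale c (A v))"
  unfolding finrank_def
proof (intro conjI)
  assume *: "lin A \<and> fin_dim (range A)"
  then show "lin (\<lambda>v. scale c (A v))" by (simp add: lin_iff scale_right_distrib mult.commute)
  have "fin_dim (span (range A))" using * by (intro fin_dim_span) auto
  then show "fin_dim (range (\<lambda>v. scale c (A v)))"
    by (rule fin_dim_subset) (auto intro!: span_scale intro: span_base)
qed

lemma finrank_zero: "finrank (\<lambda>v. 0)"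
  by (rule finrankI[of _ "{0}"]) (auto simp: lin_iff fin_dim_def intro!: exI[of _ "{}"])

lemma finrank_diff: "finrank A \<Longrightarrow> finrank B \<Longrightarrow> finrank (\<lambda>v. A v - B v)"
  using finrank_add[of A "\<lambda>v. scale (-1) (B v)"] finrank_scale[of B "-1"] by simp

lemma finrank_sum: "(\<And>i. i \<in> I \<Longrightarrow> finrank (A i)) \<Longrightarrow> finrank (\<lambda>v. \<Sum>i\<in>I. A i v)"
  by (induction I rule: infinite_finite_induct) (auto simp: finrank_zero intro: finrank_add)

lemma finrank_comp: "lin A \<Longrightarrow> finrank B \<Longrightarrow> finrank (\<lambda>v. A (B v))"
proof -
  assume *: "lin A" "finrank B"
  then obtain S where S: "finite S" "range B \<subseteq> span S" unfolding finrank_def fin_dim_def by blast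
  interpret A: Vector_Spaces.linear scale scale A by fact
  have "range (\<lambda>v. A (B v)) \<subseteq> span (A ` S)" using S(2) by (auto simp: A.span_image)
  moreover have "lin (\<lambda>v. A (B v))" using * by (simp add: finrank_def lin_iff)
  ultimately show ?thesis using S(1) unfolding finrank_def fin_dim_def by blast
qed

lemma finrank_comp2: "finrank A \<Longrightarrow> lin B \<Longrightarrow> finrank (\<lambda>v. A (B v))"
  unfolding finrank_def lin_iff by (auto intro: fin_dim_subset)

lemma finrank_lin: "finrank A \<Longrightarrow> lin A"
  by (simp add: finrank_def)

text \<open>The set depends on the range only, so traces of several operators can be computed over
  one finite index set.\<close>

lemma finrank_coord_support:
  assumes "finrank T"
  obtains D where "finite D" "\<forall>v b. b \<notin> D \<longrightarrow> coord b (T v) = 0"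
proof -
  obtain S where S': "finite S" "independent S" "span S = range T"
    by (rule finrank_basis[OF assms])
  then have S: "finite S" "independent S" "\<And>v. T v \<in> span S" by simp_all
  define D where "D = (\<Union>s\<in>S. {b. coord b s \<noteq> 0})"
  have "finite D" unfolding D_def using S(1) finite_coord by auto
  moreover have "coord b x = 0" if "b \<notin> D" "x \<in> span S" for b x
    using that(2)
  proof (induction rule: span_induct_alt)
    case base show ?case by (rule functional_0[OF functional_coord])
  next
    case (step c x y)
    then show ?case using functional_coord[of b] that(1) by (auto simp: functional_iff D_def)
  qed
  ultimately show ?thesis using that S(3) by blast
qed

lemma trace_add: "finrank A \<Longrightarrow> finrank B \<Longrightarrow> trace (\<lambda>v. A v + B v) = trace A + trace B"
proof -
  assume *: "finrank A" "finrank B"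
  obtain D where D: "finite D" "\<forall>v b. b \<notin> D \<longrightarrow> coord b (A v) = 0"
    by (rule finrank_coord_support[OF *(1)])
  obtain E where E: "finite E" "\<forall>v b. b \<notin> E \<longrightarrow> coord b (B v) = 0"
    by (rule finrank_coord_support[OF *(2)])
  have a: "coord b (x + y) = coord b x + coord b y" for b x y
    using functional_coord functional_iff by blast
  have "coord b (A b + B b) = 0" if "b \<notin> D \<union> E" for b
    using that D(2) E(2) by (simp add: a)
  then have "trace (\<lambda>v. A v + B v) = (\<Sum>b\<in>D\<union>E. coord b (A b + B b))"
    using D(1) E(1) by (intro trace_superset) blast+
  also have "\<dots> = trace A + trace B"
    unfolding a sum.distrib
    using trace_superset[of "D \<union> E" A] trace_superset[of "D \<union> E" B] D E by fastforce
  finally show ?thesis .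
qed

lemma trace_scale: "finrank A \<Longrightarrow> trace (\<lambda>v. scale c (A v)) = c * trace A"
proof -
  assume *: "finrank A"
  obtain D where D: "finite D" "\<forall>v b. b \<notin> D \<longrightarrow> coord b (A v) = 0"
    by (rule finrank_coord_support[OF *])
  have a: "coord b (scale c x) = c * coord b x" for b x
    using functional_coord functional_iff by blast
  have "{b. coord b (scale c (A b)) \<noteq> 0} \<subseteq> D" "{b. coord b (A b) \<noteq> 0} \<subseteq> D"
    using D(2) by (auto simp: a)
  then show ?thesis
    by (simp add: trace_superset[OF D(1)] a sum_distrib_left)
qed

lemma trace_zero: "trace (\<lambda>v. 0) = 0"
  using trace_scale[OF finrank_zero, of 0] by simp

lemma trace_diff: "finrank A \<Longrightarrow> finrank B \<Longrightarrow> trace (\<lambda>v. A v - B v) = trace A - trace B"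
  using trace_add[of A "\<lambda>v. scale (-1) (B v)"] finrank_scale[of B "-1"] trace_scale[of B "-1"] by simp

lemma trace_sum: "(\<And>i. i \<in> I \<Longrightarrow> finrank (A i)) \<Longrightarrow> trace (\<lambda>v. \<Sum>i\<in>I. A i v) = (\<Sum>i\<in>I. trace (A i))"
  by (induction I rule: infinite_finite_induct) (auto simp: trace_zero trace_add finrank_sum)

text \<open>A basis of the range consists of fixed vectors, so the trace counts them. That the value
  is a natural number, positive for a nonzero operator, is what the sum of squares argument later
  needs.\<close>

lemma trace_idempotent:
  assumes "finrank e" "\<And>v. e (e v) = e v"
  obtains r :: nat where "trace e = of_nat r" "r = 0 \<Longrightarrow> \<forall>v. e v = 0"
proof -
  obtain S where S': "finite S" "independent S" "span S = range e"
    by (rule finrank_basis[OF assms(1)])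
  then have S: "finite S" "independent S" "\<And>v. e v \<in> span S" "span S = range e" by simp_all
  have es: "e s = s" if "s \<in> S" for s
    using assms(2) span_base[OF that] S(4) by auto
  have "trace e = (\<Sum>s\<in>S. representation S (e s) s)"
    by (rule trace_basis) (use S assms finrank_def in auto)
  also have "\<dots> = (\<Sum>s\<in>S. 1)"
    by (rule sum.cong) (use es S(2) in \<open>auto simp: representation_basis\<close>)
  finally have "trace e = of_nat (card S)" by simp
  moreover have "\<forall>v. e v = 0" if "card S = 0"
  proof -
    have "S = {}" using that S(1) by simp
    then show ?thesis using S(3) by simp
  qed
  ultimately show ?thesis by (rule that)
qed

text \<open>If \<open>e\<close> is a projection onto the range of \<open>T\<close>, then \<open>tr T = tr (e T) = tr (T e)\<close>, and
  \<open>T e\<close> has smaller nilpotency index.\<close>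
lemma trace_nilpotent:
  assumes "finrank T" "\<And>v. (T ^^ n) v = 0"
  shows "trace T = 0"
  using assms
proof (induction n arbitrary: T)
  case 0
  then have "T = (\<lambda>v. 0)" by auto
  then show ?case by (simp add: trace_zero)
next
  case (Suc n)
  interpret T: Vector_Spaces.linear scale scale T using Suc finrank_def by blast
  obtain e where e: "lin e" "\<forall>v. e v \<in> range T" "\<forall>u\<in>range T. e u = u"
    by (rule exists_projection[OF T.subspace_image[OF subspace_UNIV]])
  let ?T = "\<lambda>v. T (e v)"
  have "(\<lambda>v. e (T v)) = T" using e(3) by auto
  then have "trace T = trace ?T" using trace_commute[OF e(1) Suc.prems(1)] by simp
  moreover have "(?T ^^ Suc k) v = (T ^^ Suc k) (e v)" for k v
  proof (induction k)
    case (Suc k)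
    then show ?case using e(3) by simp
  qed simp
  then have "(?T ^^ n) v = 0" if "n > 0" for v
    using Suc.prems(2) e(2)[rule_format, of v] that by (auto simp: funpow_swap1 gr0_conv_Suc)
  moreover have "?T v = 0" if "n = 0" for v
    using Suc.prems(2) that by auto
  moreover have "finrank ?T" using Suc.prems(1) e(1) by (rule finrank_comp2)
  ultimately show ?case
    using Suc.IH[of ?T] trace_zero by (cases "n = 0") auto
qed


text \<open>Makes the maps on the space a vector space of their own, so that a commutator map is an
  operator there and polynomials in it make sense.\<close>

definition opscale :: "'a \<Rightarrow> ('b \<Rightarrow> 'b) \<Rightarrow> 'b \<Rightarrow> 'b"
  where "opscale c T = (\<lambda>v. scale c (T v))"

lemma vec_space_opscale: "vec_space opscale"
  by unfold_locales (auto simp: opscale_def fun_eq_iff scale_right_distrib scale_left_distrib)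

section \<open>Polynomials in an operator\<close>

text \<open>Horner evaluation of p(T) at \<open>v\<close>. For linear \<open>T\<close> this is a
  ring homomorphism in the polynomial, as the next lemmas show.\<close>

definition papp :: "'a poly \<Rightarrow> ('b \<Rightarrow> 'b) \<Rightarrow> 'b \<Rightarrow> 'b"
  where "papp p T v = fold_coeffs (\<lambda>a w. scale a v + T w) p 0"

lemma papp_0 [simp]: "papp 0 T v = 0"
  by (simp add: papp_def)

lemma papp_pCons: "lin T \<Longrightarrow> papp (pCons a p) T v = scale a v + T (papp p T v)"
  by (cases "p = 0 \<and> a = 0") (auto simp: papp_def lin_0)

lemma papp_add: "lin T \<Longrightarrow> papp (p + q) T v = papp p T v + papp q T v"
proof (induction p arbitrary: q)
  case (pCons a p)
  then show ?case
    by (cases q) (simp add: papp_pCons lin_iff scale_left_distrib)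
qed simp

lemma papp_lin: "lin T \<Longrightarrow> lin (papp p T)"
  by (induction p) (simp_all add: lin_iff papp_pCons scale_right_distrib mult.commute)

lemma papp_smult: "lin T \<Longrightarrow> papp (smult c p) T v = scale c (papp p T v)"
  by (induction p) (simp_all add: papp_pCons lin_iff scale_right_distrib)

lemma papp_mult: "lin T \<Longrightarrow> papp (p * q) T v = papp p T (papp q T v)"
  by (induction p) (simp_all add: papp_pCons papp_add papp_smult mult_pCons_left lin_0)

lemma papp_commute: "lin T \<Longrightarrow> papp p T (papp q T v) = papp q T (papp p T v)"
  by (metis mult.commute papp_mult)

lemma papp_1 [simp]: "lin T \<Longrightarrow> papp 1 T v = v"
  by (simp add: one_pCons papp_pCons lin_0)

lemma papp_X: "lin T \<Longrightarrow> papp [:0, 1:] T v = T v"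
  by (simp add: papp_pCons lin_0)

lemma papp_root: "lin T \<Longrightarrow> papp [:- a, 1:] T v = T v - scale a v"
  by (simp add: papp_pCons lin_0)

lemma papp_power: "lin T \<Longrightarrow> papp (p ^ n) T v = (papp p T ^^ n) v"
  by (induction n arbitrary: v) (simp_all add: papp_mult)

lemma papp_sum: "lin T \<Longrightarrow> papp (\<Sum>i\<in>I. p i) T v = (\<Sum>i\<in>I. papp (p i) T v)"
  by (induction I rule: infinite_finite_induct) (auto simp: papp_add)

lemma papp_in: "lin T \<Longrightarrow> subspace U \<Longrightarrow> (\<And>u. u \<in> U \<Longrightarrow> T u \<in> U) \<Longrightarrow> v \<in> U \<Longrightarrow> papp p T v \<in> U"
  by (induction p) (auto simp: papp_pCons subspace_0 subspace_add subspace_scale)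

lemma papp_dvd: "lin T \<Longrightarrow> papp p T v = 0 \<Longrightarrow> p dvd q \<Longrightarrow> papp q T v = 0"
  by (auto simp: papp_mult papp_commute[of T p] lin_0[OF papp_lin] elim!: dvdE)

text \<open>The product over a basis of the range of polynomials killing one basis vector \<open>w\<close>, which exist since
  the vectors \<open>T\<^sup>i w\<close> cannot all be independent.\<close>
lemma annihilating_poly:
  assumes "finrank T"
  obtains p where "p \<noteq> 0" "\<forall>v. papp p T v = 0"
proof -
  have l: "lin T" using assms finrank_def by blast
  obtain S where S: "finite S" "independent S" "span S = range T"
    by (rule finrank_basis[OF assms])
  have ex: "\<exists>p. p \<noteq> 0 \<and> papp p T w = 0" for w
  proof (rule ccontr)
    assume "\<not> ?thesis"
    then have nz: "papp p T w \<noteq> 0" if "p \<noteq> 0" for p using that by blast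
    \<comment> \<open>The exponents start at one so that all these vectors lie in the range of
      \<open>T\<close>, which is finite dimensional.\<close>
    define g where "g i = (T ^^ Suc i) w" for i
    have g: "g i = papp (monom 1 (Suc i)) T w" for i
    proof -
      have "papp (monom 1 n) T w = (T ^^ n) w" for n
        by (induction n) (auto simp: monom_0 monom_Suc papp_pCons[OF l] lin_0[OF l])
      then show ?thesis by (simp add: g_def)
    qed
    have lc: "papp (\<Sum>i\<in>I. smult (c i) (monom 1 (Suc i))) T w = (\<Sum>i\<in>I. scale (c i) (g i))" for I c
      by (simp add: papp_sum[OF l] papp_smult[OF l] g)
    have co: "(\<Sum>i\<in>I. scale (c i) (g i)) \<noteq> 0" if "finite I" "i \<in> I" "c i \<noteq> 0" for I i c
    proof -
      have "coeff (\<Sum>i\<in>I. smult (c i) (monom 1 (Suc i))) (Suc i) = c i"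
        using that by (simp add: coeff_sum if_distrib cong: if_cong)
      then have "(\<Sum>i\<in>I. smult (c i) (monom 1 (Suc i))) \<noteq> 0" using that(3) by auto
      from nz[OF this] show ?thesis by (simp add: lc)
    qed
    have inj: "inj g"
    proof (rule injI, rule ccontr)
      fix i j assume *: "g i = g j" "i \<noteq> j"
      have "(\<Sum>k\<in>{i, j}. scale (if k = i then 1 else -1) (g k)) \<noteq> 0"
        by (rule co[of _ i]) auto
      then show False using * by simp
    qed
    have "independent (range g)"
    proof
      assume "dependent (range g)"
      then obtain t u v where t: "finite t" "t \<subseteq> range g" "(\<Sum>v\<in>t. scale (u v) v) = 0" "v \<in> t" "u v \<noteq> 0"
        unfolding dependent_explicit by blast
      have t': "t = g ` (g -` t)" using t(2) by auto
      have fin: "finite (g -` t)" using t(1) inj by (simp add: finite_vimageI)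
      obtain i where i: "i \<in> g -` t" "g i = v" using t(2,4) by auto
      have "(\<Sum>v\<in>t. scale (u v) v) = (\<Sum>i\<in>g -` t. scale (u (g i)) (g i))"
        by (subst t', subst sum.reindex) (use inj in \<open>auto intro: inj_on_subset\<close>)
      with co[OF fin i(1), of "\<lambda>i. u (g i)"] i(2) t(3,5) show False by simp
    qed
    moreover have "range g \<subseteq> span S" using S(3) by (auto simp: g_def)
    ultimately have "finite (range g)" using independent_span_bound[OF S(1)] by blast
    then show False using inj finite_imageD by blast
  qed
  then obtain q where q: "\<And>w. q w \<noteq> 0" "\<And>w. papp (q w) T w = 0" by metis
  define P where "P = (\<Prod>s\<in>S. q s)"
  have P: "papp P T x = 0" if "x \<in> span S" for x
    using that
  proof (induction rule: span_induct_alt)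
    case base show ?case by (simp add: lin_0[OF papp_lin[OF l]])
  next
    case (step c s y)
    have "papp P T s = 0"
      by (rule papp_dvd[OF l q(2)]) (use step(1) S(1) in \<open>auto simp: P_def\<close>)
    with step(2) show ?case using papp_lin[OF l, of P] by (simp add: lin_iff)
  qed
  show ?thesis
  proof (rule that)
    \<comment> \<open>\<open>P\<close> is known to kill the range of \<open>T\<close>; the extra
      factor X first sends every vector there.\<close>
    show "P * [:0, 1:] \<noteq> 0" using q(1) S(1) by (simp add: P_def)
    show "\<forall>v. papp (P * [:0, 1:]) T v = 0"
      unfolding papp_mult[OF l] papp_X[OF l] using P S(3) by blast
  qed
qed

end

section \<open>Partial fractions for powers of distinct linear polynomials\<close>

lemma coprime_linear_polys:
  fixes a b :: "'k::field_gcd"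
  assumes "a \<noteq> b"
  shows "coprime [:- a, 1:] [:- b, 1:]"
proof (rule coprimeI)
  fix d assume "d dvd [:- a, 1:]" "d dvd [:- b, 1:]"
  then have "d dvd [:- a, 1:] - [:- b, 1:]" by (rule dvd_diff)
  then have "d dvd [:b - a:]" by simp
  moreover have "is_unit [:b - a:]" using assms by (simp add: is_unit_const_poly_iff dvd_field_iff)
  ultimately show "is_unit d" by (rule dvd_unit_imp_unit)
qed

text \<open>The Chinese remainder idempotents of the pairwise coprime powers, each killed by its own
  power modulo the product. A new root is added by a Bezout identity between its power and the
  product of the old ones.\<close>

lemma poly_partition:
  fixes S :: "'k::field_gcd set"
  assumes "finite S" "S \<noteq> {}"
  obtains E where "(\<Sum>a\<in>S. E a) = 1"
    "\<forall>a\<in>S. (\<Prod>b\<in>S. [:- b, 1:] ^ m) dvd [:- a, 1:] ^ m * E a"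
proof -
  have "\<exists>E. (\<Sum>a\<in>S. E a) = 1 \<and>
    (\<forall>a\<in>S. (\<Prod>b\<in>S. [:- b, 1:] ^ m) dvd [:- a, 1:] ^ m * E a)"
    using assms
  proof (induction rule: finite_ne_induct)
    case (singleton a)
    show ?case by (rule exI[of _ "\<lambda>_. 1"]) simp
  next
    case (insert a S)
    let ?p = "[:- a, 1:] ^ m" and ?q = "\<Prod>b\<in>S. [:- b, 1:] ^ m"
    from insert.IH obtain E where E: "(\<Sum>a\<in>S. E a) = 1" "\<forall>a\<in>S. ?q dvd [:- a, 1:] ^ m * E a" by blast
    have "coprime ?p ?q"
      using insert(3) by (intro prod_coprime_right) (auto intro!: coprime_linear_polys)
    then obtain u v where uv: "u * ?p + v * ?q = 1"
      using bezout_coefficients_fst_snd[of ?p ?q] by (metis coprime_imp_gcd_eq_1)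
    define E' where "E' b = (if b = a then v * ?q else u * ?p * E b)" for b
    have "(\<Sum>b\<in>S. E' b) = (\<Sum>b\<in>S. u * ?p * E b)"
      by (rule sum.cong) (use insert(3) in \<open>auto simp: E'_def\<close>)
    also have "\<dots> = u * ?p" by (simp flip: sum_distrib_left add: E(1))
    finally have "(\<Sum>b\<in>insert a S. E' b) = 1"
      using insert(1,3) uv by (simp add: E'_def add.commute)
    moreover have "(\<Prod>b\<in>insert a S. [:- b, 1:] ^ m) dvd [:- b, 1:] ^ m * E' b" if "b \<in> insert a S" for b
    proof (cases "b = a")
      case True
      have "?p * E' a = (?p * ?q) * v" by (simp add: E'_def mult.commute mult.left_commute)
      then show ?thesis using True insert(1,3) by simp
    next
      case False
      have "?p * ?q dvd ?p * ([:- b, 1:] ^ m * E b)"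
        by (rule mult_dvd_mono) (use E(2) that False in auto)
      then have "?p * ?q dvd u * (?p * ([:- b, 1:] ^ m * E b))" by (rule dvd_mult)
      then show ?thesis using False insert(1,3) by (simp add: E'_def mult.commute mult.left_commute)
    qed
    ultimately show ?case by blast
  qed
  then show ?thesis using that by blast
qed

section \<open>Nilpotency from a vanishing trace form, over an algebraically closed field\<close>

context vec_space
begin

text \<open>Left and right multiplication by \<open>x\<close> commute, and \<open>D\<close> minus a
  - b is (left minus a) minus (right minus b). In the binomial expansion of the 2m-th power every
  term contains at least m factors of one kind, which die on \<open>e\<close> or on
  \<open>e'\<close>.\<close>

lemma commutator_power_vanishes:
  assumes x: "lin x" and z: "lin z"
    and D: "D = (\<lambda>z v. x (z v) - z (x v))"
    and P: "\<forall>v. papp ([:- a, 1:] ^ m) x (e v) = 0" "\<forall>v. papp ([:- b, 1:] ^ m) x (e' v) = 0"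
    and e: "e = papp p x" "e' = papp q x"
  shows "vec_space.papp opscale ([:- (a - b), 1:] ^ (2 * m)) D (\<lambda>v. e (z (e' v))) = (\<lambda>v. 0)"
proof -
  interpret op: vec_space opscale by (rule vec_space_opscale)
  have lD: "op.lin D"
    using x by (auto simp: D op.lin_iff lin_iff opscale_def fun_eq_iff scale_right_diff_distrib)
  \<comment> \<open>Tracking the two exponents replaces binomial coefficients: each further factor
    raises either \<open>i\<close> or \<open>j\<close>.\<close>
  define w where "w i j = (\<lambda>v. papp ([:- a, 1:] ^ i) x (e (z (e' (papp ([:- b, 1:] ^ j) x v)))))" for i j
  have step: "op.papp [:- (a - b), 1:] D (w i j) = w (Suc i) j - w i (Suc j)" for i j
  proof
    fix v
    let ?u = "papp ([:- b, 1:] ^ j) x"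
    have le: "lin e" "lin e'" using papp_lin[OF x] e by auto
    have 1: "w i (Suc j) v = w i j (x v) - scale b (w i j v)"
    proof -
      have "papp ([:- b, 1:] ^ Suc j) x v = ?u (x v) - scale b (?u v)"
        by (simp only: power_Suc2 papp_mult[OF x] papp_root[OF x])
          (use papp_lin[OF x, of "[:- b, 1:] ^ j"] in \<open>simp add: lin_diff lin_iff\<close>)
      then show ?thesis
        using z le papp_lin[OF x, of "[:- a, 1:] ^ i"] by (simp add: w_def lin_diff lin_iff)
    qed
    have 2: "w (Suc i) j v = x (w i j v) - scale a (w i j v)"
      by (simp only: w_def power_Suc papp_mult[OF x] papp_root[OF x])
    show "op.papp [:- (a - b), 1:] D (w i j) v = (w (Suc i) j - w i (Suc j)) v"
      by (simp only: op.papp_root[OF lD] fun_diff_def 1 2)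
        (simp add: D opscale_def scale_left_diff_distrib)
  qed
  have van: "w i j = (\<lambda>v. 0)" if "i \<ge> m \<or> j \<ge> m" for i j
  proof
    fix v
    have le: "lin e" "lin e'" using papp_lin[OF x] e by auto
    show "w i j v = 0"
    proof (cases "i \<ge> m")
      case True
      then have "papp ([:- a, 1:] ^ i) x (e u) = 0" for u
        using papp_dvd[OF x P(1)[rule_format]] le_imp_power_dvd by blast
      then show ?thesis by (simp add: w_def)
    next
      case False
      then have "papp ([:- b, 1:] ^ j) x (e' v) = 0"
        using that papp_dvd[OF x P(2)[rule_format]] le_imp_power_dvd by blast
      then have "e' (papp ([:- b, 1:] ^ j) x v) = 0"
        unfolding e by (simp add: papp_commute[OF x])
      then show ?thesis using z le papp_lin[OF x, of "[:- a, 1:] ^ i"] by (simp add: w_def lin_0)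
    qed
  qed
  have "op.papp ([:- (a - b), 1:] ^ k) D (w i j) = 0" if "i + j + k \<ge> 2 * m" for i j k
    using that
  proof (induction k arbitrary: i j)
    case 0
    then have "i \<ge> m \<or> j \<ge> m" by linarith
    then show ?case using van[of i j] by (simp add: op.papp_1[OF lD] zero_fun_def)
  next
    case (Suc k)
    then show ?case
      using Suc.IH[of "Suc i" j] Suc.IH[of i "Suc j"] op.papp_lin[OF lD, of "[:- (a - b), 1:] ^ k"]
      by (simp only: power_Suc2 op.papp_mult[OF lD] step op.lin_diff) simp
  qed
  from this[of 0 0 "2 * m"] show ?thesis by (simp add: w_def x zero_fun_def)
qed

end

locale field_gcd_space = vec_space scale
  for scale :: "'k::field_gcd \<Rightarrow> 'x::ab_group_add \<Rightarrow> 'x"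
begin

text \<open>For c different from a, coprimality makes \<open>E c\<close> a multiple of the power of
  X - a that kills \<open>v\<close>; as the \<open>E\<close> sum to 1, \<open>E a\<close> must fix
  \<open>v\<close>.\<close>

lemma partition_projects:
  assumes l: "lin T" and S: "finite S"
    and E: "(\<Sum>a\<in>S. E a) = 1" "\<forall>a\<in>S. (\<Prod>b\<in>S. [:- b, 1:] ^ m) dvd [:- a, 1:] ^ m * E a"
    and a: "a \<in> S" "c \<in> S" and v: "papp ([:- a, 1:] ^ m) T v = 0"
  shows "papp (E c) T v = (if c = a then v else 0)"
proof -
  have 0: "papp (E c) T v = 0" if "c \<in> S" "c \<noteq> a" for c
  proof (rule papp_dvd[OF l v])
    have "[:- a, 1:] ^ m dvd (\<Prod>b\<in>S. [:- b, 1:] ^ m)"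
      using S a(1) by (rule dvd_prodI)
    then have "[:- a, 1:] ^ m dvd [:- c, 1:] ^ m * E c"
      using E(2) that(1) dvd_trans by blast
    moreover have "coprime ([:- a, 1:] ^ m) ([:- c, 1:] ^ m)"
      using that(2) by (auto intro: coprime_linear_polys)
    ultimately show "[:- a, 1:] ^ m dvd E c"
      by (simp add: coprime_dvd_mult_right_iff)
  qed
  have "v = papp (\<Sum>c\<in>S. E c) T v" by (simp add: E(1) l)
  also have "\<dots> = (\<Sum>c\<in>S. papp (E c) T v)" by (simp add: papp_sum[OF l])
  also have "\<dots> = (\<Sum>c\<in>S. if c = a then papp (E a) T v else 0)"
    by (rule sum.cong) (use 0 in auto)
  also have "\<dots> = papp (E a) T v" using S a(1) by simp
  finally show ?thesis using 0 a(2) by auto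
qed

end

locale closed_space = field_gcd_space scale
  for scale :: "'k::{alg_closed_field, field_char_0, field_gcd} \<Rightarrow> 'x::ab_group_add \<Rightarrow> 'x"
begin

text \<open>One exponent above all multiplicities serves every root. The root 0 is always included,
  with positive exponent, so that the components at the other roots lie in the range of
  \<open>x\<close>.\<close>

lemma primary_decomposition:
  assumes "finrank x"
  obtains S E m where "finite S" "0 \<in> S" "m > 0" "(\<Sum>a\<in>S. E a) = 1"
    "\<forall>a\<in>S. (\<Prod>b\<in>S. [:- b, 1:] ^ m) dvd [:- a, 1:] ^ m * E a"
    "\<forall>v. papp (\<Prod>b\<in>S. [:- b, 1:] ^ m) x v = 0"
proof -
  have l: "lin x" using assms finrank_def by blast
  obtain p where p: "p \<noteq> 0" "\<forall>v. papp p x v = 0"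
    by (rule annihilating_poly[OF assms])
  obtain A where A: "p = smult (lead_coeff p) (\<Prod>a\<in>#A. [:- a, 1:])"
    using alg_closed_imp_factorization[OF p(1)] by blast
  define m where "m = Suc (size A)"
  define S where "S = insert 0 (set_mset A)"
  let ?P = "\<Prod>b\<in>S. [:- b, 1:] ^ m"
  have "(\<Prod>a\<in>#A. [:- a, 1:]) = (\<Prod>a\<in>set_mset A. [:- a, 1:] ^ count A a)"
    by (rule image_prod_mset_multiplicity)
  also have "\<dots> dvd (\<Prod>a\<in>set_mset A. [:- a, 1:] ^ m)"
    by (rule prod_dvd_prod) (simp only: m_def le_imp_power_dvd le_SucI count_le_size)
  also have "\<dots> dvd ?P"
    by (rule prod_dvd_prod_subset) (auto simp: S_def)
  finally have dvd: "p dvd ?P"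
    by (subst A) (use p(1) in \<open>simp add: smult_dvd_iff\<close>)
  have S: "finite S" "S \<noteq> {}" by (auto simp: S_def)
  obtain E where E: "(\<Sum>a\<in>S. E a) = 1" "\<forall>a\<in>S. ?P dvd [:- a, 1:] ^ m * E a"
    by (rule poly_partition[OF S])
  show ?thesis
    by (rule that[OF S(1) _ _ E]) (use papp_dvd[OF l _ dvd] p(2) in \<open>auto simp: m_def S_def\<close>)
qed

text \<open>\<open>M\<close> is kept apart from \<open>N\<close> because operators obtained by
  extending scalars do not form a subspace over the larger field: commutators are taken in
  \<open>N\<close>, while polynomials in \<open>ad x\<close> act on the subspace
  \<open>M\<close>.\<close>

theorem trace_form_nilpotent:
  assumes x: "finrank x"
    and N: "\<And>u. u \<in> N \<Longrightarrow> finrank u" "N \<subseteq> M"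
    and xN: "x \<in> module.span opscale {(\<lambda>v. u (w v) - w (u v)) | u w. u \<in> N \<and> w \<in> N}"
    and M: "module.subspace opscale M" "\<And>z. z \<in> M \<Longrightarrow> finrank z"
      "\<And>z. z \<in> M \<Longrightarrow> (\<lambda>v. x (z v) - z (x v)) \<in> M"
    and tr: "\<And>u w. u \<in> N \<Longrightarrow> w \<in> M \<Longrightarrow> trace (\<lambda>v. u (w v)) = 0"
  shows "\<exists>n. \<forall>v. (x ^^ n) v = 0"
proof -
  interpret op: field_gcd_space opscale
    unfolding field_gcd_space_def by (rule vec_space_opscale)
  have l: "lin x" using x finrank_def by blast
  obtain S E m where S: "finite S" "0 \<in> S" "m > 0" and E: "(\<Sum>a\<in>S. E a) = 1"
    "\<forall>a\<in>S. (\<Prod>b\<in>S. [:- b, 1:] ^ m) dvd [:- a, 1:] ^ m * E a"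
    and P: "\<forall>v. papp (\<Prod>b\<in>S. [:- b, 1:] ^ m) x v = 0"
    by (rule primary_decomposition[OF x])
  define e where "e a = papp (E a) x" for a
  have le: "lin (e a)" for a unfolding e_def by (rule papp_lin[OF l])
  have sum_e: "(\<Sum>a\<in>S. e a v) = v" for v
    unfolding e_def papp_sum[OF l, symmetric] by (simp add: E(1) l)
  have ker: "papp ([:- a, 1:] ^ m * E a) x v = 0" if "a \<in> S" for a v
    using papp_dvd[OF l P[rule_format]] E(2) that by blast
  then have ker': "papp ([:- a, 1:] ^ m) x (e a v) = 0" if "a \<in> S" for a v
    using that by (simp add: e_def papp_mult[OF l])
  have ee: "e c (e a v) = (if c = a then e a v else 0)" if "a \<in> S" "c \<in> S" for a c v
    using partition_projects[OF l S(1) E that ker'[OF that(1)]] by (simp add: e_def)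
  \<comment> \<open>X divides \<open>E a\<close> when a is nonzero, so \<open>e a\<close> has its
    range inside that of \<open>x\<close>.\<close>
  have fe: "finrank (e a)" if a: "a \<in> S" "a \<noteq> 0" for a
  proof -
    have "[:- 0, 1:] ^ m dvd (\<Prod>b\<in>S. [:- b, 1:] ^ m)"
      using S by (intro dvd_prodI) auto
    then have "[:- 0, 1:] ^ m dvd [:- a, 1:] ^ m * E a"
      using E(2) a(1) dvd_trans by blast
    moreover have "coprime ([:- 0, 1:] ^ m) ([:- a, 1:] ^ m)"
      using a(2) by (intro coprime_power_left_iff[THEN iffD2] coprime_power_right_iff[THEN iffD2] disjI1 disjI2 coprime_linear_polys) auto
    ultimately have "[:- 0, 1:] ^ m dvd E a"
      using coprime_dvd_mult_right_iff by blast
    then have "[:0, 1:] dvd E a"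
      using S(3) dvd_power[of m "[:0, 1:]"] dvd_trans by auto
    then obtain q where q: "E a = [:0, 1:] * q" by (elim dvdE)
    have "e a v \<in> range x" for v
      unfolding e_def q papp_mult[OF l] papp_X[OF l] by blast
    then show ?thesis
      by (rule finrankI[OF le]) (use x finrank_def in blast)
  qed
  have "\<exists>r. trace (e a) = of_nat r \<and> (r = 0 \<longrightarrow> (\<forall>v. e a v = 0))" if "a \<in> S - {0}" for a
  proof -
    have "finrank (e a)" "\<And>v. e a (e a v) = e a v" using that fe[of a] ee by auto
    from trace_idempotent[OF this] show ?thesis by metis
  qed
  then obtain r :: "'k \<Rightarrow> nat" where r: "\<And>a. a \<in> S - {0} \<Longrightarrow> trace (e a) = of_nat (r a)"
    "\<And>a v. a \<in> S - {0} \<Longrightarrow> r a = 0 \<Longrightarrow> e a v = 0" by metis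
  have tr_xe: "trace (\<lambda>v. x (e a v)) = a * of_nat (r a)" if a: "a \<in> S - {0}" for a
  proof -
    \<comment> \<open>On the component of a, \<open>x\<close> is a plus a nilpotent operator of
      trace zero, so only a times the rank remains.\<close>
    define n where "n = papp ([:- a, 1:] * E a) x"
    have n: "n v = x (e a v) - scale a (e a v)" for v
      by (simp only: n_def papp_mult[OF l] papp_root[OF l] e_def)
    have n': "n = (\<lambda>v. x (e a v) - scale a (e a v))" using n by blast
    have fn: "finrank n"
      using finrank_diff[OF finrank_comp[OF l fe] finrank_scale[OF fe]] a by (simp add: n')
    have "(n ^^ m) v = 0" for v
    proof -
      have "[:- a, 1:] ^ m * E a dvd ([:- a, 1:] * E a) ^ m"
        using S(3) by (simp only: power_mult_distrib) (auto intro!: mult_dvd_mono dvd_power)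
      from papp_dvd[OF l ker this] a show ?thesis
        by (simp add: n_def papp_power[OF l])
    qed
    then have 0: "trace n = 0" by (rule trace_nilpotent[OF fn])
    have "(\<lambda>v. x (e a v)) = (\<lambda>v. n v + scale a (e a v))" by (simp add: n)
    then have "trace (\<lambda>v. x (e a v)) = trace n + a * trace (e a)"
      using fn fe[of a] a by (simp add: trace_add finrank_scale trace_scale)
    then show ?thesis by (simp add: 0 r(1)[OF a])
  qed
  define D where "D = (\<lambda>z v. x (z v) - z (x v))"
  have lD: "op.lin D"
    using l by (auto simp: D_def op.lin_iff lin_iff opscale_def fun_eq_iff scale_right_diff_distrib)
  have e0: "e a v = 0" if a: "a \<in> S" "a \<noteq> 0" for a v
  proof (rule ccontr)
    assume ne: "e a v \<noteq> 0"
    \<comment> \<open>The field is regarded as a vector space over the rationals.\<close>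
    have Q: "vector_space (\<lambda>q (k :: 'k). of_rat q * k)"
      by unfold_locales (auto simp: algebra_simps of_rat_add of_rat_mult)
    obtain f where f: "Vector_Spaces.linear (\<lambda>q k. of_rat q * k) (*) f" "f a = 1"
      by (rule linear_functional_nonzero[OF Q a(2)])
    have fa: "f (k + k') = f k + f k'" "f (of_rat q * k) = q * f k" for k k' q
      using f(1) unfolding linear_iff_add_scale by auto
    have f0: "f 0 = 0" using fa(2)[of 0] by simp
    have fd: "f (k - k') = f k - f k'" for k k'
      using fa(1)[of "k - k'" k'] by simp
    have fs: "f (sum g A) = (\<Sum>i\<in>A. f (g i))" for g :: "'k \<Rightarrow> 'k" and A
      by (induction A rule: infinite_finite_induct) (auto simp: f0 fa)
    define y where "y v = (\<Sum>a\<in>S. scale (of_rat (f a)) (e a v))" for v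
    \<comment> \<open>As f is 0 at 0, the component at 0, for which finite rank was not shown, drops
      out.\<close>
    have y': "y v = (\<Sum>a\<in>S - {0}. scale (of_rat (f a)) (e a v))" for v
      unfolding y_def by (rule sum.mono_neutral_right) (use S(1) f0 in auto)
    have fy: "finrank y"
    proof -
      have "finrank (\<lambda>v. \<Sum>a\<in>S - {0}. scale (of_rat (f a)) (e a v))"
        by (rule finrank_sum) (use fe in \<open>auto intro: finrank_scale\<close>)
      moreover have "y = (\<lambda>v. \<Sum>a\<in>S - {0}. scale (of_rat (f a)) (e a v))" using y' by blast
      ultimately show ?thesis by simp
    qed
    have ly: "lin y" using fy by (rule finrank_lin)
    have yM: "(\<lambda>v. y (z v) - z (y v)) \<in> M" if z: "z \<in> M" for z
    proof -
      have lz: "lin z" using M(2)[OF z] finrank_lin by blast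
      \<comment> \<open>The differences a - b are the generalised eigenvalues of \<open>D\<close> on
        the blocks \<open>Z a b\<close>.\<close>
      define C where "C = (\<lambda>(a, b). a - b) ` (S \<times> S)"
      have C: "finite C" "C \<noteq> {}" using S unfolding C_def by auto
      obtain F where F: "(\<Sum>c\<in>C. F c) = 1"
        "\<forall>c\<in>C. (\<Prod>b\<in>C. [:- b, 1:] ^ (2 * m)) dvd [:- c, 1:] ^ (2 * m) * F c"
        by (rule poly_partition[OF C])
      define Z where "Z a b = (\<lambda>v. e a (z (e b v)))" for a b
      have pF: "op.papp (F c) D (Z a b) = (if c = a - b then Z a b else 0)"
        if "c \<in> C" "a \<in> S" "b \<in> S" for a b c
      proof (rule op.partition_projects[OF lD C(1) F])
        show "a - b \<in> C" "c \<in> C" using that by (auto simp: C_def)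
        show "op.papp ([:- (a - b), 1:] ^ (2 * m)) D (Z a b) = 0"
          unfolding Z_def zero_fun_def
          by (rule commutator_power_vanishes[OF l lz D_def]) (use ker' that in \<open>auto simp: e_def\<close>)
      qed
      \<comment> \<open>The scalar of \<open>ad y\<close> on a block is f a - f b = f (a - b), which
        depends on the difference alone; hence one polynomial in \<open>D\<close> yields it on all
        blocks.\<close>
      define G where "G = (\<Sum>c\<in>C. smult (of_rat (f c)) (F c))"
      have pG: "op.papp G D (Z a b) = opscale (of_rat (f a) - of_rat (f b)) (Z a b)"
        if "a \<in> S" "b \<in> S" for a b
      proof -
        have "a - b \<in> C" using that by (auto simp: C_def)
        have "op.papp G D (Z a b) = (\<Sum>c\<in>C. opscale (of_rat (f c)) (op.papp (F c) D (Z a b)))"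
          by (simp add: G_def op.papp_sum[OF lD] op.papp_smult[OF lD])
        also have "\<dots> = (\<Sum>c\<in>C. if c = a - b then opscale (of_rat (f (a - b))) (Z a b) else 0)"
          by (rule sum.cong) (use pF that in auto)
        also have "\<dots> = opscale (of_rat (f (a - b))) (Z a b)"
          using C(1) \<open>a - b \<in> C\<close> by simp
        finally show ?thesis by (simp add: fd of_rat_diff)
      qed
      have zZ: "z = (\<Sum>a\<in>S. \<Sum>b\<in>S. Z a b)"
      proof
        fix v
        have "(\<Sum>a\<in>S. \<Sum>b\<in>S. Z a b) v = (\<Sum>a\<in>S. e a (z (\<Sum>b\<in>S. e b v)))"
          by (simp add: sum_fun_apply Z_def lin_sum[OF lz] lin_sum[OF le])
        then show "z v = (\<Sum>a\<in>S. \<Sum>b\<in>S. Z a b) v" by (simp add: sum_e)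
      qed
      have "op.papp G D z = (\<Sum>a\<in>S. \<Sum>b\<in>S. opscale (of_rat (f a) - of_rat (f b)) (Z a b))"
        by (subst zZ) (simp add: op.lin_sum[OF op.papp_lin[OF lD]] pG cong: sum.cong)
      also have "\<dots> = (\<lambda>v. y (z v) - z (y v))"
      proof
        fix v
        have 1: "y (z v) = (\<Sum>a\<in>S. \<Sum>b\<in>S. scale (of_rat (f a)) (Z a b v))"
        proof -
          have "y (z v) = (\<Sum>a\<in>S. scale (of_rat (f a)) (e a (z (\<Sum>b\<in>S. e b v))))"
            by (simp add: y_def sum_e)
          then show ?thesis by (simp add: Z_def lin_sum[OF lz] lin_sum[OF le] scale_sum_right)
        qed
        have 2: "z (y v) = (\<Sum>a\<in>S. \<Sum>b\<in>S. scale (of_rat (f b)) (Z a b v))"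
        proof -
          have "z (y v) = (\<Sum>a\<in>S. e a (z (y v)))" by (simp add: sum_e)
          moreover have "e a (scale k w) = scale k (e a w)" "z (scale k w) = scale k (z w)" for a k w
            using le lz lin_iff by blast+
          ultimately show ?thesis
            by (simp add: y_def Z_def lin_sum[OF lz] lin_sum[OF le])
        qed
        show "(\<Sum>a\<in>S. \<Sum>b\<in>S. opscale (of_rat (f a) - of_rat (f b)) (Z a b)) v = y (z v) - z (y v)"
          unfolding 1 2 by (simp add: sum_fun_apply opscale_def scale_left_diff_distrib sum_subtractf)
      qed
      finally have "op.papp G D z = (\<lambda>v. y (z v) - z (y v))" .
      moreover have "op.papp G D z \<in> M"
        by (rule op.papp_in[OF lD M(1) _ z]) (simp add: D_def M(3))
      ultimately show ?thesis by simp
    qed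
    have "finrank x' \<and> trace (\<lambda>v. x' (y v)) = 0"
      if "x' \<in> op.span {(\<lambda>v. u (w v) - w (u v)) | u w. u \<in> N \<and> w \<in> N}" for x'
      using that
    proof (induction rule: op.span_induct_alt)
      case base
      show ?case by (simp add: zero_fun_def finrank_zero trace_zero)
    next
      case (step c d x')
      then obtain u w where uw: "u \<in> N" "w \<in> N" and d: "d = (\<lambda>v. u (w v) - w (u v))" by blast
      note fu = N(1)[OF uw(1)] and fw = N(1)[OF uw(2)]
      note lu = finrank_lin[OF fu] and lw = finrank_lin[OF fw]
      have fd: "finrank d" unfolding d by (rule finrank_diff[OF finrank_comp[OF lu fw] finrank_comp[OF lw fu]])
      have fdy: "finrank (\<lambda>v. d (y v))" by (rule finrank_comp2[OF fd ly])
      have f1: "finrank (\<lambda>v. u (w (y v)))" "finrank (\<lambda>v. w (u (y v)))" "finrank (\<lambda>v. u (y (w v)))"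
        by (rule finrank_comp[OF lu finrank_comp[OF lw fy]] finrank_comp[OF lw finrank_comp[OF lu fy]]
            finrank_comp[OF lu finrank_comp[OF ly fw]])+
      \<comment> \<open>For d = [u, w] this is tr([u, w] y) = - tr(u [y, w]), and [y, w] lies in
        \<open>M\<close>.\<close>
      have "trace (\<lambda>v. d (y v)) = trace (\<lambda>v. u (w (y v))) - trace (\<lambda>v. w (u (y v)))"
        unfolding d by (rule trace_diff[OF f1(1,2)])
      also have "trace (\<lambda>v. w (u (y v))) = trace (\<lambda>v. u (y (w v)))"
        using trace_commute[OF lw, of "\<lambda>v. u (y v)"] finrank_comp[OF lu fy] by simp
      also have "trace (\<lambda>v. u (w (y v))) - \<dots> = - trace (\<lambda>v. u (y (w v) - w (y v)))"
        using trace_diff[OF f1(3,1)] by (simp add: lin_diff[OF lu])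
      also have "\<dots> = 0"
        using tr[OF uw(1) yM[of w]] N(2) uw(2) by auto
      finally have "trace (\<lambda>v. d (y v)) = 0" .
      moreover have "(\<lambda>v. (opscale c d + x') (y v)) = (\<lambda>v. scale c (d (y v)) + x' (y v))"
        by (simp add: opscale_def)
      moreover have "finrank (opscale c d + x')"
        using finrank_add[OF finrank_scale[OF fd, of c], of x'] step(2)
        by (simp add: opscale_def plus_fun_def)
      moreover have "finrank (\<lambda>v. x' (y v))"
        using finrank_comp2[OF _ ly] step(2) by blast
      ultimately show ?case
        using step(2) fdy by (simp add: trace_add trace_scale finrank_scale del: plus_fun_apply)
    qed
    with xN have 0: "trace (\<lambda>v. x (y v)) = 0" by blast
    have "(\<lambda>v. x (y v)) = (\<lambda>v. \<Sum>a\<in>S - {0}. scale (of_rat (f a)) (x (e a v)))"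
      using l by (simp add: y' lin_sum lin_iff)
    moreover have "finrank (\<lambda>v. x (e a v))" if "a \<in> S - {0}" for a
      using finrank_comp[OF l fe] that by blast
    ultimately have "trace (\<lambda>v. x (y v)) = (\<Sum>a\<in>S - {0}. of_rat (f a) * (a * of_nat (r a)))"
      using trace_sum[of "S - {0}" "\<lambda>a v. scale (of_rat (f a)) (x (e a v))"]
      by (simp add: finrank_scale trace_scale tr_xe)
    \<comment> \<open>Applying f to the sum of f a times a times the rank turns it into a sum of
      nonnegative rationals, whose vanishing forces each summand to vanish.\<close>
    with 0 have "f (\<Sum>a\<in>S - {0}. of_rat (f a) * (a * of_nat (r a))) = 0" by (simp add: f0)
    also have "f (\<Sum>a\<in>S - {0}. of_rat (f a) * (a * of_nat (r a))) = (\<Sum>a\<in>S - {0}. f a * f a * of_nat (r a))"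
      unfolding fs
    proof (rule sum.cong[OF refl])
      fix a
      have "of_rat (f a) * (a * of_nat (r a)) = of_rat (f a * of_nat (r a)) * a"
        by (simp add: of_rat_mult mult_ac)
      then show "f (of_rat (f a) * (a * of_nat (r a))) = f a * f a * of_nat (r a)"
        by (simp only: fa(2)) (simp add: mult_ac)
    qed
    finally have "f a * f a * of_nat (r a) = 0"
      using a S(1) by (subst (asm) sum_nonneg_eq_0_iff) auto
    then show False using r(2)[of a v] a ne f(2) by simp
  qed
  \<comment> \<open>All components at nonzero roots being zero, every vector belongs to the
    generalised kernel of \<open>x\<close>.\<close>
  have "(x ^^ m) v = 0" for v
  proof -
    have "(\<Sum>a\<in>S. e a v) = (\<Sum>a\<in>S. if a = 0 then e 0 v else 0)"
      by (rule sum.cong) (use e0 in auto)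
    then have "v = e 0 v" using S by (simp add: sum_e)
    moreover have "papp ([:- 0, 1:] ^ m) x (e 0 v) = 0" by (rule ker'[OF S(2)])
    moreover have "papp [:- 0, 1:] x = x" using papp_X[OF l] by auto
    ultimately show ?thesis by (simp add: papp_power[OF l])
  qed
  then show ?thesis by blast
qed

end

section \<open>Descent from the algebraic closure\<close>

text \<open>The Bezout coefficients in \<open>poly_partition\<close> are taken over the
  closure.\<close>

instance alg_closure :: (field) field_gcd ..

definition fun_scale :: "'k::field \<Rightarrow> ('i \<Rightarrow> 'k) \<Rightarrow> 'i \<Rightarrow> 'k"
  where "fun_scale c f = (\<lambda>i. c * f i)"

lemma vec_space_fun_scale: "vec_space fun_scale"
  by unfold_locales (auto simp: fun_scale_def fun_eq_iff algebra_simps)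

locale char_0_space = vec_space scale
  for scale :: "'a::field_char_0 \<Rightarrow> 'b::ab_group_add \<Rightarrow> 'b"

text \<open>Scalars are extended by letting the matrix of an operator with range in \<open>span B\<close> act on functions
  \<open>'b \<Rightarrow> 'a alg_closure\<close>, of which only the values on \<open>B\<close> matter.\<close>
locale base_change = char_0_space scale
  for scale :: "'a::field_char_0 \<Rightarrow> 'b::ab_group_add \<Rightarrow> 'b" +
  fixes B :: "'b set"
  assumes B: "finite B" "independent B"
begin

sublocale K: closed_space "fun_scale :: 'a alg_closure \<Rightarrow> ('b \<Rightarrow> 'a alg_closure) \<Rightarrow> _"
  unfolding closed_space_def field_gcd_space_def by (rule vec_space_fun_scale)

definition supported :: "('b \<Rightarrow> 'b) \<Rightarrow> bool"
  where "supported T \<longleftrightarrow> lin T \<and> (\<forall>v. T v \<in> span B)"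

definition column :: "('b \<Rightarrow> 'b) \<Rightarrow> 'b \<Rightarrow> 'b \<Rightarrow> 'a alg_closure"
  where "column T j = (\<lambda>i. if i \<in> B then to_ac (representation B (T j) i) else 0)"

definition ext :: "('b \<Rightarrow> 'b) \<Rightarrow> ('b \<Rightarrow> 'a alg_closure) \<Rightarrow> 'b \<Rightarrow> 'a alg_closure"
  where "ext T f = (\<Sum>j\<in>B. fun_scale (f j) (column T j))"

lemma ext_apply: "ext T f i = (\<Sum>j\<in>B. f j * column T j i)"
  by (simp add: ext_def sum_fun_apply fun_scale_def)

lemma functional_eval: "K.functional (\<lambda>f. f j)"
  by (simp add: K.functional_iff fun_scale_def)

lemma lin_ext: "K.lin (ext T)"
  by (auto simp: K.lin_iff fun_eq_iff ext_apply fun_scale_def sum.distrib sum_distrib_left algebra_simps)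

lemma finrank_ext: "K.finrank (ext T)"
proof (rule K.finrankI[OF lin_ext])
  show "ext T f \<in> K.span (column T ` B)" for f
    unfolding ext_def by (intro K.span_sum K.span_scale K.span_base) auto
  show "K.fin_dim (K.span (column T ` B))"
    unfolding K.fin_dim_def using B(1) by blast
qed

lemma trace_ext: "supported T \<Longrightarrow> K.trace (ext T) = to_ac (trace T)"
proof -
  assume T: "supported T"
  have "K.trace (ext T) = (\<Sum>j\<in>B. column T j j)"
    unfolding ext_def by (rule K.trace_dyads[OF B(1) functional_eval])
  also have "\<dots> = to_ac (trace T)"
    using T by (simp add: trace_basis[OF B] supported_def column_def to_ac_sum)
  finally show ?thesis .
qed

lemma supported_comp: "lin T \<Longrightarrow> supported T' \<Longrightarrow> supported T \<Longrightarrow> supported (\<lambda>v. T (T' v))"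
  by (auto simp: supported_def lin_iff)

lemma supported_comb: "supported T \<Longrightarrow> supported T' \<Longrightarrow> supported (opscale c T + T')"
  by (auto simp: supported_def lin_iff opscale_def scale_right_distrib mult.commute
      intro!: span_add span_scale)

lemma ext_comp:
  assumes "supported T" "supported T'"
  shows "ext (\<lambda>v. T (T' v)) f = ext T (ext T' f)"
proof -
  have T: "lin T" "\<And>v. T v \<in> span B" "\<And>v. T' v \<in> span B" using assms supported_def by auto
  have "column (\<lambda>v. T (T' v)) j i = (\<Sum>k\<in>B. column T' j k * column T k i)" for i j
  proof (cases "i \<in> B")
    case True
    have "T (T' j) = T (\<Sum>k\<in>B. scale (representation B (T' j) k) k)"
      using sum_representation_eq[OF B(2) T(3) B(1)] by simp
    also have "\<dots> = (\<Sum>k\<in>B. scale (representation B (T' j) k) (T k))"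
      using T(1) by (simp add: lin_sum lin_iff)
    finally have "representation B (T (T' j)) i = (\<Sum>k\<in>B. representation B (T' j) k * representation B (T k) i)"
      using T(2) by (simp add: representation_sum[OF B(2)] representation_scale[OF B(2)] span_scale)
    with True show ?thesis by (simp add: column_def to_ac_sum)
  qed (simp add: column_def)
  then show ?thesis
    by (auto simp: fun_eq_iff ext_apply sum_distrib_left sum_distrib_right mult.assoc intro: sum.swap)
qed

lemma ext_diff:
  assumes "supported T" "supported T'"
  shows "ext (\<lambda>v. T v - T' v) f = ext T f - ext T' f"
  using assms by (auto simp: fun_eq_iff ext_apply column_def supported_def
      representation_diff[OF B(2)] algebra_simps sum_subtractf[symmetric] intro!: sum.cong)

lemma ext_comb:
  assumes "supported T" "supported T'"
  shows "ext (opscale c T + T') = K.opscale (to_ac c) (ext T) + ext T'"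
  using assms by (auto simp: fun_eq_iff ext_apply column_def supported_def opscale_def K.opscale_def fun_scale_def
      representation_add[OF B(2)] representation_scale[OF B(2)] span_scale
      algebra_simps sum.distrib[symmetric] sum_distrib_left intro!: sum.cong)

lemma ext_zero: "ext (\<lambda>v. 0) = (\<lambda>f. 0)"
  by (simp add: ext_def column_def representation_zero fun_scale_def fun_eq_iff sum_fun_apply)

text \<open>\<open>ext\<close> respects products and the embedding \<open>to_ac\<close> is
  injective, so a vanishing power of the extended matrix means that a power of \<open>T\<close>
  kills \<open>B\<close>. One further power handles vectors outside \<open>span B\<close>, which
  \<open>T\<close> maps into it.\<close>

lemma ext_nilpotent:
  assumes T: "supported T" and n: "\<forall>f. (ext T ^^ n) f = 0"
  shows "\<exists>n. \<forall>v. (T ^^ n) v = 0"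
proof -
  have l: "lin T" and r: "\<And>v. T v \<in> span B" using T supported_def by auto
  \<comment> \<open>Positive powers only: the identity need not have its range in
    \<open>span B\<close>.\<close>
  have pow: "supported (T ^^ Suc k) \<and> ext (T ^^ Suc k) = ext T ^^ Suc k" for k
  proof (induction k)
    case (Suc k)
    have eq: "T ^^ Suc (Suc k) = (\<lambda>v. T ((T ^^ Suc k) v))"
      "ext T ^^ Suc (Suc k) = (\<lambda>f. ext T ((ext T ^^ Suc k) f))" by auto
    from Suc have s: "supported (T ^^ Suc k)" and e: "ext (T ^^ Suc k) = ext T ^^ Suc k" by blast+
    show ?case unfolding eq e[symmetric]
      using supported_comp[OF l s T] ext_comp[OF T s] by blast
  qed (use T in simp)
  let ?U = "T ^^ Suc n"
  have lU: "lin ?U" using pow[of n] supported_def by blast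
  have ext_U: "ext ?U f = 0" for f
  proof -
    have "ext ?U f = ext T ((ext T ^^ n) f)" using pow[of n] by simp
    also have "\<dots> = 0" using n K.lin_0[OF lin_ext] by simp
    finally show ?thesis .
  qed
  have Uj: "?U j = 0" if j: "j \<in> B" for j
  proof -
    have "representation B (?U j) i = 0" for i
    proof (cases "i \<in> B")
      case True
      have "0 = ext ?U (\<lambda>k. if k = j then 1 else 0) i" unfolding ext_U by simp
      also have "\<dots> = (\<Sum>k\<in>B. if k = j then column ?U j i else 0)"
        unfolding ext_apply by (rule sum.cong) auto
      also have "\<dots> = column ?U j i" using B(1) j by simp
      finally show ?thesis using True by (simp add: column_def)
    next
      case False
      then show ?thesis using representation_ne_zero by blast
    qed
    moreover have "?U j \<in> span B" using pow[of n] supported_def by blast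
    ultimately show ?thesis using sum_representation_eq[OF B(2), of "?U j"] B(1) by auto
  qed
  have "?U v = 0" if "v \<in> span B" for v
    using that
  proof (induction rule: span_induct_alt)
    case base show ?case by (rule lin_0[OF lU])
  next
    case (step c x y)
    then show ?case using Uj lU by (simp add: lin_iff del: funpow.simps)
  qed
  then have "(T ^^ Suc (Suc n)) v = 0" for v
    using r[of v] by (simp add: funpow_swap1)
  then show ?thesis by blast
qed

text \<open>The closed-field statement is applied to the extended operators and their linear span
  over the closure; vanishing of the form and stability under commutators pass to the span by
  bilinearity.\<close>

lemma trace_form_nilpotent_supported:
  assumes N: "\<And>u. u \<in> N \<Longrightarrow> supported u"
      "\<And>u w. u \<in> N \<Longrightarrow> w \<in> N \<Longrightarrow> (\<lambda>v. u (w v) - w (u v)) \<in> N"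
    and x: "x \<in> N" "x \<in> module.span opscale {(\<lambda>v. u (w v) - w (u v)) | u w. u \<in> N \<and> w \<in> N}"
    and tr: "\<And>u w. u \<in> N \<Longrightarrow> w \<in> N \<Longrightarrow> trace (\<lambda>v. u (w v)) = 0"
  shows "\<exists>n. \<forall>v. (x ^^ n) v = 0"
proof -
  interpret op: vec_space opscale by (rule vec_space_opscale)
  interpret Kop: vec_space "K.opscale :: _ \<Rightarrow> (_ \<Rightarrow> 'b \<Rightarrow> 'a alg_closure) \<Rightarrow> _" by (rule K.vec_space_opscale)
  let ?M = "Kop.span (ext ` N)"
  have comm: "(\<lambda>f. ext u (ext w f) - ext w (ext u f)) = ext (\<lambda>v. u (w v) - w (u v))"
    if "u \<in> N" "w \<in> N" for u w
  proof -
    note s = N(1)[OF that(1)] N(1)[OF that(2)]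
    have "supported (\<lambda>v. u (w v))" "supported (\<lambda>v. w (u v))"
      using supported_comp s supported_def by blast+
    then show ?thesis by (simp add: fun_eq_iff ext_diff ext_comp[OF s] ext_comp[OF s(2,1)])
  qed
  have "\<exists>n. \<forall>f. (ext x ^^ n) f = 0"
  proof (rule K.trace_form_nilpotent[of "ext x" "ext ` N" ?M])
    show "K.finrank (ext x)" by (rule finrank_ext)
    show "\<And>u. u \<in> ext ` N \<Longrightarrow> K.finrank u" using finrank_ext by auto
    show "ext ` N \<subseteq> ?M" by (rule Kop.span_superset)
    show "module.subspace K.opscale ?M" by (rule Kop.subspace_span)
    show fM: "K.finrank z" if "z \<in> ?M" for z
      using that
    proof (induction rule: Kop.span_induct_alt)
      case base show ?case using K.finrank_zero by (simp add: zero_fun_def)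
    next
      case (step c d z)
      then obtain u where u: "d = ext u" by blast
      have "K.finrank (\<lambda>v. fun_scale c (d v) + z v)"
        unfolding u by (rule K.finrank_add[OF K.finrank_scale[OF finrank_ext] step(2)])
      then show ?case by (simp add: K.opscale_def plus_fun_def)
    qed
    show "(\<lambda>v. ext x (z v) - z (ext x v)) \<in> ?M" if "z \<in> ?M" for z
      using that
    proof (induction rule: Kop.span_induct_alt)
      case base
      show ?case using Kop.span_zero K.lin_0[OF lin_ext[of x]] by (simp add: zero_fun_def[abs_def])
    next
      case (step c d z)
      then obtain u where u: "u \<in> N" "d = ext u" by blast
      have "(\<lambda>v. ext x (ext u v) - ext u (ext x v)) \<in> ?M"
        unfolding comm[OF x(1) u(1)] using N(2)[OF x(1) u(1)] by (auto intro: Kop.span_base)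
      then have "K.opscale c (\<lambda>v. ext x (ext u v) - ext u (ext x v)) + (\<lambda>v. ext x (z v) - z (ext x v)) \<in> ?M"
        using step(2) by (intro Kop.span_add Kop.span_scale)
      also have "K.opscale c (\<lambda>v. ext x (ext u v) - ext u (ext x v)) + (\<lambda>v. ext x (z v) - z (ext x v))
        = (\<lambda>v. ext x ((K.opscale c d + z) v) - (K.opscale c d + z) (ext x v))"
      proof
        fix f
        have "ext x (g + h) = ext x g + ext x h" "ext x (fun_scale c g) = fun_scale c (ext x g)" for g h
          using lin_ext[of x] K.lin_iff by blast+
        then show "(K.opscale c (\<lambda>v. ext x (ext u v) - ext u (ext x v)) + (\<lambda>v. ext x (z v) - z (ext x v))) f
          = ext x ((K.opscale c d + z) f) - (K.opscale c d + z) (ext x f)"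
          unfolding plus_fun_apply u(2) K.opscale_def by (simp only: K.scale_right_diff_distrib) (simp add: fun_eq_iff)
      qed
      finally show ?case .
    qed
    have "K.finrank w \<and> K.trace (\<lambda>v. u (w v)) = 0" if u: "u \<in> ext ` N" and w: "w \<in> ?M" for u w
      using w
    proof (induction rule: Kop.span_induct_alt)
      case base
      show ?case using K.trace_zero K.finrank_zero u K.lin_0[OF lin_ext] by (auto simp: zero_fun_def[abs_def])
    next
      case (step c d z)
      obtain u' where u': "u' \<in> N" "u = ext u'" using u by blast
      obtain d' where d': "d' \<in> N" "d = ext d'" using step by blast
      have "ext (\<lambda>v. u' (d' v)) = (\<lambda>v. u (d v))"
        unfolding u' d' using ext_comp N(1) u'(1) d'(1) by blast
      moreover have "supported (\<lambda>v. u' (d' v))"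
        using supported_comp N(1) u'(1) d'(1) supported_def by blast
      ultimately have 0: "K.trace (\<lambda>v. u (d v)) = 0"
        using trace_ext[of "\<lambda>v. u' (d' v)"] tr[OF u'(1) d'(1)] by simp
      have z: "K.finrank z" using step(2) by blast
      have cz: "K.finrank (K.opscale c d + z)"
        using K.finrank_add[OF K.finrank_scale[OF finrank_ext] z] by (simp add: d' K.opscale_def plus_fun_def)
      have "(\<lambda>v. u ((K.opscale c d + z) v)) = (\<lambda>v. fun_scale c (u (d v)) + u (z v))"
        using lin_ext[of u'] unfolding u'(2) K.lin_iff by (simp add: K.opscale_def plus_fun_def)
      with cz show ?case
        using 0 step(2) K.trace_add[OF K.finrank_scale K.finrank_comp, of "\<lambda>v. u (d v)" u z c] K.trace_scale[of "\<lambda>v. u (d v)" c]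
          K.finrank_comp[of u d] u'(2) d'(2) lin_ext finrank_ext z by (simp del: plus_fun_apply)
    qed
    then show "\<And>u w. u \<in> ext ` N \<Longrightarrow> w \<in> ?M \<Longrightarrow> K.trace (\<lambda>v. u (w v)) = 0" by blast
    have "supported y \<and> ext y \<in> Kop.span {(\<lambda>v. u (w v) - w (u v)) | u w. u \<in> ext ` N \<and> w \<in> ext ` N}"
      if "y \<in> op.span {(\<lambda>v. u (w v) - w (u v)) | u w. u \<in> N \<and> w \<in> N}" for y
      using that
    proof (induction rule: op.span_induct_alt)
      case base
      show ?case
        using ext_zero Kop.span_zero span_zero by (simp add: supported_def lin_iff zero_fun_def[abs_def])
    next
      case (step c d y)
      then obtain u w where uw: "u \<in> N" "w \<in> N" "d = (\<lambda>v. u (w v) - w (u v))" by blast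
      then have d: "supported d" using N by blast
      have "ext d \<in> Kop.span {(\<lambda>v. u (w v) - w (u v)) | u w. u \<in> ext ` N \<and> w \<in> ext ` N}"
        unfolding uw(3) comm[OF uw(1,2), symmetric] using uw by (intro Kop.span_base) blast
      with step(2) d show ?case
        by (auto simp only: ext_comb intro!: supported_comb Kop.span_add Kop.span_scale)
    qed
    with x(2) show "ext x \<in> Kop.span {(\<lambda>v. u (w v) - w (u v)) | u w. u \<in> ext ` N \<and> w \<in> ext ` N}" by blast
  qed
  then show ?thesis using ext_nilpotent N(1) x(1) by blast
qed

end

section \<open>Engel's theorem and Cartan's criterion\<close>

locale fd_lie_algebra = lie_algebra sL br + char_0_space sL
  for sL :: "'f::field_char_0 \<Rightarrow> 'l::ab_group_add \<Rightarrow> 'l" and br :: "'l \<Rightarrow> 'l \<Rightarrow> 'l" +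
  assumes fin_dim_UNIV: "fin_dim UNIV"
begin

lemma fin_dim_any: "fin_dim U"
  using fin_dim_UNIV fin_dim_subset by blast

lemma br_add: "br (x + y) z = br x z + br y z" "br z (x + y) = br z x + br z y"
  and br_scale: "br (sL c x) z = sL c (br x z)" "br z (sL c x) = sL c (br z x)"
  using bracket_bilinear unfolding bilinear_map_def linear_iff_add_scale by blast+

lemma br_skew: "br x y = - br y x"
proof -
  have "br (x + y) (x + y) = (br x x + br x y) + (br y x + br y y)"
    by (simp only: br_add add_ac)
  then have "br x y + br y x = 0" by (simp add: bracket_alternating)
  then show ?thesis by (rule eq_neg_iff_add_eq_0[THEN iffD2])
qed

lemma lin_br: "lin (br x)"
  by (simp add: lin_iff br_add br_scale)

lemma lin_br_left: "lin (\<lambda>y. br y x)"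
  by (simp add: lin_iff br_add br_scale)

lemma br_0 [simp]: "br x 0 = 0" "br 0 x = 0"
  using lin_0[OF lin_br] lin_0[OF lin_br_left] by auto

lemma br_minus: "br (- x) y = - br x y" "br x (- y) = - br x y"
  using br_skew br_0 by (metis add.right_inverse add_eq_0_iff br_add)+

lemma br_br: "br (br x y) z = br x (br y z) - br y (br x z)"
proof -
  have "br z (br x y) = - br x (br y z) - br y (br z x)"
    using jacobi[of x y z] by (simp add: algebra_simps eq_neg_iff_add_eq_0)
  then show ?thesis using br_skew[of "br x y" z] br_skew[of z x] by (simp add: br_minus)
qed

lemma in_span_insert_subspace:
  "subspace U \<Longrightarrow> x \<in> span (insert z U) \<longleftrightarrow> (\<exists>u\<in>U. \<exists>c. x = u + sL c z)"
proof -
  assume U: "subspace U"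
  have "x \<in> span (insert z U) \<longleftrightarrow> (\<exists>c. x - sL c z \<in> U)"
    by (simp add: span_breakdown_eq span_eq_iff[THEN iffD2, OF U])
  also have "\<dots> \<longleftrightarrow> (\<exists>u\<in>U. \<exists>c. x = u + sL c z)"
    by (metis add_diff_cancel_right' diff_add_cancel)
  finally show ?thesis .
qed

text \<open>Engel's argument on \<open>N / I\<close>: a subalgebra \<open>K\<close> is good if every proper inclusion of \<open>K\<close>-stable
  subspaces has an invariant vector modulo the smaller one, and a good \<open>K \<noteq> N\<close> can be enlarged.
  That \<open>N\<close> itself is good contradicts \<open>N = [N, N]\<close>.\<close>
lemma engel_perfect:
  assumes N: "subspace N" "\<And>x y. x \<in> N \<Longrightarrow> y \<in> N \<Longrightarrow> br x y \<in> N"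
    and I: "subspace I" "I \<subseteq> N" "\<And>x y. x \<in> N \<Longrightarrow> y \<in> I \<Longrightarrow> br x y \<in> I"
    and nil: "\<And>x y. x \<in> N \<Longrightarrow> y \<in> N \<Longrightarrow> \<exists>k. (br x ^^ k) y \<in> I"
    and perfect: "N \<subseteq> span {br x y | x y. x \<in> N \<and> y \<in> N}"
  shows "N \<subseteq> I"
proof (rule ccontr)
  assume "\<not> N \<subseteq> I"
  define stable where "stable K U \<longleftrightarrow> subspace U \<and> I \<subseteq> U \<and> U \<subseteq> N \<and> (\<forall>k\<in>K. \<forall>u\<in>U. br k u \<in> U)" for K U
  define good where "good K \<longleftrightarrow> stable K K \<and>
    (\<forall>U' U. stable K U' \<and> stable K U \<and> U' \<subset> U \<longrightarrow> (\<exists>v\<in>U - U'. \<forall>k\<in>K. br k v \<in> U'))" for K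
  \<comment> \<open>Since \<open>I\<close> is an ideal of \<open>N\<close> contained in every stable
    subspace, it acts as zero on any such quotient.\<close>
  have "good I"
    unfolding good_def
  proof (intro conjI allI impI)
    show "stable I I" using I by (auto simp: stable_def)
    fix U' U assume U: "stable I U' \<and> stable I U \<and> U' \<subset> U"
    then obtain v where v: "v \<in> U - U'" by blast
    have "br k v \<in> U'" if "k \<in> I" for k
    proof -
      have "br v k \<in> I" using U v that I(3) by (auto simp: stable_def)
      then show ?thesis using U br_skew[of k v] subspace_neg[OF I(1)] by (auto simp: stable_def)
    qed
    with v show "\<exists>v\<in>U - U'. \<forall>k\<in>I. br k v \<in> U'" by blast
  qed
  then have "\<exists>K. good K \<and> (\<forall>K'. good K' \<longrightarrow> dim K' \<le> dim K)"
    by (rule ex_has_greatest_nat[of _ _ _ "Suc (dim N)"])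
      (auto intro!: le_imp_less_Suc dim_mono_fin[OF fin_dim_any] simp: good_def stable_def)
  then obtain K where K: "good K" and max: "\<forall>K'. good K' \<longrightarrow> dim K' \<le> dim K" by blast
  have sK: "stable K K" using K good_def by blast
  have subK: "subspace K" "I \<subseteq> K" "K \<subseteq> N" "\<And>x y. x \<in> K \<Longrightarrow> y \<in> K \<Longrightarrow> br x y \<in> K"
    using sK by (auto simp: stable_def)
  have "K = N"
  proof (rule ccontr)
    assume "K \<noteq> N"
    then have "K \<subset> N" using subK(3) by blast
    moreover have "stable K N" using N I subK(3) by (auto simp: stable_def)
    \<comment> \<open>Goodness applied to the inclusion of \<open>K\<close> in \<open>N\<close>
      gives a vector normalising \<open>K\<close>.\<close>
    ultimately obtain z where z': "z \<in> N - K" "\<forall>k\<in>K. br k z \<in> K"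
      using K sK unfolding good_def by blast
    then have z: "z \<in> N" "z \<notin> K" "\<And>k. k \<in> K \<Longrightarrow> br k z \<in> K" by blast+
    define K' where "K' = span (insert z K)"
    have K'_iff: "x \<in> K' \<longleftrightarrow> (\<exists>k\<in>K. \<exists>c. x = k + sL c z)" for x
      unfolding K'_def by (rule in_span_insert_subspace[OF subK(1)])
    have KK': "K \<subseteq> K'" "z \<in> K'" unfolding K'_def using span_superset by blast+
    have zK: "br z k \<in> K" if "k \<in> K" for k
      using subspace_neg[OF subK(1) z(3)[OF that]] br_skew[of z k] by simp
    have "good K'"
      unfolding good_def
    proof (intro conjI allI impI)
      show "stable K' K'"
        unfolding stable_def
      proof (intro conjI ballI)
        show "subspace K'" unfolding K'_def by (rule subspace_span)
        show "I \<subseteq> K'" using KK' subK(2) by blast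
        show "K' \<subseteq> N" unfolding K'_def by (rule span_minimal) (use z(1) subK(3) N(1) in auto)
        fix x y assume "x \<in> K'" "y \<in> K'"
        then obtain k c l d where *: "k \<in> K" "x = k + sL c z" "l \<in> K" "y = l + sL d z"
          unfolding K'_iff by blast
        have "br x y = br k l + sL d (br k z) + sL c (br z l)"
          unfolding *(2,4) by (simp add: br_add br_scale bracket_alternating scale_right_distrib)
        also have "\<dots> \<in> K"
          using * subK z(3) zK by (intro subspace_add subspace_scale) auto
        finally show "br x y \<in> K'" using KK' by blast
      qed
      fix U' U assume "stable K' U' \<and> stable K' U \<and> U' \<subset> U"
      then have U: "stable K' U'" "stable K' U" "U' \<subset> U" by blast+
      have "stable K U'" "stable K U" using U(1,2) KK' by (auto simp: stable_def)
      then obtain v0 where v0: "v0 \<in> U - U'" "\<forall>k\<in>K. br k v0 \<in> U'"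
        using K U(3) unfolding good_def by blast
      have subU: "subspace U'" "U \<subseteq> N" "I \<subseteq> U'" using U by (auto simp: stable_def)
      \<comment> \<open>As [k, z] lies in \<open>K\<close>, applying \<open>br z\<close> keeps a
        vector invariant under \<open>K\<close> modulo \<open>U'\<close>.\<close>
      have inv: "(br z ^^ i) v0 \<in> U \<and> (\<forall>k\<in>K. br k ((br z ^^ i) v0) \<in> U')" for i
      proof (induction i)
        case (Suc i)
        let ?w = "(br z ^^ i) v0"
        have "br k (br z ?w) \<in> U'" if "k \<in> K" for k
        proof -
          have "br k (br z ?w) = br (br k z) ?w + br z (br k ?w)" by (simp add: br_br)
          moreover have "br (br k z) ?w \<in> U'" using Suc z(3) that by blast
          moreover have "br z (br k ?w) \<in> U'" using Suc that U(1) KK'(2) by (auto simp: stable_def)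
          ultimately show ?thesis using subspace_add[OF subU(1)] by simp
        qed
        moreover have "br z ?w \<in> U" using Suc U(2) KK'(2) by (auto simp: stable_def)
        ultimately show ?case by simp
      qed (use v0 in auto)
      have ex: "\<exists>k. (br z ^^ k) v0 \<in> U'" using nil[OF z(1), of v0] v0(1) subU by blast
      \<comment> \<open>The last vector of this orbit outside \<open>U'\<close> is killed modulo
        \<open>U'\<close> by \<open>K\<close> and also by \<open>z\<close>.\<close>
      define k where "k = (LEAST k. (br z ^^ k) v0 \<in> U')"
      have k: "(br z ^^ k) v0 \<in> U'" unfolding k_def using ex by (rule LeastI_ex)
      then have "k \<noteq> 0" using v0(1) by (cases k) auto
      then obtain j where j: "k = Suc j" using not0_implies_Suc by blast
      define v where "v = (br z ^^ j) v0"
      have "v \<notin> U'" using not_less_Least[of j "\<lambda>k. (br z ^^ k) v0 \<in> U'"] j by (auto simp: k_def v_def)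
      moreover have "v \<in> U" "\<forall>k\<in>K. br k v \<in> U'" using inv[of j] by (auto simp: v_def)
      moreover have "br z v \<in> U'" using k by (simp add: j v_def)
      ultimately show "\<exists>v\<in>U - U'. \<forall>k\<in>K'. br k v \<in> U'"
        using subU(1) by (intro bexI[of _ v]) (auto simp: K'_iff br_add br_scale intro!: subspace_add subspace_scale)
    qed
    with max have "dim K' \<le> dim K" by blast
    moreover have "dim K < dim K'"
      by (rule subspace_dim_less[OF fin_dim_any subK(1)]) (use KK' z(2) K'_def in auto)
    ultimately show False by simp
  qed
  \<comment> \<open>For a maximal proper stable \<open>U\<close> the invariant vector spans N / U,
    so [N, N] lies in \<open>U\<close>, contrary to perfectness.\<close>
  define proper where "proper U \<longleftrightarrow> stable N U \<and> U \<noteq> N" for U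
  have "proper I" using I \<open>\<not> N \<subseteq> I\<close> by (auto simp: proper_def stable_def)
  then have "\<exists>U. proper U \<and> (\<forall>U'. proper U' \<longrightarrow> dim U' \<le> dim U)"
    by (rule ex_has_greatest_nat[of _ _ _ "Suc (dim N)"])
      (auto intro!: le_imp_less_Suc dim_mono_fin[OF fin_dim_any] simp: proper_def stable_def)
  then obtain U where U: "proper U" and maxU: "\<forall>U'. proper U' \<longrightarrow> dim U' \<le> dim U" by blast
  have sU: "stable N U" "U \<subset> N" using U by (auto simp: proper_def stable_def)
  then obtain v where v: "v \<in> N - U" "\<forall>k\<in>N. br k v \<in> U"
    using K sK unfolding \<open>K = N\<close> good_def by blast
  define U' where "U' = span (insert v U)"
  have subU: "subspace U" using sU stable_def by blast
  have U'_iff: "x \<in> U' \<longleftrightarrow> (\<exists>u\<in>U. \<exists>c. x = u + sL c v)" for x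
    unfolding U'_def by (rule in_span_insert_subspace[OF subU])
  have UU': "U \<subseteq> U'" "v \<in> U'" unfolding U'_def using span_superset by blast+
  have brU: "br x y \<in> U" if "x \<in> N" "y \<in> U'" for x y
    using that sU(1) v(2) subU by (auto simp: U'_iff br_add br_scale stable_def intro!: subspace_add subspace_scale)
  have "U' = N"
  proof (rule ccontr)
    assume "U' \<noteq> N"
    have "U' \<subseteq> N" unfolding U'_def by (rule span_minimal) (use v(1) sU(2) N(1) in auto)
    then have "proper U'"
      using \<open>U' \<noteq> N\<close> sU UU' brU subspace_span by (auto simp: proper_def stable_def U'_def)
    with maxU have "dim U' \<le> dim U" by blast
    moreover have "dim U < dim U'"
      by (rule subspace_dim_less[OF fin_dim_any subU]) (use UU' v(1) U'_def in auto)
    ultimately show False by simp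
  qed
  have "span {br x y | x y. x \<in> N \<and> y \<in> N} \<subseteq> U"
    by (rule span_minimal) (use brU subU \<open>U' = N\<close> in auto)
  with perfect v(1) show False by blast
qed

abbreviation derived :: "'l set \<Rightarrow> nat \<Rightarrow> 'l set"
  where "derived \<equiv> derived_series sL br"

lemma derived_subalgebra:
  assumes "subspace N" "\<And>x y. x \<in> N \<Longrightarrow> y \<in> N \<Longrightarrow> br x y \<in> N"
  shows "subspace (derived N n) \<and> derived N (Suc n) \<subseteq> derived N n"
proof (induction n)
  case 0
  have "span {br x y | x y. x \<in> N \<and> y \<in> N} \<subseteq> N"
    by (rule span_minimal) (use assms in auto)
  then show ?case using assms(1) by simp
next
  case (Suc n)
  then show ?case
    by (auto intro!: span_mono subsetD[OF span_mono])
qed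

lemma derived_subset:
  assumes "subspace N" "\<And>x y. x \<in> N \<Longrightarrow> y \<in> N \<Longrightarrow> br x y \<in> N"
  shows "derived N n \<subseteq> N"
proof (induction n)
  case (Suc n)
  then show ?case using derived_subalgebra[OF assms, of n] by blast
qed simp

lemma derived_stabilizes:
  assumes "subspace N" "\<And>x y. x \<in> N \<Longrightarrow> y \<in> N \<Longrightarrow> br x y \<in> N"
  obtains n where "derived N (Suc n) = derived N n"
proof -
  define n where "n = (ARG_MIN (\<lambda>n. dim (derived N n)) n. True)"
  have "dim (derived N n) \<le> dim (derived N (Suc n))"
    unfolding n_def by (rule arg_min_nat_le) simp
  then have "\<not> derived N (Suc n) \<subset> derived N n"
    using subspace_dim_less[OF fin_dim_any] derived_subalgebra[OF assms] by (meson leD)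
  then show ?thesis using that derived_subalgebra[OF assms, of n] by blast
qed

end

text \<open>The space may be infinite dimensional; a common finite dimensional range is what an
  action on a finite dimensional subspace has after composition with a projection onto it.\<close>

locale finrank_rep = lie_representation sL br sV \<psi> + L: fd_lie_algebra sL br + V: char_0_space sV
  for sL :: "'f::field_char_0 \<Rightarrow> 'l::ab_group_add \<Rightarrow> 'l" and br :: "'l \<Rightarrow> 'l \<Rightarrow> 'l"
    and sV :: "'f \<Rightarrow> 'v::ab_group_add \<Rightarrow> 'v" and \<psi> :: "'l \<Rightarrow> 'v \<Rightarrow> 'v" +
  assumes common_range: "\<exists>U. V.fin_dim U \<and> (\<forall>x v. \<psi> x v \<in> U)"
begin

lemma psi_add: "\<psi> (x + y) v = \<psi> x v + \<psi> y v" "\<psi> x (v + w) = \<psi> x v + \<psi> x w"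
  and psi_scale: "\<psi> (sL c x) v = sV c (\<psi> x v)" "\<psi> x (sV c v) = sV c (\<psi> x v)"
  using rep_bilinear unfolding bilinear_map_def linear_iff_add_scale by blast+

lemma lin_psi: "V.lin (\<psi> x)"
  by (simp add: V.lin_iff psi_add psi_scale)

lemma psi_0 [simp]: "\<psi> 0 v = 0" "\<psi> x 0 = 0"
  using psi_scale(1)[of 0 0] psi_scale(2)[of x 0 0] by simp_all

lemma finrank_psi: "V.finrank (\<psi> x)"
  using common_range V.finrankI[OF lin_psi] by metis

text \<open>\<open>commutator_power_vanishes\<close> with both roots 0 and both projections the
  identity, written as the polynomial 1.\<close>

lemma psi_nilpotent_ad:
  assumes "\<forall>v. (\<psi> x ^^ n) v = 0"
  shows "\<psi> ((br x ^^ (2 * n)) y) v = 0"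
proof -
  interpret op: vec_space V.opscale by (rule V.vec_space_opscale)
  define D where "D = (\<lambda>z v. \<psi> x (z v) - z (\<psi> x v))"
  have lD: "op.lin D"
    by (auto simp: D_def op.lin_iff V.opscale_def fun_eq_iff psi_add psi_scale V.scale_right_diff_distrib)
  have X: "V.papp [:- 0, 1:] (\<psi> x) = \<psi> x" "op.papp [:- (0 - 0), 1:] D = D"
    using V.papp_X[OF lin_psi] op.papp_X[OF lD] by auto
  have "op.papp ([:- (0 - 0), 1:] ^ (2 * n)) D (\<lambda>v. V.papp 1 (\<psi> x) (\<psi> y (V.papp 1 (\<psi> x) v))) = (\<lambda>v. 0)"
    by (rule V.commutator_power_vanishes[OF lin_psi lin_psi D_def _ _ refl refl])
      (unfold V.papp_power[OF lin_psi] X V.papp_1[OF lin_psi], (rule assms)+)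
  then have "(D ^^ (2 * n)) (\<psi> y) = (\<lambda>v. 0)"
    unfolding op.papp_power[OF lD] X V.papp_1[OF lin_psi] .
  moreover have "(D ^^ k) (\<psi> y) = \<psi> ((br x ^^ k) y)" for k
    by (induction k) (auto simp: D_def rep_bracket)
  ultimately show ?thesis by metis
qed

text \<open>Perfectness puts every operator in the span of commutators, so all are nilpotent by the
  trace argument. Then \<open>ad x\<close> is nilpotent modulo the kernel of \<open>\<psi>\<close>,
  and Engel's argument puts \<open>N\<close> into this kernel.\<close>

lemma trace_zero_perfect:
  assumes N: "L.subspace N" "\<And>x y. x \<in> N \<Longrightarrow> y \<in> N \<Longrightarrow> br x y \<in> N"
    and perfect: "N \<subseteq> L.span {br x y | x y. x \<in> N \<and> y \<in> N}"
    and tr: "\<And>x y. x \<in> N \<Longrightarrow> y \<in> N \<Longrightarrow> V.trace (\<lambda>v. \<psi> x (\<psi> y v)) = 0"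
    and x: "x \<in> N"
  shows "\<psi> x v = 0"
proof -
  interpret op: vec_space V.opscale by (rule V.vec_space_opscale)
  obtain U where U: "V.fin_dim U" "\<forall>x v. \<psi> x v \<in> U" using common_range by blast
  obtain B where B: "finite B" "V.independent B" "V.span B = V.span U" "B \<subseteq> V.span U" "card B = V.dim (V.span U)"
    by (rule V.fin_dim_basis[OF V.fin_dim_span[OF U(1)] V.subspace_span])
  interpret bc: base_change sV B by unfold_locales (use B in auto)
  have sup: "bc.supported (\<psi> x)" for x
    using U(2) V.span_superset unfolding bc.supported_def B(3) by (auto simp: lin_psi)
  have comm: "(\<lambda>v. \<psi> x (\<psi> y v) - \<psi> y (\<psi> x v)) = \<psi> (br x y)" for x y
    by (simp add: rep_bracket fun_eq_iff)
  have nilp: "\<exists>n. \<forall>v. (\<psi> x ^^ n) v = 0" if x: "x \<in> N" for x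
  proof (rule bc.trace_form_nilpotent_supported[of "\<psi> ` N"])
    show "\<psi> x \<in> \<psi> ` N" using x by blast
    show "\<And>u. u \<in> \<psi> ` N \<Longrightarrow> bc.supported u" using sup by blast
    show "\<And>u w. u \<in> \<psi> ` N \<Longrightarrow> w \<in> \<psi> ` N \<Longrightarrow> (\<lambda>v. u (w v) - w (u v)) \<in> \<psi> ` N"
      using comm N(2) by auto
    show "\<And>u w. u \<in> \<psi> ` N \<Longrightarrow> w \<in> \<psi> ` N \<Longrightarrow> V.trace (\<lambda>v. u (w v)) = 0"
      using tr by auto
    let ?C = "{(\<lambda>v. u (w v) - w (u v)) | u w. u \<in> \<psi> ` N \<and> w \<in> \<psi> ` N}"
    have "x \<in> L.span {br x y | x y. x \<in> N \<and> y \<in> N}" using x perfect by blast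
    then show "\<psi> x \<in> op.span ?C"
    proof (induction rule: L.span_induct_alt)
      case base
      have "\<psi> 0 = 0" by (simp add: fun_eq_iff)
      then show ?case by (simp only: op.span_zero)
    next
      case (step c d y)
      then obtain a b where ab: "a \<in> N" "b \<in> N" "d = br a b" by blast
      then have "\<psi> d \<in> op.span ?C"
        unfolding ab(3) comm[symmetric] by (intro op.span_base) blast
      then have "V.opscale c (\<psi> d) + \<psi> y \<in> op.span ?C"
        using step(2) by (intro op.span_add op.span_scale)
      moreover have "\<psi> (sL c d + y) = V.opscale c (\<psi> d) + \<psi> y"
        by (simp add: fun_eq_iff psi_add psi_scale V.opscale_def)
      ultimately show ?case by (simp only:)
    qed
  qed
  let ?I = "{x \<in> N. \<forall>v. \<psi> x v = 0}"
  have "N \<subseteq> ?I"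
  proof (rule L.engel_perfect[OF N _ _ _ _ perfect])
    show "L.subspace ?I"
      using N(1) by (auto simp: L.subspace_def psi_add psi_scale)
    show "?I \<subseteq> N" by blast
    show "\<And>x y. x \<in> N \<Longrightarrow> y \<in> ?I \<Longrightarrow> br x y \<in> ?I"
      using N(2) by (simp add: rep_bracket)
    fix x y assume xy: "x \<in> N" "y \<in> N"
    have "(br x ^^ k) y \<in> N" for k by (induction k) (use xy N(2) in auto)
    then show "\<exists>k. (br x ^^ k) y \<in> ?I"
      using nilp[OF xy(1)] psi_nilpotent_ad by blast
  qed
  with x show ?thesis by blast
qed

text \<open>Cartan's criterion for the image of \<open>N\<close>: the derived series becomes
  stationary at a perfect subalgebra, which acts as zero.\<close>

theorem trace_zero_derived:
  assumes N: "L.subspace N" "\<And>x y. x \<in> N \<Longrightarrow> y \<in> N \<Longrightarrow> br x y \<in> N"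
    and tr: "\<And>x y. x \<in> N \<Longrightarrow> y \<in> N \<Longrightarrow> V.trace (\<lambda>v. \<psi> x (\<psi> y v)) = 0"
  obtains n where "\<forall>x\<in>derived_series sL br N n. \<forall>v. \<psi> x v = 0"
proof -
  obtain n where n: "L.derived N (Suc n) = L.derived N n" by (rule L.derived_stabilizes[OF N])
  note D = L.derived_subalgebra[OF N, of n] and S = L.derived_subset[OF N, of n]
  have "\<psi> x v = 0" if "x \<in> L.derived N n" for x v
  proof (rule trace_zero_perfect[of "L.derived N n"])
    show "L.subspace (L.derived N n)" using D by blast
    show "\<And>x y. x \<in> L.derived N n \<Longrightarrow> y \<in> L.derived N n \<Longrightarrow> br x y \<in> L.derived N n"
      using n by (auto intro!: L.span_base)
    show "L.derived N n \<subseteq> L.span {br x y | x y. x \<in> L.derived N n \<and> y \<in> L.derived N n}"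
      using n by auto
  qed (use tr S that in auto)
  then show ?thesis using that by blast
qed

end

section \<open>Casimir elements and Weyl's theorem\<close>

context vec_space
begin

lemma lin_funpow: "lin T \<Longrightarrow> lin (T ^^ n)"
  by (induction n) (auto simp: lin_iff)

lemma lin_image_subspace: "lin T \<Longrightarrow> subspace U \<Longrightarrow> subspace (T ` U)"
  using Modules.module_hom.subspace_image[of scale scale T U] by (simp add: module_hom_iff_linear)

lemma independent_inj_image:
  assumes "lin T" "finite B" "independent B" "\<And>v. v \<in> span B \<Longrightarrow> T v = 0 \<Longrightarrow> v = 0"
  shows "independent (T ` B)" "card (T ` B) = card B"
proof -
  have inj: "inj_on T (span B)"
  proof (rule inj_onI)
    fix x y assume "x \<in> span B" "y \<in> span B" "T x = T y"
    then show "x = y" using assms(4)[of "x - y"] lin_diff[OF assms(1)] span_diff by auto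
  qed
  interpret p: vector_space_pair scale scale by unfold_locales
  show "independent (T ` B)" by (rule p.linear_independent_injective_image[OF assms(1,3) inj])
  show "card (T ` B) = card B" by (rule card_image[OF inj_on_subset[OF inj span_superset]])
qed

lemma kernel_nontrivial:
  assumes "lin T" "fin_dim U" "subspace U" "subspace W" "\<And>v. T v \<in> W" "fin_dim W" "dim W < dim U"
  obtains x where "x \<in> U" "x \<noteq> 0" "T x = 0"
proof (rule ccontr)
  assume *: "\<not> thesis"
  obtain B where B: "finite B" "independent B" "span B = U" "B \<subseteq> U" "card B = dim U"
    by (rule fin_dim_basis[OF assms(2,3)])
  obtain C where C: "finite C" "independent C" "span C = W" "C \<subseteq> W" "card C = dim W"
    by (rule fin_dim_basis[OF assms(6,4)])
  have i: "independent (T ` B)" "card (T ` B) = card B"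
    using independent_inj_image[OF assms(1) B(1,2)] * that B(3) by blast+
  have "card (T ` B) \<le> card C"
    using independent_span_bound[OF C(1) i(1)] C(3) assms(5) by blast
  then show False using i(2) B(5) C(5) assms(7) by simp
qed

lemma inj_subspace_surj:
  assumes "lin T" "fin_dim U" "subspace U" "\<And>v. v \<in> U \<Longrightarrow> T v \<in> U" "\<And>v. v \<in> U \<Longrightarrow> T v = 0 \<Longrightarrow> v = 0"
  shows "T ` U = U"
proof -
  obtain B where B: "finite B" "independent B" "span B = U" "B \<subseteq> U" "card B = dim U"
    by (rule fin_dim_basis[OF assms(2,3)])
  have i: "independent (T ` B)" "card (T ` B) = card B"
    using independent_inj_image[OF assms(1) B(1,2)] assms(5) B(3) by blast+
  have "span (T ` B) \<subseteq> T ` U"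
    by (rule span_minimal) (use B(4) lin_image_subspace[OF assms(1,3)] in auto)
  moreover have "T ` U \<subseteq> U" using assms(4) by blast
  moreover have "\<not> span (T ` B) \<subset> U"
    using subspace_dim_less[OF assms(2) subspace_span assms(3), of "T ` B"]
      dim_span_eq_card_independent[OF i(1)] i(2) B(5) by auto
  ultimately show ?thesis by blast
qed

end

section \<open>The trace form of a representation\<close>

context finrank_rep
begin

definition form :: "'l \<Rightarrow> 'l \<Rightarrow> 'f"
  where "form x y = V.trace (\<lambda>v. \<psi> x (\<psi> y v))"

lemma finrank_psi2: "V.finrank (\<lambda>v. \<psi> x (\<psi> y v))"
  by (rule V.finrank_comp[OF lin_psi finrank_psi])

lemma form_sym: "form x y = form y x"
  unfolding form_def by (rule V.trace_commute[OF lin_psi finrank_psi])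

lemma form_add: "form (x + y) z = form x z + form y z" "form z (x + y) = form z x + form z y"
  by (auto simp: form_def psi_add finrank_psi2 intro: V.trace_add)

lemma form_scale: "form (sL c x) z = c * form x z" "form z (sL c x) = c * form z x"
  by (auto simp: form_def psi_scale finrank_psi2 intro: V.trace_scale)

lemma functional_form: "L.functional (form x)"
  by (simp add: L.functional_iff form_add form_scale)

lemma form_0 [simp]: "form 0 x = 0" "form x 0 = 0"
  using L.functional_0[OF functional_form, of x] form_sym[of 0 x] by simp_all

lemma form_minus: "form (- x) y = - form x y"
  using form_scale(1)[of "- 1" x y] by simp

lemma form_sum: "form x (sum g A) = (\<Sum>a\<in>A. form x (g a))"
  by (rule L.functional_sum[OF functional_form])

lemma form_invariant: "form (br x y) z = form x (br y z)"
proof -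
  have f: "V.finrank (\<lambda>v. \<psi> x (\<psi> y (\<psi> z v)))" for x y z
    by (rule V.finrank_comp[OF lin_psi finrank_psi2])
  have "form (br x y) z = V.trace (\<lambda>v. \<psi> x (\<psi> y (\<psi> z v))) - V.trace (\<lambda>v. \<psi> y (\<psi> x (\<psi> z v)))"
    unfolding form_def rep_bracket by (rule V.trace_diff[OF f f])
  also have "V.trace (\<lambda>v. \<psi> y (\<psi> x (\<psi> z v))) = V.trace (\<lambda>v. \<psi> x (\<psi> z (\<psi> y v)))"
    by (rule V.trace_commute[OF lin_psi finrank_psi2])
  also have "V.trace (\<lambda>v. \<psi> x (\<psi> y (\<psi> z v))) - V.trace (\<lambda>v. \<psi> x (\<psi> z (\<psi> y v))) = form x (br y z)"
    unfolding form_def rep_bracket V.lin_diff[OF lin_psi] by (rule V.trace_diff[OF f f, symmetric])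
  finally show ?thesis .
qed

end

locale semisimple_lie_algebra = fd_lie_algebra sL br
  for sL :: "'f::field_char_0 \<Rightarrow> 'l::ab_group_add \<Rightarrow> 'l" and br :: "'l \<Rightarrow> 'l \<Rightarrow> 'l" +
  assumes semisimple: "lie_semisimple sL br"
begin

abbreviation ideal :: "'l set \<Rightarrow> bool"
  where "ideal \<equiv> lie_ideal sL br"

lemma ideal_subspace: "ideal I \<Longrightarrow> subspace I"
  by (simp add: lie_ideal_def)

lemma ideal_br: "ideal I \<Longrightarrow> y \<in> I \<Longrightarrow> br x y \<in> I"
  by (simp add: lie_ideal_def)

lemma solvable_ideal_zero:
  assumes "ideal I" "derived I n \<subseteq> {0}"
  shows "I = {0}"
proof -
  have "subspace (derived I n)"
    using derived_subalgebra[OF ideal_subspace[OF assms(1)] ideal_br[OF assms(1)]] by blast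
  then have "derived I n = {0}" using assms(2) subspace_0 by blast
  then show ?thesis
    using semisimple assms(1) unfolding lie_semisimple_def lie_solvable_def by blast
qed

lemma center_zero:
  assumes "\<And>y. br x y = 0"
  shows "x = 0"
proof -
  let ?Z = "{x. \<forall>y. br x y = 0}"
  have "br x y = 0" if "y \<in> ?Z" for x y
    using that br_skew[of x y] by simp
  then have Z: "ideal ?Z"
    by (auto simp: lie_ideal_def subspace_def br_add br_scale)
  have "{br x y | x y. x \<in> ?Z \<and> y \<in> ?Z} \<subseteq> {0}" by auto
  then have "derived ?Z (Suc 0) \<subseteq> {0}" using span_minimal[OF _ subspace_single_0] by simp
  with solvable_ideal_zero[OF Z] assms show ?thesis by blast
qed

lemma adjoint_rep: "finrank_rep sL br sL br"
proof (unfold_locales)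
  show "\<exists>U. fin_dim U \<and> (\<forall>x v. br x v \<in> U)" using fin_dim_UNIV by blast
qed (use bracket_bilinear br_br in auto)

end

locale semisimple_rep = finrank_rep sL br sV \<psi> + L: semisimple_lie_algebra sL br
  for sL :: "'f::field_char_0 \<Rightarrow> 'l::ab_group_add \<Rightarrow> 'l" and br :: "'l \<Rightarrow> 'l \<Rightarrow> 'l"
    and sV :: "'f \<Rightarrow> 'v::ab_group_add \<Rightarrow> 'v" and \<psi> :: "'l \<Rightarrow> 'v \<Rightarrow> 'v"
begin

text \<open>By invariance the radical of the form on \<open>J\<close> is an ideal; by Cartan's
  criterion and faithfulness it is solvable, hence zero.\<close>

lemma form_nondegenerate:
  assumes J: "L.ideal J" and faithful: "\<And>x. x \<in> J \<Longrightarrow> \<forall>v. \<psi> x v = 0 \<Longrightarrow> x = 0"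
    and x: "x \<in> J" "\<And>y. y \<in> J \<Longrightarrow> form x y = 0"
  shows "x = 0"
proof -
  let ?R = "{x \<in> J. \<forall>y\<in>J. form x y = 0}"
  have R: "L.ideal ?R"
    unfolding lie_ideal_def
  proof (intro conjI allI ballI)
    show "L.subspace ?R"
      using L.ideal_subspace[OF J] by (auto simp: L.subspace_def form_add form_scale)
    fix z x assume x: "x \<in> ?R"
    have "form (br z x) y = 0" if "y \<in> J" for y
    proof -
      have "form (br z x) y = - form x (br z y)"
        unfolding form_invariant[symmetric] by (subst L.br_skew) (simp add: form_minus)
      then show ?thesis using x L.ideal_br[OF J that] by simp
    qed
    with x L.ideal_br[OF J] show "br z x \<in> ?R" by auto
  qed
  note R' = L.ideal_subspace[OF R] L.ideal_br[OF R]
  obtain n where n: "\<forall>x\<in>derived_series sL br ?R n. \<forall>v. \<psi> x v = 0"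
    by (rule trace_zero_derived[OF R']) (auto simp: form_def[symmetric])
  have "derived_series sL br ?R n \<subseteq> {0}"
    using n faithful L.derived_subset[OF R', of n] by blast
  with L.solvable_ideal_zero[OF R] x show ?thesis by blast
qed

text \<open>The ideal is the complement of the kernel of \<open>\<psi>\<close> orthogonal for the
  Killing form. That form is nondegenerate on the kernel because the centre is zero, so the two meet
  in zero.\<close>

lemma faithful_ideal:
  assumes "\<psi> z w \<noteq> 0"
  obtains J where "L.ideal J" "\<forall>x\<in>J. (\<forall>v. \<psi> x v = 0) \<longrightarrow> x = 0" "J \<noteq> {0}"
proof -
  interpret ad: semisimple_rep sL br sL br
    by (intro semisimple_rep.intro L.adjoint_rep L.semisimple_lie_algebra_axioms)
  let ?K = "{x. \<forall>v. \<psi> x v = 0}"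
  define J where "J = {x. \<forall>y\<in>?K. ad.form x y = 0}"
  have K: "L.ideal ?K"
    by (auto simp: lie_ideal_def L.subspace_def psi_add psi_scale rep_bracket)
  have J: "L.ideal J"
    unfolding lie_ideal_def
  proof (intro conjI allI ballI)
    show "L.subspace J" by (auto simp: J_def L.subspace_def ad.form_add ad.form_scale)
    fix z x assume x: "x \<in> J"
    have "ad.form (br z x) y = 0" if "y \<in> ?K" for y
    proof -
      have "ad.form (br z x) y = - ad.form x (br z y)"
        unfolding ad.form_invariant[symmetric] by (subst L.br_skew) (simp add: ad.form_minus)
      then show ?thesis using x L.ideal_br[OF K that, of z] by (auto simp: J_def)
    qed
    then show "br z x \<in> J" by (simp add: J_def)
  qed
  have "x = 0" if x: "x \<in> J" "\<forall>v. \<psi> x v = 0" for x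
    by (rule ad.form_nondegenerate[OF K]) (use x L.center_zero in \<open>auto simp: J_def\<close>)
  then have "\<forall>x\<in>J. (\<forall>v. \<psi> x v = 0) \<longrightarrow> x = 0" by blast
  moreover have "J \<noteq> {0}"
  proof -
    have sK: "L.subspace ?K" using L.ideal_subspace[OF K] .
    obtain B where B: "finite B" "L.independent B" "L.span B = ?K" "B \<subseteq> ?K" "card B = L.dim ?K"
      by (rule L.fin_dim_basis[OF L.fin_dim_any sK])
    \<comment> \<open>A map into the smaller space \<open>?K\<close> has a nonzero vector in its
      kernel, and this vector is orthogonal to all of \<open>?K\<close>.\<close>
    let ?T = "\<lambda>x. \<Sum>k\<in>B. sL (ad.form x k) k"
    have lT: "L.lin ?T"
      by (auto simp: L.lin_iff ad.form_add ad.form_scale L.scale_left_distrib sum.distrib L.scale_sum_right)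
    have rT: "?T x \<in> ?K" for x
      by (intro L.subspace_sum[OF sK] L.subspace_scale[OF sK] subsetD[OF B(4)])
    have "?K \<subset> UNIV" using assms by blast
    then have "L.dim ?K < L.dim UNIV"
      by (intro L.subspace_dim_less L.fin_dim_any sK L.subspace_UNIV)
    then obtain x where x: "x \<noteq> 0" "?T x = 0"
      by (rule L.kernel_nontrivial[OF lT L.fin_dim_any L.subspace_UNIV sK rT L.fin_dim_any])
    have xB: "ad.form x k = 0" if "k \<in> B" for k
      using L.independentD[OF B(2,1) order_refl x(2) that] .
    have "ad.form x y = 0" if "y \<in> L.span B" for y
      using that by (induction rule: L.span_induct_alt) (auto simp: xB ad.form_add ad.form_scale)
    then have "x \<in> J" using B(3) by (simp add: J_def)
    with x(1) show ?thesis by blast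
  qed
  ultimately show ?thesis by (rule that[OF J])
qed

text \<open>For dual bases of a faithful ideal \<open>J\<close> the trace of the sum of products is
  dim J, nonzero in characteristic 0. The last clause records that all values lie in any subspace
  containing the values of the action.\<close>

theorem casimir:
  assumes "\<psi> z w \<noteq> 0"
  obtains C where "V.finrank C" "V.trace C \<noteq> 0" "\<forall>x v. \<psi> x (C v) = C (\<psi> x v)"
    "\<forall>U. V.subspace U \<and> (\<forall>x v. \<psi> x v \<in> U) \<longrightarrow> (\<forall>v. C v \<in> U)"
proof -
  obtain J where J: "L.ideal J" "\<forall>x\<in>J. (\<forall>v. \<psi> x v = 0) \<longrightarrow> x = 0" "J \<noteq> {0}"
    by (rule faithful_ideal[OF assms])
  note sJ = L.ideal_subspace[OF J(1)]
  obtain Q where Q: "finite Q" "L.independent Q" "L.span Q = J" "Q \<subseteq> J" "card Q = L.dim J"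
    by (rule L.fin_dim_basis[OF L.fin_dim_any sJ])
  \<comment> \<open>Nondegeneracy makes this map injective on \<open>J\<close>, hence onto; the
    preimages of the basis vectors form the dual basis.\<close>
  define \<theta> where "\<theta> y = (\<Sum>x\<in>Q. sL (form x y) x)" for y
  have l\<theta>: "L.lin \<theta>"
    by (auto simp: \<theta>_def L.lin_iff form_add form_scale L.scale_left_distrib sum.distrib L.scale_sum_right)
  have \<theta>J: "\<theta> y \<in> J" for y
    unfolding \<theta>_def by (intro L.subspace_sum[OF sJ] L.subspace_scale[OF sJ] subsetD[OF Q(4)])
  have \<theta>0: "y = 0" if y: "y \<in> J" "\<theta> y = 0" for y
  proof (rule form_nondegenerate[OF J(1)])
    have Xy: "form x y = 0" if "x \<in> Q" for x
      using L.independentD[OF Q(2,1) order_refl y(2)[unfolded \<theta>_def] that] .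
    have "form x y = 0" if "x \<in> L.span Q" for x
      using that by (induction rule: L.span_induct_alt) (auto simp: Xy form_add form_scale)
    then show "\<And>x. x \<in> J \<Longrightarrow> form y x = 0" using Q(3) form_sym by simp
  qed (use J(2) y(1) in auto)
  have "\<theta> ` J = J"
    by (rule L.inj_subspace_surj[OF l\<theta> L.fin_dim_any sJ]) (use \<theta>J \<theta>0 in auto)
  then have "\<forall>x\<in>Q. \<exists>y\<in>J. \<theta> y = x" using Q(4) by (metis imageE subsetD)
  then obtain d where d: "\<forall>x\<in>Q. d x \<in> J \<and> \<theta> (d x) = x" by metis
  then have dJ: "d x \<in> J" if "x \<in> Q" for x using that by blast
  have dual: "form y (d x) = (if y = x then 1 else 0)" if "x \<in> Q" "y \<in> Q" for x y
  proof -
    have "(\<Sum>y\<in>Q. sL (form y (d x) - (if y = x then 1 else 0)) y) = \<theta> (d x) - (\<Sum>y\<in>Q. if y = x then x else 0)"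
      unfolding \<theta>_def L.scale_left_diff_distrib sum_subtractf
      by (intro arg_cong2[of _ _ _ _ "(-)"] refl sum.cong) auto
    also have "\<dots> = 0" using d Q(1) that(1) by simp
    finally show ?thesis using L.independentD[OF Q(2,1) order_refl _ that(2)] by fastforce
  qed
  have exp1: "y = (\<Sum>x\<in>Q. sL (form y (d x)) x)" if "y \<in> J" for y
  proof -
    have y: "y \<in> L.span Q" using that Q(3) by simp
    have eq: "y = (\<Sum>x\<in>Q. sL (L.representation Q y x) x)"
      using L.sum_representation_eq[OF Q(2) y Q(1) order_refl] by simp
    have "form y (d x) = L.representation Q y x" if "x \<in> Q" for x
    proof -
      have "form y (d x) = (\<Sum>x'\<in>Q. L.representation Q y x' * form x' (d x))"
        by (subst eq) (simp add: form_sym[of _ "d x"] form_sum form_scale)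
      also have "\<dots> = (\<Sum>x'\<in>Q. if x' = x then L.representation Q y x' else 0)"
        by (rule sum.cong) (use dual that in auto)
      finally show ?thesis using Q(1) that by simp
    qed
    with eq show ?thesis by simp
  qed
  have exp2: "y = (\<Sum>x\<in>Q. sL (form x y) (d x))" if y: "y \<in> J" for y
  proof -
    let ?s = "\<Sum>x\<in>Q. sL (form x y) (d x)"
    have s: "?s \<in> J" by (intro L.subspace_sum[OF sJ] L.subspace_scale[OF sJ] dJ)
    have "\<theta> ?s = \<theta> y"
      using l\<theta> d by (simp add: L.lin_sum L.lin_iff \<theta>_def[of y])
    then have "\<theta> (y - ?s) = 0" unfolding L.lin_diff[OF l\<theta>] by simp
    then have "y - ?s = 0" by (rule \<theta>0[OF L.subspace_diff[OF sJ y s]])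
    then show ?thesis by simp
  qed
  define C where "C v = (\<Sum>x\<in>Q. \<psi> x (\<psi> (d x) v))" for v
  have C': "C = (\<lambda>v. \<Sum>x\<in>Q. \<psi> x (\<psi> (d x) v))" using C_def by blast
  have fC: "V.finrank C" unfolding C' by (intro V.finrank_sum finrank_psi2)
  have "V.trace C = (\<Sum>x\<in>Q. form x (d x))"
    unfolding C' form_def by (rule V.trace_sum[OF finrank_psi2])
  also have "\<dots> = of_nat (card Q)" using dual by simp
  finally have tr: "V.trace C \<noteq> 0"
    using Q(1,3) J(3) by auto
  have comm: "\<psi> z (C v) = C (\<psi> z v)" for z v
  proof -
    have ps: "\<psi> (sum g A) u = (\<Sum>a\<in>A. \<psi> (g a) u)" for g u and A :: "'l set"
      by (induction A rule: infinite_finite_induct) (auto simp: psi_add)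
    \<comment> \<open>Expanding [z, x] in the basis and [z, d x] in the dual basis gives
      coefficients that cancel by invariance of the form.\<close>
    have "\<psi> z (C v) - C (\<psi> z v) =
      (\<Sum>x\<in>Q. \<psi> (br z x) (\<psi> (d x) v)) + (\<Sum>x\<in>Q. \<psi> x (\<psi> (br z (d x)) v))"
      unfolding C_def V.lin_sum[OF lin_psi] sum.distrib[symmetric] sum_subtractf[symmetric]
      by (rule sum.cong) (auto simp: rep_bracket V.lin_diff[OF lin_psi])
    also have "(\<Sum>x\<in>Q. \<psi> (br z x) (\<psi> (d x) v)) =
      (\<Sum>x\<in>Q. \<Sum>x'\<in>Q. sV (form (br z x) (d x')) (\<psi> x' (\<psi> (d x) v)))"
    proof (rule sum.cong[OF refl])
      fix x assume "x \<in> Q"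
      then have "br z x \<in> J" using L.ideal_br[OF J(1)] Q(4) by blast
      then have "\<psi> (br z x) (\<psi> (d x) v) = \<psi> (\<Sum>x'\<in>Q. sL (form (br z x) (d x')) x') (\<psi> (d x) v)"
        using exp1 by simp
      then show "\<psi> (br z x) (\<psi> (d x) v) = (\<Sum>x'\<in>Q. sV (form (br z x) (d x')) (\<psi> x' (\<psi> (d x) v)))"
        by (simp add: ps psi_scale)
    qed
    also have "(\<Sum>x\<in>Q. \<psi> x (\<psi> (br z (d x)) v)) =
      (\<Sum>x\<in>Q. \<Sum>x'\<in>Q. sV (form x' (br z (d x))) (\<psi> x (\<psi> (d x') v)))"
    proof (rule sum.cong[OF refl])
      fix x assume "x \<in> Q"
      then have "br z (d x) \<in> J" using L.ideal_br[OF J(1)] d by blast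
      then have "\<psi> x (\<psi> (br z (d x)) v) = \<psi> x (\<psi> (\<Sum>x'\<in>Q. sL (form x' (br z (d x))) (d x')) v)"
        using exp2 by simp
      then show "\<psi> x (\<psi> (br z (d x)) v) = (\<Sum>x'\<in>Q. sV (form x' (br z (d x))) (\<psi> x (\<psi> (d x') v)))"
        by (simp add: ps psi_scale V.lin_sum[OF lin_psi])
    qed
    also have "\<dots> = (\<Sum>x\<in>Q. \<Sum>x'\<in>Q. sV (form x (br z (d x'))) (\<psi> x' (\<psi> (d x) v)))"
      by (rule sum.swap)
    also have "(\<Sum>x\<in>Q. \<Sum>x'\<in>Q. sV (form (br z x) (d x')) (\<psi> x' (\<psi> (d x) v))) + \<dots> = 0"
    proof -
      have "form (br z x) y = - form x (br z y)" for x y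
        unfolding form_invariant[symmetric] by (subst L.br_skew) (simp add: form_minus)
      then show ?thesis by (simp add: sum_negf)
    qed
    finally show ?thesis by simp
  qed
  show ?thesis
  proof (rule that[OF fC tr])
    show "\<forall>x v. \<psi> x (C v) = C (\<psi> x v)" using comm by blast
    show "\<forall>U. V.subspace U \<and> (\<forall>x v. \<psi> x v \<in> U) \<longrightarrow> (\<forall>v. C v \<in> U)"
      unfolding C_def by (simp add: V.subspace_sum)
  qed
qed

end

text \<open>Nothing is assumed about \<open>\<psi>\<close> outside \<open>E\<close>: operators \<open>V \<rightarrow> V\<close> are an example where only the linear
  ones carry an action.\<close>
definition acts_on ::
  "('f::field \<Rightarrow> 'l::ab_group_add \<Rightarrow> 'l) \<Rightarrow> ('l \<Rightarrow> 'l \<Rightarrow> 'l) \<Rightarrow> ('f \<Rightarrow> 'v::ab_group_add \<Rightarrow> 'v) \<Rightarrow>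
   ('l \<Rightarrow> 'v \<Rightarrow> 'v) \<Rightarrow> 'v set \<Rightarrow> bool"
  where "acts_on sL br sV \<psi> E \<longleftrightarrow>
    (\<forall>x. \<forall>v\<in>E. \<psi> x v \<in> E) \<and>
    (\<forall>x y. \<forall>v\<in>E. \<psi> (x + y) v = \<psi> x v + \<psi> y v) \<and>
    (\<forall>x. \<forall>v\<in>E. \<forall>w\<in>E. \<psi> x (v + w) = \<psi> x v + \<psi> x w) \<and>
    (\<forall>c x. \<forall>v\<in>E. \<psi> (sL c x) v = sV c (\<psi> x v) \<and> \<psi> x (sV c v) = sV c (\<psi> x v)) \<and>
    (\<forall>x y. \<forall>v\<in>E. \<psi> (br x y) v = \<psi> x (\<psi> y v) - \<psi> y (\<psi> x v))"

section \<open>Complete reducibility from invariant vectors\<close>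

locale semisimple_lie_space = semisimple_lie_algebra sL br + V: char_0_space sV
  for sL :: "'f::field_char_0 \<Rightarrow> 'l::ab_group_add \<Rightarrow> 'l" and br :: "'l \<Rightarrow> 'l \<Rightarrow> 'l"
    and sV :: "'f \<Rightarrow> 'v::ab_group_add \<Rightarrow> 'v"
begin

lemma semisimple_rep_projection:
  assumes E: "acts_on sL br sV \<psi> E" "V.subspace E" "V.fin_dim E"
    and p: "V.lin p" "\<forall>v. p v \<in> E" "\<forall>v\<in>E. p v = v"
  shows "semisimple_rep sL br sV (\<lambda>x v. \<psi> x (p v))"
proof -
  have p': "p (v + w) = p v + p w" "p (sV c v) = sV c (p v)" for v w c
    using p(1) V.lin_iff by blast+
  have "bilinear_map sL sV sV (\<lambda>x v. \<psi> x (p v))"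
    using E(1) p(2) unfolding bilinear_map_def linear_iff_add_scale
    by (auto simp: p' acts_on_def V.vector_space_axioms vector_space_axioms)
  moreover have "\<psi> (br x y) (p v) = \<psi> x (p (\<psi> y (p v))) - \<psi> y (p (\<psi> x (p v)))" for x y v
    using E(1) p(2,3) by (simp add: acts_on_def)
  moreover have "\<exists>U. V.fin_dim U \<and> (\<forall>x v. \<psi> x (p v) \<in> U)"
    using E(1,3) p(2) by (auto simp: acts_on_def)
  ultimately show ?thesis by unfold_locales
qed

text \<open>Fitting decomposition of \<open>E\<close> for a Casimir element \<open>C\<close>: since \<open>C\<close> maps \<open>E\<close> into \<open>E\<^sub>0\<close> and is not
  nilpotent, its generalised kernel is a proper submodule that is not contained in \<open>E\<^sub>0\<close>.\<close>
lemma invariant_outside: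
  assumes "acts_on sL br sV \<psi> E" "V.subspace E" "V.fin_dim E"
    and "V.subspace E0" "E0 \<subset> E" "\<forall>x. \<forall>v\<in>E. \<psi> x v \<in> E0"
  shows "\<exists>e\<in>E - E0. \<forall>x. \<psi> x e = 0"
  using assms
proof (induction "V.dim E" arbitrary: E E0 rule: less_induct)
  case less
  note E = less.prems(1-3) and E0 = less.prems(4-6)
  obtain p where p: "V.lin p" "\<forall>v. p v \<in> E" "\<forall>v\<in>E. p v = v"
    by (rule V.exists_projection[OF E(2)])
  define \<phi> where "\<phi> x v = \<psi> x (p v)" for x v
  have \<phi>: "\<phi> x v = \<psi> x v" if "v \<in> E" for x v using p(3) that by (simp add: \<phi>_def)
  have \<phi>E0: "\<phi> x v \<in> E0" for x v using E0(3) p(2) by (simp add: \<phi>_def)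
  interpret r: semisimple_rep sL br sV \<phi>
    using semisimple_rep_projection[OF E p] by (simp add: \<phi>_def[abs_def])
  show ?case
  proof (cases "\<forall>x v. \<phi> x v = 0")
    case True
    then show ?thesis using E0(2) \<phi> by (metis DiffI psubset_imp_ex_mem DiffD1)
  next
    case False
    then obtain z w where zw: "\<phi> z w \<noteq> 0" by blast
    obtain C where C: "V.finrank C" "V.trace C \<noteq> 0" "\<forall>x v. \<phi> x (C v) = C (\<phi> x v)"
      "\<forall>U. V.subspace U \<and> (\<forall>x v. \<phi> x v \<in> U) \<longrightarrow> (\<forall>v. C v \<in> U)"
      by (rule r.casimir[OF zw])
    have lC: "V.lin C" by (rule V.finrank_lin[OF C(1)])
    have CE0: "C v \<in> E0" for v using C(4) E0(1) \<phi>E0 by blast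
    \<comment> \<open>The image of \<open>E\<close> has minimal dimension among positive powers of
      \<open>C\<close>. A positive exponent is required so that the power maps into
      \<open>E0\<close>.\<close>
    define j where "j = (ARG_MIN (\<lambda>j. V.dim ((C ^^ Suc j) ` E)) j. True)"
    define m where "m = Suc j"
    have lCm: "V.lin (C ^^ m)" by (rule V.lin_funpow[OF lC])
    have CmE0: "(C ^^ m) v \<in> E0" for v using CE0 by (simp add: m_def)
    have comm: "(C ^^ k) (\<phi> x v) = \<phi> x ((C ^^ k) v)" for k x v
      by (induction k) (use C(3) in auto)
    have sub: "V.subspace ((C ^^ k) ` E)" for k
      by (rule V.lin_image_subspace[OF V.lin_funpow[OF lC] E(2)])
    have "(C ^^ (m + m)) ` E = (C ^^ m) ` E"
    proof -
      have "(C ^^ (m + m)) ` E \<subseteq> (C ^^ m) ` E"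
        using CmE0 E0(2) by (auto simp: funpow_add)
      moreover have "\<not> (C ^^ (m + m)) ` E \<subset> (C ^^ m) ` E"
      proof
        assume "(C ^^ (m + m)) ` E \<subset> (C ^^ m) ` E"
        moreover have "V.fin_dim ((C ^^ m) ` E)"
          by (rule V.fin_dim_subset[OF E(3)]) (use CmE0 E0(2) in auto)
        ultimately have "V.dim ((C ^^ (m + m)) ` E) < V.dim ((C ^^ m) ` E)"
          by (intro V.subspace_dim_less sub)
        moreover have "V.dim ((C ^^ m) ` E) \<le> V.dim ((C ^^ Suc (j + m)) ` E)"
          unfolding j_def m_def by (rule arg_min_nat_le) simp
        ultimately show False by (simp add: m_def)
      qed
      ultimately show ?thesis by blast
    qed
    note fitting = this
    define E1 where "E1 = {v \<in> E. (C ^^ m) v = 0}"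
    have sE1: "V.subspace E1"
      using E(2) lCm V.lin_0[OF lCm] by (auto simp: E1_def V.subspace_def V.lin_iff)
    have actE1: "acts_on sL br sV \<psi> E1"
    proof -
      have "(C ^^ m) (\<psi> x v) = 0" if "v \<in> E1" for x v
        using comm[of m x v] that \<phi>[of v x] by (simp add: E1_def)
      then show ?thesis using E(1) unfolding acts_on_def E1_def by simp
    qed
    \<comment> \<open>Otherwise \<open>C\<close>, which maps everything into \<open>E0\<close> and
      so into \<open>E\<close>, would be nilpotent and have trace zero.\<close>
    have "E1 \<noteq> E"
    proof
      assume "E1 = E"
      then have "(C ^^ Suc m) v = 0" for v
        using CE0[of v] E0(2) by (auto simp: E1_def funpow_swap1)
      then have "V.trace C = 0" by (rule V.trace_nilpotent[OF C(1)])
      with C(2) show False by simp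
    qed
    then have "E1 \<subset> E" by (auto simp: E1_def)
    then have "V.dim E1 < V.dim E" by (intro V.subspace_dim_less E sE1)
    moreover have "E1 \<inter> E0 \<subset> E1"
    proof -
      have "\<not> E1 \<subseteq> E0"
      proof
        assume "E1 \<subseteq> E0"
        have "v \<in> E0" if v: "v \<in> E" for v
        proof -
          \<comment> \<open>Fitting: \<open>v\<close> splits into a vector killed by the m-th power
            of \<open>C\<close> and one in the image of this power, which lies in
            \<open>E0\<close>.\<close>
          have "(C ^^ m) v \<in> (C ^^ (m + m)) ` E" using fitting v by blast
          then obtain u where u: "u \<in> E" "(C ^^ m) v = (C ^^ m) ((C ^^ m) u)" by (auto simp: funpow_add)
          have "v - (C ^^ m) u \<in> E1"
            using u v CmE0[of u] E0(2) V.subspace_diff[OF E(2)] by (auto simp: E1_def V.lin_diff[OF lCm])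
          then have "(v - (C ^^ m) u) + (C ^^ m) u \<in> E0"
            using \<open>E1 \<subseteq> E0\<close> CmE0 by (intro V.subspace_add[OF E0(1)]) auto
          then show ?thesis by simp
        qed
        with E0(2) show False by blast
      qed
      then show ?thesis by blast
    qed
    moreover have "\<forall>x. \<forall>v\<in>E1. \<psi> x v \<in> E1 \<inter> E0"
      using actE1 E0(3) by (auto simp: acts_on_def E1_def)
    ultimately have "\<exists>e\<in>E1 - (E1 \<inter> E0). \<forall>x. \<psi> x e = 0"
      by (intro less.hyps actE1 sE1 V.fin_dim_subset[OF E(3)] V.subspace_inter E0(1)) (auto simp: E1_def)
    then show ?thesis by (auto simp: E1_def)
  qed
qed

end

text \<open>On the operators with range in \<open>W\<close> that are scalar on \<open>W\<close>, every commutator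
  with \<open>\<psi> x\<close> vanishes on \<open>W\<close>; an invariant operator which is nonzero on \<open>W\<close> is, up to a
  factor, a projection.\<close>
theorem weyl_projection:
  assumes "semisimple_lie_algebra sL br" "lie_representation sL br sV \<psi>"
    and "char_0_space sV" "vec_space.fin_dim sV UNIV"
    and W: "module.subspace sV W" "\<And>x w. w \<in> W \<Longrightarrow> \<psi> x w \<in> W"
  obtains P where "Vector_Spaces.linear sV sV P" "\<forall>v. P v \<in> W" "\<forall>w\<in>W. P w = w"
    "\<forall>x v. P (\<psi> x v) = \<psi> x (P v)"
proof -
  interpret semisimple_lie_algebra sL br by fact
  interpret V: char_0_space sV by fact
  interpret rep: lie_representation sL br sV \<psi> by fact
  interpret op: char_0_space V.opscale unfolding char_0_space_def by (rule V.vec_space_opscale)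
  interpret O: semisimple_lie_space sL br V.opscale by unfold_locales
  have psi: "\<psi> (x + y) v = \<psi> x v + \<psi> y v" "\<psi> x (v + w) = \<psi> x v + \<psi> x w"
    "\<psi> (sL c x) v = sV c (\<psi> x v)" "\<psi> x (sV c v) = sV c (\<psi> x v)" for x y v w c
    using rep.rep_bilinear unfolding bilinear_map_def linear_iff_add_scale by blast+
  have lpsi: "V.lin (\<psi> x)" for x by (simp add: V.lin_iff psi)
  define E where "E = {T. V.lin T \<and> (\<forall>v. T v \<in> W) \<and> (\<exists>c. \<forall>w\<in>W. T w = sV c w)}"
  define E0 where "E0 = {T. V.lin T \<and> (\<forall>v. T v \<in> W) \<and> (\<forall>w\<in>W. T w = 0)}"
  define act where "act x T = (\<lambda>v. \<psi> x (T v) - T (\<psi> x v))" for x and T :: "'c \<Rightarrow> 'c"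
  note subW = V.subspace_0[OF W(1)] V.subspace_add[OF W(1)] V.subspace_scale[OF W(1)] V.subspace_diff[OF W(1)]
  have linE: "V.lin T" if "T \<in> E" for T using that E_def by blast
  have "E0 \<subseteq> E" unfolding E_def E0_def by (auto intro: exI[of _ 0])
  have actE0: "act x T \<in> E0" if "T \<in> E" for x T
  proof -
    obtain c where c: "\<forall>w\<in>W. T w = sV c w" using \<open>T \<in> E\<close> E_def by blast
    have T: "V.lin T" "\<forall>v. T v \<in> W" using that E_def by blast+
    have "V.lin (act x T)"
      using T(1) by (simp add: act_def V.lin_iff psi V.scale_right_diff_distrib)
    moreover have "act x T w = 0" if "w \<in> W" for w
      using c W(2) that by (simp add: act_def psi)
    ultimately show ?thesis
      using T(2) W(2) subW(4) by (simp add: E0_def act_def)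
  qed
  have act: "acts_on sL br V.opscale act E"
    unfolding acts_on_def
  proof (intro conjI allI ballI)
    show "act x T \<in> E" if "T \<in> E" for x T using actE0[OF that] \<open>E0 \<subseteq> E\<close> by blast
    fix x y c and T assume "T \<in> E"
    note T = linE[OF this, unfolded V.lin_iff]
    show "act (x + y) T = act x T + act y T"
      using T by (simp add: act_def psi fun_eq_iff)
    show "act x (T + T') = act x T + act x T'" for T'
      by (simp add: act_def psi fun_eq_iff)
    show "act (sL c x) T = V.opscale c (act x T)"
      using T by (simp add: act_def psi V.opscale_def V.scale_right_diff_distrib)
    show "act x (V.opscale c T) = V.opscale c (act x T)"
      by (simp add: act_def psi V.opscale_def V.scale_right_diff_distrib)
    show "act (br x y) T = act x (act y T) - act y (act x T)"
      using V.lin_diff[OF linE[OF \<open>T \<in> E\<close>]] V.lin_diff[OF lpsi]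
      by (simp add: act_def rep.rep_bracket fun_eq_iff)
  qed
  have subE: "op.subspace E"
    unfolding op.subspace_def
  proof (intro conjI ballI allI)
    show "0 \<in> E" using subW(1) by (auto simp: E_def V.lin_iff intro!: exI[of _ 0])
    fix S T c assume "S \<in> E" "T \<in> E"
    then obtain a b where ab: "\<forall>w\<in>W. S w = sV a w" "\<forall>w\<in>W. T w = sV b w"
      and ST: "V.lin S" "V.lin T" "\<forall>v. S v \<in> W" "\<forall>v. T v \<in> W" unfolding E_def by blast
    have "\<forall>w\<in>W. (S + T) w = sV (a + b) w" using ab by (simp add: V.scale_left_distrib)
    then show "S + T \<in> E"
      using ST subW(2) unfolding E_def by (auto simp: V.lin_iff V.scale_right_distrib)
    have "\<forall>w\<in>W. V.opscale c S w = sV (c * a) w" using ab by (simp add: V.opscale_def)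
    then show "V.opscale c S \<in> E"
      using ST subW(3) unfolding E_def by (auto simp: V.lin_iff V.opscale_def V.scale_right_distrib mult.commute)
  qed
  have subE0: "op.subspace E0"
    using subW by (auto simp: op.subspace_def E0_def V.lin_iff V.opscale_def V.scale_right_distrib mult.commute)
  have fdE: "op.fin_dim E"
  proof -
    obtain B where B: "finite B" "V.independent B" "V.span B = UNIV" "B \<subseteq> UNIV" "card B = V.dim UNIV"
      by (rule V.fin_dim_basis[OF assms(4) V.subspace_UNIV])
    \<comment> \<open>The matrix units of the basis.\<close>
    let ?e = "\<lambda>(a, b) v. sV (V.representation B v a) b"
    have "T \<in> op.span (?e ` (B \<times> B))" if "T \<in> E" for T
    proof -
      have l: "V.lin T" using linE[OF that] .
      have "T = (\<Sum>a\<in>B. \<Sum>b\<in>B. V.opscale (V.representation B (T a) b) (?e (a, b)))"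
      proof
        fix v
        have rep: "(\<Sum>b\<in>B. sV (V.representation B v b) b) = v" for v
          using V.sum_representation_eq[OF B(2), of v B] B by simp
        have "T v = T (\<Sum>a\<in>B. sV (V.representation B v a) a)" by (simp only: rep)
        also have "\<dots> = (\<Sum>a\<in>B. sV (V.representation B v a) (T a))"
          using l by (simp add: V.lin_sum V.lin_iff)
        also have "\<dots> = (\<Sum>a\<in>B. sV (V.representation B v a) (\<Sum>b\<in>B. sV (V.representation B (T a) b) b))"
          by (simp only: rep)
        finally show "T v = (\<Sum>a\<in>B. \<Sum>b\<in>B. V.opscale (V.representation B (T a) b) (?e (a, b))) v"
          by (simp add: sum_fun_apply V.opscale_def V.scale_sum_right mult.commute)
      qed
      moreover have "\<dots> \<in> op.span (?e ` (B \<times> B))"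
        by (intro op.span_sum op.span_scale op.span_base) auto
      ultimately show ?thesis by simp
    qed
    then have "E \<subseteq> op.span (?e ` (B \<times> B))" by (rule subsetI)
    moreover have "finite (?e ` (B \<times> B))" using B(1) by simp
    ultimately show ?thesis unfolding op.fin_dim_def by (intro exI conjI)
  qed
  have ex: "\<exists>e\<in>E - E0. \<forall>x. act x e = 0" if "E0 \<subset> E"
    by (rule O.invariant_outside[OF act subE fdE subE0 that]) (simp add: actE0)
  obtain p where p: "V.lin p" "\<forall>v. p v \<in> W" "\<forall>w\<in>W. p w = w"
    by (rule V.exists_projection[OF W(1)])
  show ?thesis
  proof (cases "W = {0}")
    \<comment> \<open>Here \<open>E\<close> equals \<open>E0\<close>, so no invariant outside
      \<open>E0\<close> is available, but the zero map already is the projection.\<close>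
    case True
    show ?thesis
      by (rule that[of "\<lambda>v. 0"]) (use True psi(4)[of _ 0] in \<open>auto simp: V.lin_iff\<close>)
  next
    case False
    have "p \<in> E" using p by (auto simp: E_def intro!: exI[of _ 1])
    moreover have "p \<notin> E0" using p(3) False subW(1) by (auto simp: E0_def)
    ultimately obtain e where e: "e \<in> E" "e \<notin> E0" "\<forall>x. act x e = 0"
      using ex \<open>E0 \<subseteq> E\<close> by blast
    then obtain c where c: "\<forall>w\<in>W. e w = sV c w" unfolding E_def by blast
    have e': "V.lin e" "\<forall>v. e v \<in> W" using e(1) E_def by auto
    have "c \<noteq> 0" using e(2) e' c by (auto simp: E0_def)
    show ?thesis
    proof (rule that[of "\<lambda>v. sV (1 / c) (e v)"])
      show "V.lin (\<lambda>v. sV (1 / c) (e v))" using e' by (simp add: V.lin_iff V.scale_right_distrib mult.commute)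
      show "\<forall>v. sV (1 / c) (e v) \<in> W" using e' subW(3) by blast
      show "\<forall>w\<in>W. sV (1 / c) (e w) = w" using c \<open>c \<noteq> 0\<close> by simp
      have "\<psi> x (e v) = e (\<psi> x v)" for x v
        using fun_cong[OF e(3)[rule_format, of x], of v] by (simp add: act_def)
      then show "\<forall>x v. sV (1 / c) (e (\<psi> x v)) = \<psi> x (sV (1 / c) (e v))" by (simp add: psi)
    qed
  qed
qed

section \<open>Matrix coefficients in a Hopf algebra\<close>

lemma bilinear_map_iff:
  assumes "vector_space sA" "vector_space sB" "vector_space sC"
  shows "bilinear_map sA sB sC f \<longleftrightarrow>
    (\<forall>x y z. f x (y + z) = f x y + f x z) \<and> (\<forall>x c y. f x (sB c y) = sC c (f x y)) \<and>
    (\<forall>x y z. f (x + y) z = f x z + f y z) \<and> (\<forall>x c y. f (sA c x) y = sC c (f x y))"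
  using assms unfolding bilinear_map_def linear_iff_add_scale by blast

lemma linear_sum_image:
  assumes "Vector_Spaces.linear s1 s2 g"
  shows "g (\<Sum>i\<in>I. x i) = (\<Sum>i\<in>I. g (x i))"
proof -
  interpret Vector_Spaces.linear s1 s2 g by fact
  show ?thesis by (rule sum)
qed

lemma sweedler_sum_set:
  assumes "bilinear_map sA sB sC f" "finite I"
  shows "sweedler sA sB f (\<Sum>i\<in>I. tensor sA sB (x i) (y i)) = (\<Sum>i\<in>I. f (x i) (y i))"
proof -
  obtain h where h: "bij_betw h {0..<card I} I" using ex_bij_betw_nat_finite[OF assms(2)] by blast
  show ?thesis
    unfolding sum.reindex_bij_betw[OF h, symmetric] atLeast0LessThan
    by (rule sweedler_sum[OF assms(1)])
qed

lemma sum_in_tensor_product: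
  assumes "finite I" "\<And>i. i \<in> I \<Longrightarrow> x i \<in> U \<and> y i \<in> Y"
  shows "(\<Sum>i\<in>I. tensor sA sB (x i) (y i)) \<in> tensor_product sA sB U Y"
proof -
  obtain h where h: "bij_betw h {0..<card I} I" using ex_bij_betw_nat_finite[OF assms(1)] by blast
  have "(\<Sum>i\<in>I. tensor sA sB (x i) (y i)) = (\<Sum>i<card I. tensor sA sB (x (h i)) (y (h i)))"
    unfolding sum.reindex_bij_betw[OF h, symmetric] atLeast0LessThan ..
  moreover have "x (h i) \<in> U \<and> y (h i) \<in> Y" if "i < card I" for i
    using assms(2) bij_betwE[OF h] that by simp
  ultimately show ?thesis
    unfolding tensor_product_def
    by (auto intro!: exI[of _ "card I"] exI[of _ "\<lambda>i. x (h i)"] exI[of _ "\<lambda>i. y (h i)"])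
qed

lemma linear_sweedler:
  assumes f: "bilinear_map sA sB sC f"
    and D: "Vector_Spaces.linear s tensor_scale D" "\<And>a. D a \<in> tensor_product sA sB UNIV UNIV"
  shows "Vector_Spaces.linear s sC (\<lambda>a. sweedler sA sB f (D a))"
proof -
  obtain g where g: "Vector_Spaces.linear tensor_scale sC g"
    "\<forall>T\<in>tensor_product sA sB UNIV UNIV. g T = sweedler sA sB f T"
    using tensor_universal[OF f] by blast
  have "(\<lambda>a. sweedler sA sB f (D a)) = g \<circ> D" using g(2) D(2) by auto
  then show ?thesis using Vector_Spaces.linear_compose[OF D(1) g(1)] by simp
qed

context hopf_algebra
begin

lemma mult_scale: "scale c a * b = scale c (a * b)" "a * scale c b = scale c (a * b)"
  by (simp_all flip: scale_mult_left scale_mult_right)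

lemma antipode_add: "antipode (a + b) = antipode a + antipode b"
  and antipode_scale: "antipode (scale c a) = scale c (antipode a)"
  using antipode_linear unfolding linear_iff_add_scale by auto

lemma antipode_0 [simp]: "antipode 0 = 0"
  using antipode_scale[of 0 0] by simp

lemma antipode_sum: "antipode (\<Sum>i\<in>I. x i) = (\<Sum>i\<in>I. antipode (x i))"
  by (rule linear_sum_image[OF antipode_linear])

lemma bilinear_iff: "bilinear_map scale scale scale f \<longleftrightarrow>
    (\<forall>x y z. f x (y + z) = f x y + f x z) \<and> (\<forall>x c y. f x (scale c y) = scale c (f x y)) \<and>
    (\<forall>x y z. f (x + y) z = f x z + f y z) \<and> (\<forall>x c y. f (scale c x) y = scale c (f x y))"
  by (rule bilinear_map_iff) (rule vector_space_axioms)+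

lemma tensor_simps:
  "tensor scale scale x (y + z) = tensor scale scale x y + tensor scale scale x z"
  "tensor scale scale x (scale c y) = tensor_scale c (tensor scale scale x y)"
  "tensor scale scale (x + y) z = tensor scale scale x z + tensor scale scale y z"
  "tensor scale scale (scale c x) z = tensor_scale c (tensor scale scale x z)"
  using bilinear_map_tensor[OF vector_space_axioms vector_space_axioms]
  unfolding bilinear_map_iff[OF vector_space_axioms vector_space_axioms vector_space_tensor_scale]
  by auto

lemma comult_decomp:
  obtains n :: nat and u w where "comult a = (\<Sum>r<n. tensor scale scale (u r) (w r))"
  using comult_in[of a] unfolding tensor_product_def by blast

lemma linear_comult:
  assumes "bilinear_map scale scale sC f"
  shows "Vector_Spaces.linear scale sC (\<lambda>a. sweedler scale scale f (comult a))"
  by (rule linear_sweedler[OF assms comult_linear comult_in])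

lemma comult_mult_sum:
  assumes I: "finite I" "comult a = (\<Sum>i\<in>I. tensor scale scale (x i) (y i))"
    and J: "finite J" "comult b = (\<Sum>j\<in>J. tensor scale scale (u j) (w j))"
  shows "comult (a * b) = (\<Sum>p\<in>I \<times> J. tensor scale scale (x (fst p) * u (snd p)) (y (fst p) * w (snd p)))"
proof -
  have vs: "vector_space scale" by (rule vector_space_axioms)
  note bil = bilinear_map_iff[OF vs vs vector_space_tensor_scale]
  have inner: "sweedler scale scale (\<lambda>b1 b2. tensor scale scale (a1 * b1) (a2 * b2)) (comult b) =
      (\<Sum>j\<in>J. tensor scale scale (a1 * u j) (a2 * w j))" for a1 a2
    unfolding J(2)
    by (rule sweedler_sum_set[where sC = tensor_scale, OF _ J(1)]) (simp add: bil distrib_left mult_scale tensor_simps)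
  interpret t: vector_space tensor_scale by (rule vector_space_tensor_scale)
  have "comult (a * b) = (\<Sum>i\<in>I. \<Sum>j\<in>J. tensor scale scale (x i * u j) (y i * w j))"
    unfolding comult_mult inner I(2)
    by (rule sweedler_sum_set[where sC = tensor_scale, OF _ I(1)])
      (simp add: bil distrib_right mult_scale tensor_simps sum.distrib t.scale_sum_right)
  then show ?thesis by (simp add: sum.cartesian_product case_prod_beta)
qed

text \<open>A multiplicative matrix, the abstract form of the coefficient matrix of a comodule with
  respect to a basis.\<close>

definition coalg_matrix :: "'i set \<Rightarrow> ('i \<Rightarrow> 'i \<Rightarrow> 'h) \<Rightarrow> bool"
  where "coalg_matrix I c \<longleftrightarrow> finite I \<and> (\<forall>i\<in>I. \<forall>j\<in>I.
    comult (c i j) = (\<Sum>k\<in>I. tensor scale scale (c i k) (c k j)) \<and>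
    counit (c i j) = (if i = j then 1 else 0))"

text \<open>The two antipode axioms evaluated at an entry: S(c) is the two-sided inverse of
  c.\<close>

lemma antipode_matrix:
  assumes "coalg_matrix I c" "i \<in> I" "j \<in> I"
  shows "(\<Sum>k\<in>I. antipode (c i k) * c k j) = (if i = j then 1 else 0)"
    and "(\<Sum>k\<in>I. c i k * antipode (c k j)) = (if i = j then 1 else 0)"
proof -
  have c: "finite I" "comult (c i j) = (\<Sum>k\<in>I. tensor scale scale (c i k) (c k j))"
    "counit (c i j) = (if i = j then 1 else 0)" using assms unfolding coalg_matrix_def by blast+
  have "bilinear_map scale scale scale (\<lambda>x y. antipode x * y)"
    by (simp add: bilinear_iff antipode_add antipode_scale mult_scale distrib_left distrib_right)
  from sweedler_sum_set[OF this c(1), of "\<lambda>k. c i k" "\<lambda>k. c k j"] antipode_left[of "c i j"]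
  show "(\<Sum>k\<in>I. antipode (c i k) * c k j) = (if i = j then 1 else 0)"
    by (simp add: c(2,3) split: if_splits)
  have "bilinear_map scale scale scale (\<lambda>x y. x * antipode y)"
    by (simp add: bilinear_iff antipode_add antipode_scale mult_scale distrib_left distrib_right)
  from sweedler_sum_set[OF this c(1), of "\<lambda>k. c i k" "\<lambda>k. c k j"] antipode_right[of "c i j"]
  show "(\<Sum>k\<in>I. c i k * antipode (c k j)) = (if i = j then 1 else 0)"
    by (simp add: c(2,3) split: if_splits)
qed

text \<open>The Kronecker product is the coefficient matrix of a tensor product of comodules; it is
  multiplicative because \<open>comult\<close> and \<open>counit\<close> respect products.\<close>

lemma coalg_matrix_prod:
  assumes d: "coalg_matrix I d" and c: "coalg_matrix J c"
  shows "coalg_matrix (I \<times> J) (\<lambda>p q. d (fst p) (fst q) * c (snd p) (snd q))"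
  unfolding coalg_matrix_def
proof (intro conjI ballI)
  show "finite (I \<times> J)" using assms by (simp add: coalg_matrix_def)
  fix p q assume pq: "p \<in> I \<times> J" "q \<in> I \<times> J"
  show "comult (d (fst p) (fst q) * c (snd p) (snd q)) =
      (\<Sum>k\<in>I \<times> J. tensor scale scale (d (fst p) (fst k) * c (snd p) (snd k)) (d (fst k) (fst q) * c (snd k) (snd q)))"
    by (rule comult_mult_sum) (use pq d c in \<open>auto simp: coalg_matrix_def\<close>)
  show "counit (d (fst p) (fst q) * c (snd p) (snd q)) = (if p = q then 1 else 0)"
    using pq d c by (auto simp: coalg_matrix_def counit_mult prod_eq_iff)
qed

text \<open>Both sides are inverse to the matrix with entries \<open>d a b * c i j\<close>.\<close>
lemma antipode_matrix_mult:
  assumes d: "coalg_matrix I d" and c: "coalg_matrix J c"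
    and a: "a \<in> I" "b \<in> I" and i: "i \<in> J" "j \<in> J"
  shows "antipode (d a b * c i j) = antipode (c i j) * antipode (d a b)"
proof -
  let ?m = "\<lambda>p q. d (fst p) (fst q) * c (snd p) (snd q)"
  let ?n = "\<lambda>p q. antipode (c (snd p) (snd q)) * antipode (d (fst p) (fst q))"
  let ?K = "I \<times> J"
  have fin: "finite I" "finite J" using d c by (auto simp: coalg_matrix_def)
  have right: "(\<Sum>s\<in>?K. ?m r s * ?n s q) = (if r = q then 1 else 0)" if "r \<in> ?K" "q \<in> ?K" for r q
  proof -
    have "(\<Sum>s\<in>?K. ?m r s * ?n s q) =
        (\<Sum>g\<in>I. d (fst r) g * (\<Sum>k\<in>J. c (snd r) k * antipode (c k (snd q))) * antipode (d g (fst q)))"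
      by (simp add: sum.cartesian_product' sum_distrib_left sum_distrib_right mult.assoc)
    also have "\<dots> = (\<Sum>g\<in>I. d (fst r) g * (if snd r = snd q then 1 else 0) * antipode (d g (fst q)))"
      using antipode_matrix(2)[OF c] that by (intro sum.cong) auto
    also have "\<dots> = (if snd r = snd q then \<Sum>g\<in>I. d (fst r) g * antipode (d g (fst q)) else 0)" by simp
    also have "\<dots> = (if r = q then 1 else 0)"
      using antipode_matrix(2)[OF d] that by (auto simp: prod_eq_iff)
    finally show ?thesis .
  qed
  let ?p = "(a, i)" and ?q = "(b, j)"
  have pq: "?p \<in> ?K" "?q \<in> ?K" using a i by auto
  \<comment> \<open>A left inverse equals a right inverse: the unit matrix is inserted as
    \<open>?m\<close> times \<open>?n\<close>, then the product is reassociated.\<close>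
  have "antipode (?m ?p ?q) = (\<Sum>r\<in>?K. antipode (?m ?p r) * (if r = ?q then 1 else 0))"
    using pq fin by (simp add: if_distrib[of "\<lambda>x. _ * x"] cong: if_cong)
  also have "\<dots> = (\<Sum>r\<in>?K. \<Sum>s\<in>?K. antipode (?m ?p r) * (?m r s * ?n s ?q))"
    by (rule sum.cong[OF refl]) (simp only: right[OF _ pq(2), symmetric] sum_distrib_left)
  also have "\<dots> = (\<Sum>s\<in>?K. (\<Sum>r\<in>?K. antipode (?m ?p r) * ?m r s) * ?n s ?q)"
    by (subst sum.swap) (simp add: sum_distrib_right mult.assoc)
  also have "\<dots> = (\<Sum>s\<in>?K. (if ?p = s then 1 else 0) * ?n s ?q)"
    by (rule sum.cong[OF refl]) (simp only: antipode_matrix(1)[OF coalg_matrix_prod[OF d c] pq(1)])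
  also have "\<dots> = ?n ?p ?q"
    using pq fin by (simp add: if_distrib[of "\<lambda>x. x * _"] cong: if_cong)
  finally show ?thesis by simp
qed

text \<open>In Sweedler notation: \<open>\<Delta>(S(c\<^sub>(\<^sub>1\<^sub>))) (c\<^sub>(\<^sub>2\<^sub>) \<otimes> 1) = 1 \<otimes> S(c)\<close>, which follows from
  \<open>c \<otimes> 1 = \<Delta>(c\<^sub>(\<^sub>1\<^sub>)) (1 \<otimes> S(c\<^sub>(\<^sub>2\<^sub>)))\<close> without knowing that \<open>S\<close> reverses \<open>\<Delta>\<close>.\<close>
lemma comult_antipode_matrix:
  assumes f: "bilinear_map scale scale scale f"
    and c: "coalg_matrix I c" and i: "i \<in> I" "j \<in> I"
  shows "(\<Sum>m\<in>I. sweedler scale scale (\<lambda>u w. f (u * c m j) w) (comult (antipode (c i m)))) =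
    f 1 (antipode (c i j))"
proof -
  have fin: "finite I" using c by (simp add: coalg_matrix_def)
  note f' = f[unfolded bilinear_iff]
  have f2: "f u (\<Sum>k\<in>K. y k) = (\<Sum>k\<in>K. f u (y k))" for u y and K :: "'c set"
    using f unfolding bilinear_map_def by (blast intro: linear_sum_image)
  have f0: "f u 0 = 0" for u
    using f'[THEN conjunct2, THEN conjunct1, rule_format, of u 0 0] by simp
  define F where "F q u w = f u (w * antipode (c q j))" for q u w
  have bF: "bilinear_map scale scale scale (F q)" for q
    using f' by (simp add: F_def bilinear_iff distrib_right mult_scale)
  have step: "sweedler scale scale (\<lambda>u w. f (u * c m j) w) (comult (antipode (c i m))) =
      (\<Sum>q\<in>I. sweedler scale scale (F q) (comult (antipode (c i m) * c m q)))" if m: "m \<in> I" for m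
  proof -
    obtain n :: nat and u w where D: "comult (antipode (c i m)) = (\<Sum>r<n. tensor scale scale (u r) (w r))"
      by (rule comult_decomp)
    have "bilinear_map scale scale scale (\<lambda>u w. f (u * c m j) w)"
      using f' by (simp add: bilinear_iff distrib_right mult_scale)
    then have "sweedler scale scale (\<lambda>u w. f (u * c m j) w) (comult (antipode (c i m))) =
        (\<Sum>r<n. f (u r * c m j) (w r))"
      unfolding D by (rule sweedler_sum)
    \<comment> \<open>A unit matrix c S(c) is inserted in the second factor, so that the entries c m
      p and c p q reassemble to the comultiplication of c m q.\<close>
    also have "\<dots> = (\<Sum>r<n. \<Sum>p\<in>I. \<Sum>q\<in>I. f (u r * c m p) (w r * c p q * antipode (c q j)))"
    proof (rule sum.cong[OF refl])
      fix r
      have "(\<Sum>p\<in>I. \<Sum>q\<in>I. f (u r * c m p) (w r * c p q * antipode (c q j))) =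
          (\<Sum>p\<in>I. f (u r * c m p) (w r * (\<Sum>q\<in>I. c p q * antipode (c q j))))"
        by (simp add: f2 sum_distrib_left mult.assoc)
      also have "\<dots> = (\<Sum>p\<in>I. if p = j then f (u r * c m j) (w r) else 0)"
        by (rule sum.cong[OF refl]) (use antipode_matrix(2)[OF c _ i(2)] f0 in simp)
      also have "\<dots> = f (u r * c m j) (w r)" using fin i(2) by simp
      finally show "f (u r * c m j) (w r) = (\<Sum>p\<in>I. \<Sum>q\<in>I. f (u r * c m p) (w r * c p q * antipode (c q j)))"
        by simp
    qed
    also have "\<dots> = (\<Sum>q\<in>I. \<Sum>r<n. \<Sum>p\<in>I. f (u r * c m p) (w r * c p q * antipode (c q j)))"
      by (subst sum.swap[of _ I I], subst sum.swap) (rule refl)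
    also have "\<dots> = (\<Sum>q\<in>I. sweedler scale scale (F q) (comult (antipode (c i m) * c m q)))"
    proof (rule sum.cong[OF refl])
      fix q assume q: "q \<in> I"
      have "comult (c m q) = (\<Sum>p\<in>I. tensor scale scale (c m p) (c p q))"
        using c m q by (simp add: coalg_matrix_def)
      from comult_mult_sum[OF finite_lessThan D fin this]
      have "sweedler scale scale (F q) (comult (antipode (c i m) * c m q)) =
          (\<Sum>s\<in>{..<n} \<times> I. F q (u (fst s) * c m (snd s)) (w (fst s) * c (snd s) q))"
        using fin by (simp add: sweedler_sum_set[OF bF])
      then show "(\<Sum>r<n. \<Sum>p\<in>I. f (u r * c m p) (w r * c p q * antipode (c q j))) =
          sweedler scale scale (F q) (comult (antipode (c i m) * c m q))"
        by (simp add: F_def sum.cartesian_product')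
    qed
    finally show ?thesis .
  qed
  have "(\<Sum>m\<in>I. sweedler scale scale (\<lambda>u w. f (u * c m j) w) (comult (antipode (c i m)))) =
      (\<Sum>q\<in>I. \<Sum>m\<in>I. sweedler scale scale (F q) (comult (antipode (c i m) * c m q)))"
    by (simp add: step) (rule sum.swap)
  \<comment> \<open>By linearity of \<open>comult\<close> the sum over m is taken inside, where S(c)
    c = 1.\<close>
  also have "\<dots> = (\<Sum>q\<in>I. sweedler scale scale (F q) (comult (if i = q then 1 else 0)))"
    by (rule sum.cong[OF refl])
      (simp only: linear_sum_image[OF linear_comult[OF bF], symmetric] antipode_matrix(1)[OF c i(1)])
  also have "\<dots> = (\<Sum>q\<in>I. if q = i then f 1 (antipode (c i j)) else 0)"
  proof (rule sum.cong[OF refl])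
    fix q
    have "sweedler scale scale (F q) (comult 0) = 0"
      using linear_sum_image[OF linear_comult[OF bF], of q "\<lambda>_. 0" "{}"] by simp
    moreover have "sweedler scale scale (F i) (comult 1) = f 1 (antipode (c i j))"
      using sweedler_tensor[OF bF] by (simp add: comult_one F_def)
    ultimately show "sweedler scale scale (F q) (comult (if i = q then 1 else 0)) =
        (if q = i then f 1 (antipode (c i j)) else 0)" by auto
  qed
  also have "\<dots> = f 1 (antipode (c i j))" using fin i(1) by simp
  finally show ?thesis .
qed

text \<open>Says that the scalar matrix t(c P S(c)) commutes with c when P is the matrix unit at (k,
  i); general P follow by linearity.\<close>

lemma integral_matrix_commute:
  assumes t: "left_integral scale comult t"
    and c: "coalg_matrix I c" and ij: "i \<in> I" "j \<in> I" and kl: "k \<in> I" "l \<in> I"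
  shows "(\<Sum>m\<in>I. scale (t (c m k * antipode (c i j))) (c l m)) =
    (\<Sum>m\<in>I. scale (t (c l k * antipode (c i m))) (c m j))"
proof -
  have fin: "finite I" using c by (simp add: coalg_matrix_def)
  have lt: "t (x + y) = t x + t y" "t (scale a x) = a * t x" for x y a
    using t unfolding left_integral_def linear_iff_add_scale by auto
  \<comment> \<open>Read off from the integral identity at c l k S(c i m): with u and w the two
    factors of the comultiplication of S(c i m), it expresses t of this element times 1 as the sum
    of \<open>f u w\<close>.\<close>
  define f where "f u w = (\<Sum>g\<in>I. scale (t (c g k * w)) (c l g * u))" for u w
  have bf: "bilinear_map scale scale scale f"
    by (simp add: bilinear_iff f_def distrib_left mult_scale lt scale_left_distrib scale_right_distrib
        sum.distrib scale_sum_right mult.commute)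
  have bt: "bilinear_map scale scale scale (\<lambda>a1 a2. scale (t a2) a1)"
    by (simp add: bilinear_iff lt scale_left_distrib scale_right_distrib mult.commute)
  have "scale (t (c l k * antipode (c i m))) (c m j) =
      sweedler scale scale (\<lambda>u w. f (u * c m j) w) (comult (antipode (c i m)))" if m: "m \<in> I" for m
  proof -
    obtain n :: nat and u w where D: "comult (antipode (c i m)) = (\<Sum>r<n. tensor scale scale (u r) (w r))"
      by (rule comult_decomp)
    let ?a = "c l k * antipode (c i m)"
    have "comult (c l k) = (\<Sum>g\<in>I. tensor scale scale (c l g) (c g k))"
      using c kl by (simp add: coalg_matrix_def)
    from comult_mult_sum[OF fin this finite_lessThan D]
    have "sweedler scale scale (\<lambda>a1 a2. scale (t a2) a1) (comult ?a) =
        (\<Sum>s\<in>I \<times> {..<n}. scale (t (c (fst s) k * w (snd s))) (c l (fst s) * u (snd s)))"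
      using fin by (simp add: sweedler_sum_set[OF bt])
    then have "scale (t ?a) 1 = (\<Sum>g\<in>I. \<Sum>r<n. scale (t (c g k * w r)) (c l g * u r))"
      using t unfolding left_integral_def by (simp add: sum.cartesian_product')
    then have "scale (t ?a) 1 * c m j = (\<Sum>g\<in>I. \<Sum>r<n. scale (t (c g k * w r)) (c l g * u r)) * c m j"
      by simp
    then have "scale (t ?a) (c m j) = (\<Sum>r<n. f (u r * c m j) (w r))"
      unfolding f_def by (subst sum.swap) (simp add: sum_distrib_right mult_scale mult.assoc)
    moreover have "bilinear_map scale scale scale (\<lambda>u w. f (u * c m j) w)"
      using bf by (simp add: bilinear_iff distrib_right mult_scale)
    ultimately show ?thesis unfolding D by (simp add: sweedler_sum)
  qed
  then have "(\<Sum>m\<in>I. scale (t (c l k * antipode (c i m))) (c m j)) = f 1 (antipode (c i j))"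
    using comult_antipode_matrix[OF bf c ij] by simp
  then show ?thesis by (simp add: f_def)
qed

lemma ad_invariant_matrix:
  assumes t: "ad_invariant scale comult counit antipode t" "Vector_Spaces.linear scale (*) t"
    and d: "coalg_matrix I d" and ab: "a \<in> I" "b \<in> I"
  shows "(\<Sum>g\<in>I. t (d a g * x * antipode (d g b))) = (if a = b then t x else 0)"
proof -
  have fin: "finite I" using d by (simp add: coalg_matrix_def)
  have lt: "t (x + y) = t x + t y" "t (scale a x) = a * t x" for x y a
    using t(2) unfolding linear_iff_add_scale by auto
  have "bilinear_map scale scale (*) (\<lambda>a1 a2. t (a1 * x * antipode a2))"
    by (subst bilinear_map_iff[OF vector_space_axioms vector_space_axioms vector_space_field])
      (simp add: lt mult_scale distrib_left distrib_right antipode_add antipode_scale)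
  from sweedler_sum_set[OF this fin, of "\<lambda>g. d a g" "\<lambda>g. d g b"]
  moreover have "sweedler scale scale (\<lambda>a1 a2. t (a1 * x * antipode a2)) (comult (d a b)) = counit (d a b) * t x"
    using t(1) unfolding ad_invariant_def by blast
  ultimately show ?thesis using d ab by (simp add: coalg_matrix_def)
qed

end

section \<open>Averaging an operator on a comodule\<close>

locale comodule_basis = hopf_comodule sH \<Delta> \<epsilon> S sV \<rho>
  for sH :: "'f::field \<Rightarrow> 'h::ring_1 \<Rightarrow> 'h" and \<Delta> \<epsilon> S
    and sV :: "'f \<Rightarrow> 'v::ab_group_add \<Rightarrow> 'v" and \<rho> +
  fixes B :: "'v set"
  assumes B: "finite B" "V.independent B" "V.span B = UNIV"
begin

abbreviation crd :: "'v \<Rightarrow> 'v \<Rightarrow> 'f"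
  where "crd \<equiv> V.representation B"

text \<open>The coefficient \<open>\<kappa> i v\<close> of \<open>i\<close> in \<open>\<rho> v\<close>; for basis vectors \<open>i\<close>, \<open>j\<close> the elements
  \<open>\<kappa> i j\<close> are the matrix coefficients of the comodule.\<close>
definition \<kappa> :: "'v \<Rightarrow> 'v \<Rightarrow> 'h"
  where "\<kappa> i v = sweedler sV sH (\<lambda>w h. sH (crd w i) h) (\<rho> v)"

lemma crd_add: "crd (v + w) i = crd v i + crd w i"
  using V.representation_add[OF B(2)] B(3) by simp

lemma crd_scale: "crd (sV c v) i = c * crd v i"
  using V.representation_scale[OF B(2)] B(3) by simp

lemma crd_sum_scale: "crd (\<Sum>k\<in>K. sV (c k) (x k)) i = (\<Sum>k\<in>K. c k * crd (x k) i)"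
  using B(3) by (simp add: V.representation_sum[OF B(2)] crd_scale)

lemma crd_basis: "j \<in> B \<Longrightarrow> crd j i = (if i = j then 1 else 0)"
  by (simp add: V.representation_basis[OF B(2)])

lemma sum_crd: "(\<Sum>i\<in>B. sV (crd v i) i) = v"
  using V.sum_representation_eq[OF B(2), of v B] B by simp

lemma crd_subspace: "C \<subseteq> B \<Longrightarrow> x \<in> V.span C \<Longrightarrow> i \<notin> C \<Longrightarrow> crd x i = 0"
  using V.representation_extend[OF B(2), of x C] V.representation_ne_zero[of C x i] by metis

lemma bilinear_coord:
  assumes "vector_space sX"
  shows "bilinear_map sV sX sX (\<lambda>w h. sX (crd w i) h)"
proof -
  interpret X: vector_space sX by fact
  show ?thesis
    by (subst bilinear_map_iff[OF V.vector_space_axioms assms assms])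
      (simp add: crd_add crd_scale X.scale_left_distrib X.scale_right_distrib mult.commute)
qed

lemma sweedler_coord:
  assumes "vector_space sX" "i \<in> B"
  shows "sweedler sV sX (\<lambda>w h. sX (crd w i) h) (\<Sum>k\<in>B. tensor sV sX k (h k)) = h i"
proof -
  interpret X: vector_space sX by fact
  have "sweedler sV sX (\<lambda>w h. sX (crd w i) h) (\<Sum>k\<in>B. tensor sV sX k (h k)) = (\<Sum>k\<in>B. sX (crd k i) (h k))"
    by (rule sweedler_sum_set[OF bilinear_coord[OF assms(1)] B(1)])
  also have "\<dots> = (\<Sum>k\<in>B. if k = i then h i else 0)"
    by (rule sum.cong[OF refl]) (auto simp: crd_basis)
  finally show ?thesis using B(1) assms(2) by simp
qed

lemma tensor_lin:
  assumes "vector_space sX"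
  shows "tensor sV sX w (x + y) = tensor sV sX w x + tensor sV sX w y"
  "tensor sV sX w (sX c y) = tensor_scale c (tensor sV sX w y)"
  "tensor sV sX (v + w) y = tensor sV sX v y + tensor sV sX w y"
  "tensor sV sX (sV c w) y = tensor_scale c (tensor sV sX w y)"
  "tensor sV sX w (\<Sum>k\<in>K. z k) = (\<Sum>k\<in>K. tensor sV sX w (z k))"
  "tensor sV sX (\<Sum>k\<in>K'. u k) y = (\<Sum>k\<in>K'. tensor sV sX (u k) y)"
proof -
  have l: "Vector_Spaces.linear sX tensor_scale (tensor sV sX w)"
    "Vector_Spaces.linear sV tensor_scale (\<lambda>w. tensor sV sX w y)" for w y
    using bilinear_map_tensor[OF V.vector_space_axioms assms] unfolding bilinear_map_def by blast+
  show "tensor sV sX w (x + y) = tensor sV sX w x + tensor sV sX w y"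
    "tensor sV sX w (sX c y) = tensor_scale c (tensor sV sX w y)"
    "tensor sV sX (v + w) y = tensor sV sX v y + tensor sV sX w y"
    "tensor sV sX (sV c w) y = tensor_scale c (tensor sV sX w y)"
    using l unfolding linear_iff_add_scale by blast+
  show "tensor sV sX w (\<Sum>k\<in>K. z k) = (\<Sum>k\<in>K. tensor sV sX w (z k))"
    by (rule linear_sum_image[OF l(1)])
  show "tensor sV sX (\<Sum>k\<in>K'. u k) y = (\<Sum>k\<in>K'. tensor sV sX (u k) y)"
    by (rule linear_sum_image[OF l(2)])
qed

lemma coact_expand: "\<rho> v = (\<Sum>i\<in>B. tensor sV sH i (\<kappa> i v))"
proof -
  note vs = vector_space_axioms
  obtain n x y where r: "\<rho> v = (\<Sum>r<n::nat. tensor sV sH (x r) (y r))"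
    using coact_in[of v] unfolding tensor_product_def by blast
  have k: "\<kappa> i v = (\<Sum>r<n. sH (crd (x r) i) (y r))" for i
    unfolding \<kappa>_def r by (rule sweedler_sum[OF bilinear_coord[OF vs]])
  have "tensor sV sH (x r) (y r) = (\<Sum>i\<in>B. tensor sV sH i (sH (crd (x r) i) (y r)))" for r
  proof -
    have "tensor sV sH (x r) (y r) = tensor sV sH (\<Sum>i\<in>B. sV (crd (x r) i) i) (y r)"
      by (simp only: sum_crd)
    then show ?thesis by (simp only: tensor_lin[OF vs])
  qed
  then show ?thesis
    unfolding r k tensor_lin(5)[OF vs] by (simp only:) (rule sum.swap)
qed

lemma kappa_eq:
  assumes "\<rho> v = (\<Sum>i\<in>B. tensor sV sH i (h i))" "i \<in> B"
  shows "\<kappa> i v = h i"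
  unfolding \<kappa>_def assms(1) by (rule sweedler_coord[OF vector_space_axioms assms(2)])

lemma kappa_linear: "i \<in> B \<Longrightarrow> Vector_Spaces.linear sV sH (\<kappa> i)"
  unfolding \<kappa>_def[abs_def]
  by (rule linear_sweedler[OF bilinear_coord[OF vector_space_axioms] coact_linear coact_in])

lemma kappa_add: "i \<in> B \<Longrightarrow> \<kappa> i (v + w) = \<kappa> i v + \<kappa> i w"
  and kappa_scale: "i \<in> B \<Longrightarrow> \<kappa> i (sV c v) = sH c (\<kappa> i v)"
  using kappa_linear unfolding linear_iff_add_scale by blast+

lemma kappa_sum: "i \<in> B \<Longrightarrow> \<kappa> i (\<Sum>k\<in>K. x k) = (\<Sum>k\<in>K. \<kappa> i (x k))"
  by (rule linear_sum_image[OF kappa_linear])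

lemma kappa_crd: "i \<in> B \<Longrightarrow> \<kappa> i v = (\<Sum>j\<in>B. sH (crd v j) (\<kappa> i j))"
  using kappa_sum[of i "\<lambda>j. sV (crd v j) j" B] by (simp add: sum_crd kappa_scale)

lemma sweedler_coact:
  assumes "bilinear_map sV sH sC f"
  shows "sweedler sV sH f (\<rho> v) = (\<Sum>i\<in>B. f i (\<kappa> i v))"
  by (subst coact_expand) (rule sweedler_sum_set[OF assms B(1)])

lemma kappa_counit:
  assumes "i \<in> B"
  shows "\<epsilon> (\<kappa> i v) = crd v i"
proof -
  have "\<epsilon> (x + y) = \<epsilon> x + \<epsilon> y" "\<epsilon> (sH c x) = c * \<epsilon> x" for x y c
    using counit_linear unfolding linear_iff_add_scale by auto
  then have "bilinear_map sV sH sV (\<lambda>w h. sV (\<epsilon> h) w)"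
    by (subst bilinear_map_iff[OF V.vector_space_axioms vector_space_axioms V.vector_space_axioms])
      (simp add: V.scale_left_distrib V.scale_right_distrib mult.commute)
  from sweedler_coact[OF this, of v] have "v = (\<Sum>k\<in>B. sV (\<epsilon> (\<kappa> k v)) k)"
    by (simp add: coact_counit)
  then have "crd v i = crd (\<Sum>k\<in>B. sV (\<epsilon> (\<kappa> k v)) k) i" by simp
  also have "\<dots> = (\<Sum>k\<in>B. if k = i then \<epsilon> (\<kappa> i v) else 0)"
    unfolding crd_sum_scale by (rule sum.cong[OF refl]) (auto simp: crd_basis)
  finally show ?thesis using B(1) assms by simp
qed

text \<open>Coassociativity of the coaction, compared at the basis vector \<open>i\<close> of the
  left factor.\<close>

lemma kappa_comult:
  assumes i: "i \<in> B"
  shows "\<Delta> (\<kappa> i v) = (\<Sum>k\<in>B. tensor sH sH (\<kappa> i k) (\<kappa> k v))"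
proof -
  interpret t: vector_space "tensor_scale :: 'f \<Rightarrow> ('f, 'h, 'h) tensor \<Rightarrow> _"
    by (rule vector_space_tensor_scale)
  interpret tt: vector_space "tensor_scale :: 'f \<Rightarrow> ('f, 'v, ('f, 'h, 'h) tensor) tensor \<Rightarrow> _"
    by (rule vector_space_tensor_scale)
  note vs = V.vector_space_axioms vector_space_axioms vector_space_tensor_scale
  note bil = bilinear_map_iff[OF vs]
  note tl = tensor_lin[OF vector_space_tensor_scale]
  have inner: "sweedler sV sH (\<lambda>w0 w1. tensor sV tensor_scale w0 (tensor sH sH w1 h)) (\<rho> w) =
      (\<Sum>i\<in>B. tensor sV tensor_scale i (tensor sH sH (\<kappa> i w) h))" for w h
    by (rule sweedler_coact[where sC = tensor_scale]) (simp add: bil tl tensor_simps)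
  have lhs: "sweedler sV sH (\<lambda>w h. sweedler sV sH
          (\<lambda>w0 w1. tensor sV tensor_scale w0 (tensor sH sH w1 h)) (\<rho> w)) (\<rho> v) =
      (\<Sum>k\<in>B. \<Sum>i\<in>B. tensor sV tensor_scale i (tensor sH sH (\<kappa> i k) (\<kappa> k v)))"
    unfolding inner
    by (rule sweedler_coact[where sC = tensor_scale])
      (simp add: bil tl tensor_simps kappa_add kappa_scale sum.distrib tt.scale_sum_right)
  have D: "\<Delta> (x + y) = \<Delta> x + \<Delta> y" "\<Delta> (sH c x) = tensor_scale c (\<Delta> x)" for x y c
    using comult_linear unfolding linear_iff_add_scale by auto
  have rhs: "sweedler sV sH (\<lambda>w h. tensor sV tensor_scale w (\<Delta> h)) (\<rho> v) =
      (\<Sum>i\<in>B. tensor sV tensor_scale i (\<Delta> (\<kappa> i v)))"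
    by (rule sweedler_coact[where sC = tensor_scale]) (simp add: bil tl D)
  have "(\<Sum>i\<in>B. tensor sV tensor_scale i (\<Delta> (\<kappa> i v))) =
      (\<Sum>i\<in>B. tensor sV tensor_scale i (\<Sum>k\<in>B. tensor sH sH (\<kappa> i k) (\<kappa> k v)))"
    unfolding rhs[symmetric] coact_coassoc[symmetric] lhs tl(5) by (rule sum.swap)
  \<comment> \<open>Contracting the left factor with the coordinate of \<open>i\<close> isolates one
    summand.\<close>
  from arg_cong[OF this, of "sweedler sV tensor_scale (\<lambda>w T. tensor_scale (crd w i) T)"]
  show ?thesis unfolding sweedler_coord[OF vector_space_tensor_scale i] .
qed

lemma coalg_matrix_kappa: "coalg_matrix B \<kappa>"
  unfolding coalg_matrix_def using B(1) kappa_comult kappa_counit crd_basis by auto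

text \<open>The coefficient matrix is block triangular when part of the basis spans a
  subcomodule.\<close>

lemma kappa_outside:
  assumes "C \<subseteq> B" "\<rho> w \<in> tensor_product sV sH (V.span C) UNIV" "i \<notin> C"
  shows "\<kappa> i w = 0"
proof -
  obtain n x y where r: "\<rho> w = (\<Sum>r<n::nat. tensor sV sH (x r) (y r))" "\<forall>r<n. x r \<in> V.span C"
    using assms(2) unfolding tensor_product_def by blast
  have "\<kappa> i w = (\<Sum>r<n. sH (crd (x r) i) (y r))"
    unfolding \<kappa>_def r(1) by (rule sweedler_sum[OF bilinear_coord[OF vector_space_axioms]])
  also have "\<dots> = 0" using r(2) crd_subspace[OF assms(1) _ assms(3)] by simp
  finally show ?thesis .
qed

text \<open>The entries of \<open>t(c P S(c))\<close>, where \<open>c\<close> is the coefficient matrix and \<open>P\<close> the matrix of \<open>p\<close>.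
  In Sweedler notation the averaged operator is \<open>v \<mapsto> t(p(v\<^sub>(\<^sub>0\<^sub>))\<^sub>(\<^sub>1\<^sub>) S(v\<^sub>(\<^sub>1\<^sub>))) p(v\<^sub>(\<^sub>0\<^sub>))\<^sub>(\<^sub>0\<^sub>)\<close>.\<close>
definition avg_entry :: "('h \<Rightarrow> 'f) \<Rightarrow> ('v \<Rightarrow> 'v) \<Rightarrow> 'v \<Rightarrow> 'v \<Rightarrow> 'f"
  where "avg_entry t p m j = (\<Sum>k\<in>B. \<Sum>i\<in>B. crd (p i) k * t (\<kappa> m k * S (\<kappa> i j)))"

definition avg :: "('h \<Rightarrow> 'f) \<Rightarrow> ('v \<Rightarrow> 'v) \<Rightarrow> 'v \<Rightarrow> 'v"
  where "avg t p v = (\<Sum>m\<in>B. sV (\<Sum>j\<in>B. crd v j * avg_entry t p m j) m)"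

lemma avg_linear: "Vector_Spaces.linear sV sV (avg t p)"
  by (auto simp: linear_iff_add_scale V.vector_space_axioms avg_def crd_add crd_scale
      distrib_right sum.distrib V.scale_left_distrib V.scale_sum_right sum_distrib_left mult.assoc)

lemma avg_basis: "j \<in> B \<Longrightarrow> avg t p j = (\<Sum>m\<in>B. sV (avg_entry t p m j) m)"
  using B(1) by (simp add: avg_def crd_basis if_distrib[of "\<lambda>x. x * _"] cong: if_cong)

text \<open>The matrix form of being a comodule map: \<open>integral_matrix_commute\<close> is
  summed over the matrix units composing \<open>p\<close>, then extended from basis vectors to all
  \<open>v\<close>.\<close>

lemma avg_kappa:
  assumes t: "left_integral sH \<Delta> t" and l: "l \<in> B"
  shows "\<kappa> l (avg t p v) = (\<Sum>m\<in>B. sH (avg_entry t p l m) (\<kappa> m v))"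
proof -
  have basis: "\<kappa> l (avg t p j) = (\<Sum>m\<in>B. sH (avg_entry t p l m) (\<kappa> m j))" if j: "j \<in> B" for j
  proof -
    have "\<kappa> l (avg t p j) = (\<Sum>m\<in>B. sH (avg_entry t p m j) (\<kappa> l m))"
      by (simp add: avg_basis[OF j] kappa_sum[OF l] kappa_scale[OF l])
    also have "\<dots> = (\<Sum>k\<in>B. \<Sum>i\<in>B. sH (crd (p i) k) (\<Sum>m\<in>B. sH (t (\<kappa> m k * S (\<kappa> i j))) (\<kappa> l m)))"
      unfolding avg_entry_def scale_sum_left scale_sum_right scale_scale
      by (subst sum.swap, rule sum.cong[OF refl], rule sum.swap)
    also have "\<dots> = (\<Sum>k\<in>B. \<Sum>i\<in>B. sH (crd (p i) k) (\<Sum>m\<in>B. sH (t (\<kappa> l k * S (\<kappa> i m))) (\<kappa> m j)))"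
    proof (rule sum.cong[OF refl], rule sum.cong[OF refl])
      fix k i assume "k \<in> B" "i \<in> B"
      from integral_matrix_commute[OF t coalg_matrix_kappa this(2) j this(1) l]
      show "sH (crd (p i) k) (\<Sum>m\<in>B. sH (t (\<kappa> m k * S (\<kappa> i j))) (\<kappa> l m)) =
          sH (crd (p i) k) (\<Sum>m\<in>B. sH (t (\<kappa> l k * S (\<kappa> i m))) (\<kappa> m j))" by simp
    qed
    also have "\<dots> = (\<Sum>m\<in>B. sH (avg_entry t p l m) (\<kappa> m j))"
      unfolding avg_entry_def scale_sum_left scale_sum_right scale_scale
      by (subst (2) sum.swap, rule sum.cong[OF refl], rule sum.swap)
    finally show ?thesis .
  qed
  have "avg t p v = (\<Sum>j\<in>B. sV (crd v j) (avg t p j))"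
  proof -
    have "avg t p v = avg t p (\<Sum>j\<in>B. sV (crd v j) j)" by (simp only: sum_crd)
    also have "\<dots> = (\<Sum>j\<in>B. avg t p (sV (crd v j) j))" by (rule linear_sum_image[OF avg_linear])
    finally show ?thesis using avg_linear[of t p] by (simp add: linear_iff_add_scale)
  qed
  then have "\<kappa> l (avg t p v) = (\<Sum>j\<in>B. sH (crd v j) (\<kappa> l (avg t p j)))"
    by (simp add: kappa_sum[OF l] kappa_scale[OF l])
  also have "\<dots> = (\<Sum>j\<in>B. \<Sum>m\<in>B. sH (avg_entry t p l m) (sH (crd v j) (\<kappa> m j)))"
    by (simp add: basis scale_sum_right mult.commute)
  also have "\<dots> = (\<Sum>m\<in>B. sH (avg_entry t p l m) (\<Sum>j\<in>B. sH (crd v j) (\<kappa> m j)))"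
    unfolding scale_sum_right by (rule sum.swap)
  also have "\<dots> = (\<Sum>m\<in>B. sH (avg_entry t p l m) (\<kappa> m v))"
    by (rule sum.cong[OF refl]) (simp only: kappa_crd[symmetric])
  finally show ?thesis .
qed

lemma avg_coact:
  assumes t: "left_integral sH \<Delta> t"
  shows "\<rho> (avg t p v) = sweedler sV sH (\<lambda>w h. tensor sV sH (avg t p w) h) (\<rho> v)"
proof -
  note tl = tensor_lin[OF vector_space_axioms]
  have "bilinear_map sV sH tensor_scale (\<lambda>w h. tensor sV sH (avg t p w) h)"
    using avg_linear[of t p]
    by (simp add: bilinear_map_iff[OF V.vector_space_axioms vector_space_axioms vector_space_tensor_scale]
        linear_iff_add_scale tl)
  then have "sweedler sV sH (\<lambda>w h. tensor sV sH (avg t p w) h) (\<rho> v) = (\<Sum>m\<in>B. tensor sV sH (avg t p m) (\<kappa> m v))"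
    by (rule sweedler_coact)
  also have "\<dots> = (\<Sum>m\<in>B. \<Sum>l\<in>B. tensor sV sH l (sH (avg_entry t p l m) (\<kappa> m v)))"
    by (rule sum.cong[OF refl]) (simp add: avg_basis tl)
  also have "\<dots> = (\<Sum>l\<in>B. tensor sV sH l (\<Sum>m\<in>B. sH (avg_entry t p l m) (\<kappa> m v)))"
    unfolding tl(5) by (rule sum.swap)
  also have "\<dots> = \<rho> (avg t p v)"
    unfolding coact_expand[of "avg t p v"] by (rule sum.cong[OF refl]) (simp only: avg_kappa[OF t])
  finally show ?thesis by simp
qed

text \<open>Rows outside \<open>C\<close> vanish, since neither c nor P leads out of
  \<open>C\<close>. In a column in \<open>C\<close> only indices on which P is the identity
  contribute, leaving c S(c) = 1 and \<open>t 1 = 1\<close>.\<close>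

lemma avg_projection:
  assumes t: "t 1 = 1" "Vector_Spaces.linear sH (*) t"
    and C: "C \<subseteq> B" "\<And>w. w \<in> V.span C \<Longrightarrow> \<rho> w \<in> tensor_product sV sH (V.span C) UNIV"
    and p: "\<And>v. p v \<in> V.span C" "\<And>w. w \<in> V.span C \<Longrightarrow> p w = w"
  shows "avg t p v \<in> V.span C" and "w \<in> V.span C \<Longrightarrow> avg t p w = w"
proof -
  have lt: "t (sH a x) = a * t x" for a x
    using t(2) unfolding linear_iff_add_scale by auto
  have t0: "t 0 = 0" using lt[of 0 0] by simp
  have k0: "\<kappa> m k = 0" if "k \<in> C" "m \<notin> C" for m k
    by (rule kappa_outside[OF C(1) C(2) that(2)]) (rule V.span_base[OF that(1)])
  have p0: "crd (p i) k = 0" if "k \<notin> C" for i k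
    by (rule crd_subspace[OF C(1) p(1) that])
  have e0: "avg_entry t p m j = 0" if "m \<notin> C" for m j
    unfolding avg_entry_def
  proof (intro sum.neutral ballI)
    fix k i
    show "crd (p i) k * t (\<kappa> m k * S (\<kappa> i j)) = 0"
      by (cases "k \<in> C") (use k0 p0 that t0 in auto)
  qed
  show "avg t p v \<in> V.span C" for v
    unfolding avg_def
  proof (rule V.span_sum)
    fix m assume "m \<in> B"
    show "sV (\<Sum>j\<in>B. crd v j * avg_entry t p m j) m \<in> V.span C"
      by (cases "m \<in> C") (auto simp: e0 intro: V.span_scale V.span_base V.span_zero)
  qed
  have ej: "avg t p j = j" if j: "j \<in> C" for j
  proof -
    have jB: "j \<in> B" using j C(1) by blast
    have "avg_entry t p m j = (if m = j then 1 else 0)" if m: "m \<in> B" for m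
    proof -
      have "avg_entry t p m j = (\<Sum>i\<in>B. \<Sum>k\<in>B. crd (p i) k * t (\<kappa> m k * S (\<kappa> i j)))"
        unfolding avg_entry_def by (rule sum.swap)
      also have "\<dots> = (\<Sum>i\<in>B. t (\<kappa> m i * S (\<kappa> i j)))"
      proof (rule sum.cong[OF refl])
        fix i assume i: "i \<in> B"
        show "(\<Sum>k\<in>B. crd (p i) k * t (\<kappa> m k * S (\<kappa> i j))) = t (\<kappa> m i * S (\<kappa> i j))"
        proof (cases "i \<in> C")
          case True
          then have "p i = i" by (intro p(2) V.span_base)
          then show ?thesis
            using i B(1) by (simp add: crd_basis if_distrib[of "\<lambda>x. x * _"] cong: if_cong)
        next
          case False
          then show ?thesis using k0[OF j] t0 by simp
        qed
      qed
      also have "\<dots> = t (\<Sum>i\<in>B. \<kappa> m i * S (\<kappa> i j))"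
        by (rule linear_sum_image[OF t(2), symmetric])
      also have "\<dots> = (if m = j then 1 else 0)"
        using antipode_matrix(2)[OF coalg_matrix_kappa m jB] t(1) t0 by simp
      finally show ?thesis .
    qed
    then have "avg t p j = (\<Sum>m\<in>B. if m = j then j else 0)"
      unfolding avg_basis[OF jB] by (intro sum.cong) auto
    then show ?thesis using B(1) jB by simp
  qed
  show "avg t p w = w" if "w \<in> V.span C" for w
    using that
  proof (induction rule: V.span_induct_alt)
    case base
    show ?case using linear_sum_image[OF avg_linear, of t p "\<lambda>_. 0" "{}"] by simp
  next
    case (step c x y)
    then show ?case using avg_linear[of t p] ej by (simp add: linear_iff_add_scale)
  qed
qed

end

section \<open>Averaging and the Lie algebra action\<close>

lemma (in comodule_basis) linear_expand:
  assumes "Vector_Spaces.linear sV s f"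
  shows "f v = (\<Sum>j\<in>B. s (crd v j) (f j))"
proof -
  have "f v = f (\<Sum>j\<in>B. sV (crd v j) j)" by (simp only: sum_crd)
  also have "\<dots> = (\<Sum>j\<in>B. f (sV (crd v j) j))" by (rule linear_sum_image[OF assms])
  finally show ?thesis using assms by (simp add: linear_iff_add_scale)
qed

locale HL_basis = HL_module sH \<Delta> \<epsilon> S sL br \<rho>L sV \<rho>V \<psi> +
    LB: comodule_basis sH \<Delta> \<epsilon> S sL \<rho>L BL + VB: comodule_basis sH \<Delta> \<epsilon> S sV \<rho>V BV
  for sH :: "'f::field \<Rightarrow> 'h::ring_1 \<Rightarrow> 'h" and \<Delta> \<epsilon> S
    and sL :: "'f \<Rightarrow> 'l::ab_group_add \<Rightarrow> 'l" and br \<rho>L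
    and sV :: "'f \<Rightarrow> 'v::ab_group_add \<Rightarrow> 'v" and \<rho>V \<psi> BL BV
begin

lemma psi_add: "\<psi> (x + y) v = \<psi> x v + \<psi> y v" "\<psi> x (v + w) = \<psi> x v + \<psi> x w"
  and psi_scale: "\<psi> (sL c x) v = sV c (\<psi> x v)" "\<psi> x (sV c v) = sV c (\<psi> x v)"
  using rep.rep_bilinear unfolding bilinear_map_def linear_iff_add_scale by blast+

lemma psi_linear: "Vector_Spaces.linear sV sV (\<psi> x)" "Vector_Spaces.linear sL sV (\<lambda>x. \<psi> x v)"
  using rep.rep_bilinear unfolding bilinear_map_def by auto

abbreviation entry :: "'l \<Rightarrow> 'v \<Rightarrow> 'v \<Rightarrow> 'f"
  where "entry b i j \<equiv> VB.crd (\<psi> b j) i"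

text \<open>Compatibility of coaction and action in coordinates; it is the only access to
  \<open>coact_rep\<close> in the averaging argument.\<close>

lemma kappa_psi:
  assumes l: "l \<in> BV"
  shows "VB.\<kappa> l (\<psi> b v) = (\<Sum>a\<in>BL. \<Sum>i\<in>BV. sH (entry a l i) (LB.\<kappa> a b * VB.\<kappa> i v))"
proof -
  interpret t: vector_space "tensor_scale :: 'f \<Rightarrow> ('f, 'v, 'h) tensor \<Rightarrow> _"
    by (rule vector_space_tensor_scale)
  note vs = L.vector_space_axioms
  note tl = VB.tensor_lin[OF vs]
  have inner: "sweedler sV sH (\<lambda>v0 v1. tensor sV sH (\<psi> a0 v0) (a1 * v1)) (\<rho>V v) =
      (\<Sum>i\<in>BV. tensor sV sH (\<psi> a0 i) (a1 * VB.\<kappa> i v))" for a0 a1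
    by (rule VB.sweedler_coact[where sC = tensor_scale])
      (simp add: bilinear_map_iff[OF V.V.vector_space_axioms vs vector_space_tensor_scale]
        psi_add psi_scale tl distrib_left L.mult_scale)
  have "\<rho>V (\<psi> b v) = (\<Sum>a\<in>BL. \<Sum>i\<in>BV. tensor sV sH (\<psi> a i) (LB.\<kappa> a b * VB.\<kappa> i v))"
    unfolding coact_rep inner
    by (rule LB.sweedler_coact[where sC = tensor_scale])
      (simp add: bilinear_map_iff[OF L.V.vector_space_axioms vs vector_space_tensor_scale]
        psi_add psi_scale tl distrib_right L.mult_scale sum.distrib t.scale_sum_right)
  also have "\<dots> = (\<Sum>a\<in>BL. \<Sum>i\<in>BV. \<Sum>l\<in>BV. tensor sV sH l (sH (entry a l i) (LB.\<kappa> a b * VB.\<kappa> i v)))"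
  proof (intro sum.cong[OF refl])
    fix a i
    have "tensor sV sH (\<psi> a i) h = tensor sV sH (\<Sum>l\<in>BV. sV (entry a l i) l) h" for h
      by (simp only: VB.sum_crd)
    then show "tensor sV sH (\<psi> a i) (LB.\<kappa> a b * VB.\<kappa> i v) =
        (\<Sum>l\<in>BV. tensor sV sH l (sH (entry a l i) (LB.\<kappa> a b * VB.\<kappa> i v)))"
      by (simp only: tl)
  qed
  also have "\<dots> = (\<Sum>a\<in>BL. \<Sum>l\<in>BV. \<Sum>i\<in>BV. tensor sV sH l (sH (entry a l i) (LB.\<kappa> a b * VB.\<kappa> i v)))"
    by (rule sum.cong[OF refl], rule sum.swap)
  also have "\<dots> = (\<Sum>l\<in>BV. tensor sV sH l (\<Sum>a\<in>BL. \<Sum>i\<in>BV. sH (entry a l i) (LB.\<kappa> a b * VB.\<kappa> i v)))"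
    unfolding tl(5) by (rule sum.swap)
  finally show ?thesis by (rule VB.kappa_eq[OF _ l])
qed

text \<open>Matrix form of commuting with the action of \<open>a\<close>: the action is carried from
  left to right through c, P and S(c) in turn, with factors d and S(d) appearing and then being
  absorbed.\<close>

lemma avg_entry_commute:
  assumes t: "left_integral sH \<Delta> t" "ad_invariant sH \<Delta> \<epsilon> S t"
    and p: "Vector_Spaces.linear sV sV p" "\<And>x v. p (\<psi> x v) = \<psi> x (p v)"
    and a: "a \<in> BL" and l: "l \<in> BV" and j: "j \<in> BV"
  shows "(\<Sum>m\<in>BV. entry a l m * VB.avg_entry t p m j) = (\<Sum>m\<in>BV. VB.avg_entry t p l m * entry a m j)"
proof -
  let ?c = VB.\<kappa> and ?d = LB.\<kappa> and ?p = "\<lambda>k i. VB.crd (p i) k"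
  have lt: "Vector_Spaces.linear sH (*) t" using t(1) by (simp add: left_integral_def)
  have t': "t (x + y) = t x + t y" "t (sH c x) = c * t x" for x y c
    using lt unfolding linear_iff_add_scale by auto
  have tsum: "t (\<Sum>i\<in>I. x i) = (\<Sum>i\<in>I. t (x i))" for I :: "'i set" and x
    by (rule linear_sum_image[OF lt])
  have pA: "(\<Sum>k\<in>BV. ?p k i * entry b n k) = (\<Sum>k\<in>BV. ?p n k * entry b k i)" for b n i
  proof -
    have "VB.crd (\<psi> b (p i)) n = (\<Sum>k\<in>BV. ?p k i * entry b n k)"
      by (subst VB.linear_expand[OF psi_linear(1)]) (rule VB.crd_sum_scale)
    moreover have "VB.crd (p (\<psi> b i)) n = (\<Sum>k\<in>BV. entry b k i * ?p n k)"
      by (subst VB.linear_expand[OF p(1)]) (rule VB.crd_sum_scale)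
    ultimately show ?thesis by (simp add: p(2) mult.commute)
  qed
  \<comment> \<open>Ad-invariance, read backwards, inserts d and S(d) around the argument of t; d
    then combines with c by \<open>kappa_psi\<close>, and the action comes out on the other side of
    c.\<close>
  have 1: "(\<Sum>m\<in>BV. entry a l m * t (?c m k * y)) =
      (\<Sum>b\<in>BL. \<Sum>n\<in>BV. entry b n k * t (?c l n * (y * S (?d b a))))" if k: "k \<in> BV" for k y
  proof -
    have "(\<Sum>m\<in>BV. entry a l m * t (?c m k * y)) =
        (\<Sum>g\<in>BL. \<Sum>m\<in>BV. entry g l m * (if g = a then t (?c m k * y) else 0))"
    proof -
      have "(\<Sum>g\<in>BL. \<Sum>m\<in>BV. entry g l m * (if g = a then t (?c m k * y) else 0)) =
          (\<Sum>g\<in>BL. if g = a then \<Sum>m\<in>BV. entry a l m * t (?c m k * y) else 0)"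
        by (rule sum.cong) auto
      then show ?thesis using LB.B(1) a by simp
    qed
    also have "\<dots> = (\<Sum>g\<in>BL. \<Sum>m\<in>BV. entry g l m * (\<Sum>b\<in>BL. t (?d g b * (?c m k * y) * S (?d b a))))"
      by (intro sum.cong[OF refl]) (simp only: L.ad_invariant_matrix[OF t(2) lt LB.coalg_matrix_kappa _ a])
    also have "\<dots> = (\<Sum>g\<in>BL. \<Sum>b\<in>BL. \<Sum>m\<in>BV. entry g l m * t (?d g b * (?c m k * y) * S (?d b a)))"
      unfolding sum_distrib_left by (rule sum.cong[OF refl], rule sum.swap)
    also have "\<dots> = (\<Sum>b\<in>BL. \<Sum>g\<in>BL. \<Sum>m\<in>BV. entry g l m * t (?d g b * (?c m k * y) * S (?d b a)))"
      by (rule sum.swap)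
    also have "\<dots> = (\<Sum>b\<in>BL. t (?c l (\<psi> b k) * (y * S (?d b a))))"
      unfolding kappa_psi[OF l]
      by (simp add: sum_distrib_right tsum L.mult_scale t' mult.assoc)
    also have "\<dots> = (\<Sum>b\<in>BL. \<Sum>n\<in>BV. entry b n k * t (?c l n * (y * S (?d b a))))"
      by (subst VB.kappa_crd[OF l]) (simp add: sum_distrib_right tsum L.mult_scale t')
    finally show ?thesis .
  qed
  \<comment> \<open>The leftover S(d) stands to the right of S(c), the order in which the antipode
    of a product d c appears, so \<open>kappa_psi\<close> absorbs it.\<close>
  have 2: "(\<Sum>b\<in>BL. \<Sum>i\<in>BV. sH (entry b k i) (S (?c i j) * S (?d b a))) = (\<Sum>m\<in>BV. sH (entry a m j) (S (?c k m)))"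
    if k: "k \<in> BV" for k
  proof -
    have "(\<Sum>b\<in>BL. \<Sum>i\<in>BV. sH (entry b k i) (S (?c i j) * S (?d b a))) = S (?c k (\<psi> a j))"
      unfolding kappa_psi[OF k]
      by (simp add: L.antipode_sum L.antipode_scale a j
          L.antipode_matrix_mult[OF LB.coalg_matrix_kappa VB.coalg_matrix_kappa] cong: sum.cong)
    also have "\<dots> = (\<Sum>m\<in>BV. sH (entry a m j) (S (?c k m)))"
      by (subst VB.kappa_crd[OF k]) (simp add: L.antipode_sum L.antipode_scale)
    finally show ?thesis .
  qed
  have "(\<Sum>m\<in>BV. entry a l m * VB.avg_entry t p m j) =
      (\<Sum>m\<in>BV. \<Sum>k\<in>BV. \<Sum>i\<in>BV. ?p k i * (entry a l m * t (?c m k * S (?c i j))))"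
    unfolding VB.avg_entry_def by (simp add: sum_distrib_left mult.left_commute)
  also have "\<dots> = (\<Sum>k\<in>BV. \<Sum>i\<in>BV. ?p k i * (\<Sum>m\<in>BV. entry a l m * t (?c m k * S (?c i j))))"
    unfolding sum_distrib_left by (subst sum.swap, rule sum.cong[OF refl], rule sum.swap)
  also have "\<dots> = (\<Sum>k\<in>BV. \<Sum>i\<in>BV. ?p k i * (\<Sum>b\<in>BL. \<Sum>n\<in>BV. entry b n k * t (?c l n * (S (?c i j) * S (?d b a)))))"
    by (intro sum.cong[OF refl] arg_cong[of _ _ "(*) _"]) (simp only: 1)
  also have "\<dots> = (\<Sum>i\<in>BV. \<Sum>b\<in>BL. \<Sum>n\<in>BV. (\<Sum>k\<in>BV. ?p k i * entry b n k) * t (?c l n * (S (?c i j) * S (?d b a))))"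
    (is "(\<Sum>k\<in>BV. \<Sum>i\<in>BV. ?p k i * (\<Sum>b\<in>BL. \<Sum>n\<in>BV. entry b n k * ?T n i b)) = _")
  proof -
    have "(\<Sum>k\<in>BV. \<Sum>i\<in>BV. ?p k i * (\<Sum>b\<in>BL. \<Sum>n\<in>BV. entry b n k * ?T n i b)) =
        (\<Sum>i\<in>BV. \<Sum>k\<in>BV. \<Sum>b\<in>BL. \<Sum>n\<in>BV. ?p k i * entry b n k * ?T n i b)"
      by (subst sum.swap) (simp add: sum_distrib_left mult.assoc)
    also have "\<dots> = (\<Sum>i\<in>BV. \<Sum>b\<in>BL. \<Sum>k\<in>BV. \<Sum>n\<in>BV. ?p k i * entry b n k * ?T n i b)"
      by (rule sum.cong[OF refl], rule sum.swap)
    also have "\<dots> = (\<Sum>i\<in>BV. \<Sum>b\<in>BL. \<Sum>n\<in>BV. \<Sum>k\<in>BV. ?p k i * entry b n k * ?T n i b)"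
      by (rule sum.cong[OF refl], rule sum.cong[OF refl], rule sum.swap)
    finally show ?thesis by (simp only: sum_distrib_right)
  qed
  also have "\<dots> = (\<Sum>i\<in>BV. \<Sum>b\<in>BL. \<Sum>n\<in>BV. \<Sum>k\<in>BV. ?p n k * (entry b k i * ?T n i b))"
    unfolding pA by (simp add: sum_distrib_right mult.assoc)
  also have "\<dots> = (\<Sum>n\<in>BV. \<Sum>k\<in>BV. ?p n k * (\<Sum>b\<in>BL. \<Sum>i\<in>BV. entry b k i * ?T n i b))"
  proof -
    have "(\<Sum>i\<in>BV. \<Sum>b\<in>BL. \<Sum>n\<in>BV. \<Sum>k\<in>BV. ?p n k * (entry b k i * ?T n i b)) =
        (\<Sum>b\<in>BL. \<Sum>i\<in>BV. \<Sum>n\<in>BV. \<Sum>k\<in>BV. ?p n k * (entry b k i * ?T n i b))"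
      by (rule sum.swap)
    also have "\<dots> = (\<Sum>b\<in>BL. \<Sum>n\<in>BV. \<Sum>k\<in>BV. \<Sum>i\<in>BV. ?p n k * (entry b k i * ?T n i b))"
      by (rule sum.cong[OF refl], subst sum.swap, rule sum.cong[OF refl], rule sum.swap)
    also have "\<dots> = (\<Sum>n\<in>BV. \<Sum>k\<in>BV. \<Sum>b\<in>BL. \<Sum>i\<in>BV. ?p n k * (entry b k i * ?T n i b))"
      by (subst sum.swap, rule sum.cong[OF refl], rule sum.swap)
    finally show ?thesis by (simp only: sum_distrib_left)
  qed
  also have "\<dots> = (\<Sum>n\<in>BV. \<Sum>k\<in>BV. ?p n k * (\<Sum>m\<in>BV. entry a m j * t (?c l n * S (?c k m))))"
  proof (intro sum.cong[OF refl] arg_cong[of _ _ "(*) _"])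
    fix n k assume k: "k \<in> BV"
    have "(\<Sum>b\<in>BL. \<Sum>i\<in>BV. entry b k i * ?T n i b) =
        t (?c l n * (\<Sum>b\<in>BL. \<Sum>i\<in>BV. sH (entry b k i) (S (?c i j) * S (?d b a))))"
      by (simp add: sum_distrib_left tsum L.mult_scale t')
    also have "\<dots> = (\<Sum>m\<in>BV. entry a m j * t (?c l n * S (?c k m)))"
      unfolding 2[OF k] by (simp add: sum_distrib_left tsum L.mult_scale t')
    finally show "(\<Sum>b\<in>BL. \<Sum>i\<in>BV. entry b k i * ?T n i b) = (\<Sum>m\<in>BV. entry a m j * t (?c l n * S (?c k m)))" .
  qed
  also have "\<dots> = (\<Sum>n\<in>BV. \<Sum>m\<in>BV. \<Sum>k\<in>BV. ?p n k * t (?c l n * S (?c k m)) * entry a m j)"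
    unfolding sum_distrib_left
    by (rule sum.cong[OF refl], subst sum.swap) (simp add: mult_ac)
  also have "\<dots> = (\<Sum>m\<in>BV. VB.avg_entry t p l m * entry a m j)"
    unfolding VB.avg_entry_def sum_distrib_right by (rule sum.swap)
  finally show ?thesis .
qed

lemma avg_commute:
  assumes t: "left_integral sH \<Delta> t" "ad_invariant sH \<Delta> \<epsilon> S t"
    and p: "Vector_Spaces.linear sV sV p" "\<And>x v. p (\<psi> x v) = \<psi> x (p v)"
  shows "VB.avg t p (\<psi> x v) = \<psi> x (VB.avg t p v)"
proof -
  have basis: "VB.avg t p (\<psi> a j) = \<psi> a (VB.avg t p j)" if a: "a \<in> BL" and j: "j \<in> BV" for a j
  proof -
    have "\<psi> a (VB.avg t p j) = (\<Sum>m\<in>BV. sV (VB.avg_entry t p m j) (\<psi> a m))"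
      unfolding VB.avg_basis[OF j] linear_sum_image[OF psi_linear(1)] psi_scale ..
    also have "\<dots> = (\<Sum>m\<in>BV. sV (VB.avg_entry t p m j) (\<Sum>l\<in>BV. sV (entry a l m) l))"
      by (simp only: VB.sum_crd)
    also have "\<dots> = (\<Sum>l\<in>BV. sV (\<Sum>m\<in>BV. entry a l m * VB.avg_entry t p m j) l)"
      unfolding V.V.scale_sum_right V.V.scale_sum_left
      by (subst sum.swap) (simp add: mult.commute)
    also have "\<dots> = (\<Sum>l\<in>BV. sV (\<Sum>m\<in>BV. entry a m j * VB.avg_entry t p l m) l)"
      using avg_entry_commute[OF t p a _ j] by (simp add: mult.commute)
    finally show ?thesis by (simp add: VB.avg_def)
  qed
  have lin1: "Vector_Spaces.linear sV sV (\<lambda>v. VB.avg t p (\<psi> x v))" "Vector_Spaces.linear sV sV (\<lambda>v. \<psi> x (VB.avg t p v))"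
    "Vector_Spaces.linear sL sV (\<lambda>x. VB.avg t p (\<psi> x v))" "Vector_Spaces.linear sL sV (\<lambda>x. \<psi> x (VB.avg t p v))" for x v
    using VB.avg_linear[of t p] psi_linear by (auto simp: linear_iff_add_scale)
  have "VB.avg t p (\<psi> a v) = \<psi> a (VB.avg t p v)" if "a \<in> BL" for a
    unfolding VB.linear_expand[OF lin1(1)[of a], of v] VB.linear_expand[OF lin1(2)[of a], of v]
    by (rule sum.cong[OF refl]) (simp only: basis[OF that])
  then show ?thesis
    unfolding LB.linear_expand[OF lin1(3)[of v], of x] LB.linear_expand[OF lin1(4)[of v], of x]
    by (intro sum.cong[OF refl]) simp
qed

end

lemma fin_dim_of_finite_dimensional:
  assumes "finite_dimensional s"
  shows "vec_space s" "vec_space.fin_dim s UNIV"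
proof -
  obtain B where "finite_dimensional_vector_space s B"
    using assms unfolding finite_dimensional_def by blast
  then interpret f: finite_dimensional_vector_space s B .
  show "vec_space s" by unfold_locales
  then interpret v: vec_space s .
  show "v.fin_dim UNIV"
    unfolding v.fin_dim_def using f.finite_Basis f.span_Basis by blast
qed

theorem HL_projection:
  fixes sH :: "'f::field_char_0 \<Rightarrow> 'h::ring_1 \<Rightarrow> 'h"
    and sL :: "'f \<Rightarrow> 'l::ab_group_add \<Rightarrow> 'l" and sV :: "'f \<Rightarrow> 'v::ab_group_add \<Rightarrow> 'v"
  assumes t: "left_integral sH \<Delta> t" "ad_invariant sH \<Delta> \<epsilon> S t" "t 1 = 1"
    and L: "finite_dimensional sL" "lie_semisimple sL br"
    and V: "HL_module sH \<Delta> \<epsilon> S sL br \<rho>L sV \<rho>V \<psi>" "finite_dimensional sV"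
    and W: "HL_submodule sH sV \<rho>V \<psi> W"
  obtains g where "Vector_Spaces.linear sV sV g" "\<forall>v. g v \<in> W" "\<forall>w\<in>W. g w = w"
    "\<forall>x v. g (\<psi> x v) = \<psi> x (g v)"
    "\<forall>v. \<rho>V (g v) = sweedler sV sH (\<lambda>w h. tensor sV sH (g w) h) (\<rho>V v)"
proof -
  interpret l: vec_space sL by (rule fin_dim_of_finite_dimensional[OF L(1)])
  interpret v: vec_space sV by (rule fin_dim_of_finite_dimensional[OF V(2)])
  interpret M: HL_module sH \<Delta> \<epsilon> S sL br \<rho>L sV \<rho>V \<psi> by fact
  note fd = fin_dim_of_finite_dimensional(2)[OF L(1)] fin_dim_of_finite_dimensional(2)[OF V(2)]
  have ss: "semisimple_lie_algebra sL br"
    by (intro semisimple_lie_algebra.intro fd_lie_algebra.intro char_0_space.intro l.vec_space_axioms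
        M.L.L.lie_algebra_axioms fd_lie_algebra_axioms.intro fd semisimple_lie_algebra_axioms.intro L)
  have W': "v.subspace W" "\<And>x w. w \<in> W \<Longrightarrow> \<psi> x w \<in> W" "\<And>w. w \<in> W \<Longrightarrow> \<rho>V w \<in> tensor_product sV sH W UNIV"
    using W by (auto simp: HL_submodule_def)
  obtain P where P: "v.lin P" "\<forall>v. P v \<in> W" "\<forall>w\<in>W. P w = w" "\<forall>x v. P (\<psi> x v) = \<psi> x (P v)"
    by (rule weyl_projection[OF ss M.rep.lie_representation_axioms char_0_space.intro[OF v.vec_space_axioms] fd(2) W'(1,2)])
  obtain BL where BL: "finite BL" "l.independent BL" "l.span BL = UNIV" "BL \<subseteq> UNIV" "card BL = l.dim UNIV"
    by (rule l.fin_dim_basis[OF fd(1) l.subspace_UNIV])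
  obtain C where C: "finite C" "v.independent C" "v.span C = W" "C \<subseteq> W" "card C = v.dim W"
    by (rule v.fin_dim_basis[OF v.fin_dim_subset[OF fd(2) subset_UNIV] W'(1)])
  \<comment> \<open>The basis of \<open>V\<close> extends one of \<open>W\<close>, as
    \<open>avg_projection\<close> requires.\<close>
  define BV where "BV = v.extend_basis C"
  have BV: "v.independent BV" "C \<subseteq> BV" "v.span BV = UNIV"
    unfolding BV_def by (rule v.independent_extend_basis[OF C(2)] v.extend_basis_superset[OF C(2)] v.span_extend_basis[OF C(2)])+
  have finBV: "finite BV" by (rule v.fin_dim_independent[OF fd(2) BV(1)]) simp
  interpret HL_basis sH \<Delta> \<epsilon> S sL br \<rho>L sV \<rho>V \<psi> BL BV
    by unfold_locales (use BL BV finBV in auto)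
  have lt: "Vector_Spaces.linear sH (*) t" using t(1) by (simp add: left_integral_def)
  have pr: "VB.avg t P v \<in> v.span C" "w \<in> v.span C \<Longrightarrow> VB.avg t P w = w" for v w
    by (rule VB.avg_projection[OF t(3) lt BV(2)]; use W'(3) P C(3) in simp)+
  show ?thesis
  proof (rule that)
    show "Vector_Spaces.linear sV sV (VB.avg t P)" by (rule VB.avg_linear)
    show "\<forall>v. VB.avg t P v \<in> W" "\<forall>w\<in>W. VB.avg t P w = w" using pr C(3) by auto
    show "\<forall>x v. VB.avg t P (\<psi> x v) = \<psi> x (VB.avg t P v)"
      using avg_commute[OF t(1,2) P(1)] P(4) by simp
    show "\<forall>v. \<rho>V (VB.avg t P v) = sweedler sV sH (\<lambda>w h. tensor sV sH (VB.avg t P w) h) (\<rho>V v)"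
      using VB.avg_coact[OF t(1)] by blast
  qed
qed

section \<open>Decomposition into irreducible submodules\<close>

lemma sum_lessThan_add: "(\<Sum>i<m + n. f i) = (\<Sum>i<m. f i) + (\<Sum>i<n. f (m + i))"
  for f :: "nat \<Rightarrow> 'a::comm_monoid_add"
  by (induction n) (auto simp: add.assoc)

text \<open>Unlike \<^const>\<open>direct_sum\<close>, this is about a subset \<open>U\<close>, and uniqueness is only required
  for the decomposition of zero.\<close>
definition internal_sum :: "nat \<Rightarrow> (nat \<Rightarrow> 'v::ab_group_add set) \<Rightarrow> 'v set \<Rightarrow> bool"
  where "internal_sum s W U \<longleftrightarrow> (\<forall>i<s. W i \<subseteq> U) \<and>
    (\<forall>u\<in>U. \<exists>w. (\<forall>i<s. w i \<in> W i) \<and> u = (\<Sum>i<s. w i)) \<and>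
    (\<forall>w. (\<forall>i<s. w i \<in> W i) \<and> (\<Sum>i<s. w i) = 0 \<longrightarrow> (\<forall>i<s. w i = 0))"

context vec_space
begin

lemma internal_sum_append:
  assumes U: "subspace U1" "subspace U2" "U1 \<inter> U2 \<subseteq> {0}" "U1 \<subseteq> U" "U2 \<subseteq> U"
      "\<forall>u\<in>U. \<exists>u1\<in>U1. \<exists>u2\<in>U2. u = u1 + u2"
    and W: "internal_sum s1 W1 U1" "internal_sum s2 W2 U2"
  shows "internal_sum (s1 + s2) (\<lambda>i. if i < s1 then W1 i else W2 (i - s1)) U"
  unfolding internal_sum_def
proof (intro conjI allI ballI impI)
  let ?W = "\<lambda>i. if i < s1 then W1 i else W2 (i - s1)"
  show "?W i \<subseteq> U" if "i < s1 + s2" for i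
  proof (cases "i < s1")
    case True
    then show ?thesis using W(1) U(4) by (auto simp: internal_sum_def)
  next
    case False
    then have "i - s1 < s2" using that by simp
    then show ?thesis using False W(2) U(5) unfolding internal_sum_def by auto
  qed
  fix u assume "u \<in> U"
  then obtain u1 u2 where u: "u1 \<in> U1" "u2 \<in> U2" "u = u1 + u2" using U(6) by blast
  obtain w1 where w1: "\<forall>i<s1. w1 i \<in> W1 i" "u1 = (\<Sum>i<s1. w1 i)"
    using W(1) u(1) unfolding internal_sum_def by blast
  obtain w2 where w2: "\<forall>i<s2. w2 i \<in> W2 i" "u2 = (\<Sum>i<s2. w2 i)"
    using W(2) u(2) unfolding internal_sum_def by blast
  show "\<exists>w. (\<forall>i<s1 + s2. w i \<in> ?W i) \<and> u = (\<Sum>i<s1 + s2. w i)"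
  proof (intro exI conjI allI impI)
    let ?w = "\<lambda>i. if i < s1 then w1 i else w2 (i - s1)"
    show "?w i \<in> ?W i" if "i < s1 + s2" for i
      using w1(1) w2(1) that by auto
    show "u = (\<Sum>i<s1 + s2. ?w i)"
      unfolding sum_lessThan_add u(3) w1(2) w2(2) by simp
  qed
next
  let ?W = "\<lambda>i. if i < s1 then W1 i else W2 (i - s1)"
  fix w i assume w: "(\<forall>i<s1 + s2. w i \<in> ?W i) \<and> (\<Sum>i<s1 + s2. w i) = 0" and i: "i < s1 + s2"
  have w1: "\<forall>i<s1. w i \<in> W1 i"
  proof (intro allI impI)
    fix i assume "i < s1"
    then show "w i \<in> W1 i" using w[THEN conjunct1, rule_format, of i] by simp
  qed
  have w2: "\<forall>i<s2. w (s1 + i) \<in> W2 i"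
  proof (intro allI impI)
    fix i assume "i < s2"
    then show "w (s1 + i) \<in> W2 i" using w[THEN conjunct1, rule_format, of "s1 + i"] by simp
  qed
  let ?a = "\<Sum>i<s1. w i" and ?b = "\<Sum>i<s2. w (s1 + i)"
  have "?a + ?b = 0" using w by (simp add: sum_lessThan_add)
  moreover have a: "?a \<in> U1" by (rule subspace_sum[OF U(1)]) (use w1 W(1) in \<open>auto simp: internal_sum_def\<close>)
  moreover have "?b \<in> U2" by (rule subspace_sum[OF U(2)]) (use w2 W(2) in \<open>auto simp: internal_sum_def\<close>)
  moreover have "?a = - ?b" using \<open>?a + ?b = 0\<close> by (simp add: eq_neg_iff_add_eq_0)
  ultimately have "?a = 0" using U(2,3) subspace_neg by auto
  with \<open>?a + ?b = 0\<close> have "?b = 0" by simp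
  have "\<forall>i<s1. w i = 0" using W(1) w1 \<open>?a = 0\<close> unfolding internal_sum_def by blast
  moreover have "\<forall>i<s2. w (s1 + i) = 0"
    using W(2)[unfolded internal_sum_def, THEN conjunct2, THEN conjunct2, rule_format, of "\<lambda>i. w (s1 + i)"] w2 \<open>?b = 0\<close> by blast
  ultimately show "w i = 0"
    using i by (metis add_diff_inverse_nat nat_add_left_cancel_less)
qed

lemma direct_sum_internal_sum:
  assumes "internal_sum s W UNIV" "\<forall>i<s. subspace (W i)"
  shows "direct_sum s W"
  unfolding direct_sum_def
proof (intro allI ex_ex1I)
  fix v
  obtain w where "\<forall>i<s. w i \<in> W i" "v = (\<Sum>i<s. w i)"
    using assms(1) unfolding internal_sum_def by blast
  then show "\<exists>w. w \<in> (\<Pi>\<^sub>E i\<in>{..<s}. W i) \<and> v = (\<Sum>i<s. w i)"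
    by (intro exI[of _ "restrict w {..<s}"]) auto
next
  fix v w w'
  assume w: "w \<in> (\<Pi>\<^sub>E i\<in>{..<s}. W i) \<and> v = (\<Sum>i<s. w i)"
    and w': "w' \<in> (\<Pi>\<^sub>E i\<in>{..<s}. W i) \<and> v = (\<Sum>i<s. w' i)"
  have "\<forall>i<s. w i - w' i \<in> W i"
    using w w' assms(2) subspace_diff by (auto simp: PiE_iff)
  moreover have "(\<Sum>i<s. w i - w' i) = 0" using w w' by (simp add: sum_subtractf)
  ultimately have "\<forall>i<s. w i - w' i = 0"
    using assms(1)[unfolded internal_sum_def, THEN conjunct2, THEN conjunct2, rule_format, of "\<lambda>i. w i - w' i"] by blast
  then show "w = w'" using w w' by (intro PiE_ext[of w "{..<s}" W]) auto
qed

end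

text \<open>The map id - g respects both structures, so it carries submodules to submodules. Using
  its image rather than the kernel of g lets the coaction condition be checked by mapping a tensor
  decomposition factor by factor.\<close>

lemma HL_submodule_complement:
  assumes V: "HL_module sH \<Delta> \<epsilon> S sL br \<rho>L sV \<rho>V \<psi>"
    and g: "Vector_Spaces.linear sV sV g" "\<forall>x v. g (\<psi> x v) = \<psi> x (g v)"
      "\<forall>v. \<rho>V (g v) = sweedler sV sH (\<lambda>w h. tensor sV sH (g w) h) (\<rho>V v)"
    and U: "HL_submodule sH sV \<rho>V \<psi> U"
  shows "HL_submodule sH sV \<rho>V \<psi> ((\<lambda>u. u - g u) ` U)"
proof -
  interpret M: HL_module sH \<Delta> \<epsilon> S sL br \<rho>L sV \<rho>V \<psi> by fact
  interpret v: vec_space sV by unfold_locales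
  let ?q = "\<lambda>u. u - g u"
  have lq: "v.lin ?q" using g(1) by (simp add: v.lin_iff M.V.V.scale_right_diff_distrib)
  have U': "M.V.V.subspace U" "\<And>x u. u \<in> U \<Longrightarrow> \<psi> x u \<in> U" "\<And>u. u \<in> U \<Longrightarrow> \<rho>V u \<in> tensor_product sV sH U UNIV"
    using U by (auto simp: HL_submodule_def)
  note vs = M.V.V.vector_space_axioms M.L.vector_space_axioms vector_space_tensor_scale
  have tl: "tensor sV sH w (x + y) = tensor sV sH w x + tensor sV sH w y"
    "tensor sV sH w (sH c y) = tensor_scale c (tensor sV sH w y)"
    "tensor sV sH (v + w) y = tensor sV sH v y + tensor sV sH w y"
    "tensor sV sH (sV c w) y = tensor_scale c (tensor sV sH w y)" for v w x y c
    using bilinear_map_tensor[OF vs(1,2)] unfolding bilinear_map_iff[OF vs] by blast+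
  have "bilinear_map sV sH tensor_scale (\<lambda>w h. tensor sV sH (g w) h)"
    using g(1) by (simp add: bilinear_map_iff[OF vs] v.lin_iff tl)
  note sw = sweedler_sum[OF this]
  have "v.lin (\<psi> x)" for x using M.rep.rep_bilinear by (simp add: bilinear_map_def)
  then have "\<psi> x (u - w) = \<psi> x u - \<psi> x w" for x u w by (rule v.lin_diff)
  then have "\<psi> x (?q u) = ?q (\<psi> x u)" for x u using g(2) by simp
  then have "\<psi> x w \<in> ?q ` U" if "w \<in> ?q ` U" for x w
    using that U'(2) by (auto intro: rev_image_eqI)
  moreover have "\<rho>V (?q u) \<in> tensor_product sV sH (?q ` U) UNIV" if u: "u \<in> U" for u
  proof -
    obtain n x y where r: "\<rho>V u = (\<Sum>r<n::nat. tensor sV sH (x r) (y r))" "\<forall>r<n. x r \<in> U"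
      using U'(3)[OF u] unfolding tensor_product_def by blast
    have d: "tensor sV sH (v - w) y = tensor sV sH v y - tensor sV sH w y" for v w y
      using tl(3)[of "v - w" w y] by simp
    have "\<rho>V (?q u) + \<rho>V (g u) = \<rho>V u"
      using M.V.coact_linear unfolding linear_iff_add_scale by (metis diff_add_cancel)
    from this have "\<rho>V (?q u) = (\<Sum>r<n. tensor sV sH (x r) (y r)) - (\<Sum>r<n. tensor sV sH (g (x r)) (y r))"
      unfolding g(3)[rule_format] r(1) sw by (simp add: eq_diff_eq)
    also have "\<dots> = (\<Sum>r<n. tensor sV sH (?q (x r)) (y r))"
      by (simp add: d sum_subtractf)
    also have "\<dots> \<in> tensor_product sV sH (?q ` U) UNIV"
      by (rule sum_in_tensor_product) (use r(2) in auto)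
    finally show ?thesis .
  qed
  ultimately show ?thesis
    using v.lin_image_subspace[OF lq U'(1)] unfolding HL_submodule_def by blast
qed

theorem mainTheorem9:
  fixes sH :: "'f::field_char_0 \<Rightarrow> 'h::ring_1 \<Rightarrow> 'h"
    and \<Delta> :: "'h \<Rightarrow> ('f, 'h, 'h) tensor"
    and \<epsilon> :: "'h \<Rightarrow> 'f"
    and S :: "'h \<Rightarrow> 'h"
    and t :: "'h \<Rightarrow> 'f"
    and sL :: "'f \<Rightarrow> 'l::ab_group_add \<Rightarrow> 'l"
    and br :: "'l \<Rightarrow> 'l \<Rightarrow> 'l"
    and \<rho>L :: "'l \<Rightarrow> ('f, 'l, 'h) tensor"
    and sV :: "'f \<Rightarrow> 'v::ab_group_add \<Rightarrow> 'v"
    and \<rho>V :: "'v \<Rightarrow> ('f, 'v, 'h) tensor"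
    and \<psi> :: "'l \<Rightarrow> 'v \<Rightarrow> 'v"
  assumes "hopf_algebra sH \<Delta> \<epsilon> S"
    and "left_integral sH \<Delta> t"
    and "ad_invariant sH \<Delta> \<epsilon> S t"
    and "t 1 = 1"
    and "comodule_lie_algebra sH \<Delta> \<epsilon> S sL br \<rho>L"
    and "finite_dimensional sL"
    and "lie_semisimple sL br"
    and "HL_module sH \<Delta> \<epsilon> S sL br \<rho>L sV \<rho>V \<psi>"
    and "finite_dimensional sV"
  shows "\<exists>(s::nat) W. (\<forall>i<s. irreducible_HL_submodule sH sV \<rho>V \<psi> (W i)) \<and> direct_sum s W"
proof -
  interpret v: vec_space sV by (rule fin_dim_of_finite_dimensional[OF assms(9)])
  interpret M: HL_module sH \<Delta> \<epsilon> S sL br \<rho>L sV \<rho>V \<psi> by fact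
  note fd = fin_dim_of_finite_dimensional(2)[OF assms(9)]
  let ?sub = "HL_submodule sH sV \<rho>V \<psi>" and ?irr = "irreducible_HL_submodule sH sV \<rho>V \<psi>"
  have sub: "v.subspace U" if "?sub U" for U using that by (simp add: HL_submodule_def)
  have fdU: "v.fin_dim U" for U by (rule v.fin_dim_subset[OF fd subset_UNIV])
  \<comment> \<open>Stated for all submodules, as the induction on dimension must pass to both
    summands.\<close>
  have decomp: "\<exists>s W. (\<forall>i<s. ?irr (W i)) \<and> internal_sum s W U" if "?sub U" for U
    using that
  proof (induction "v.dim U" arbitrary: U rule: less_induct)
    case less
    consider "U = {0}" | "?irr U" | U1 where "U1 \<subseteq> U" "?sub U1" "U1 \<noteq> {0}" "U1 \<noteq> U"
      using less.prems unfolding irreducible_HL_submodule_def by blast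
    then show ?case
    proof cases
      case 1
      then have "internal_sum 0 (\<lambda>_. {}) U" by (auto simp: internal_sum_def)
      then show ?thesis by blast
    next
      case 2
      have "internal_sum 1 (\<lambda>_. U) U"
        unfolding internal_sum_def by (auto intro: exI[of _ "\<lambda>_. _"])
      with 2 show ?thesis by (intro exI[of _ 1] exI[of _ "\<lambda>_. U"]) simp
    next
      case 3
      obtain g where g: "v.lin g" "\<forall>v. g v \<in> U1" "\<forall>w\<in>U1. g w = w" "\<forall>x v. g (\<psi> x v) = \<psi> x (g v)"
        "\<forall>v. \<rho>V (g v) = sweedler sV sH (\<lambda>w h. tensor sV sH (g w) h) (\<rho>V v)"
        by (rule HL_projection[OF assms(2,3,4,6,7,8,9) 3(2)])
      \<comment> \<open>The projection g is defined on all of \<open>V\<close>, but its range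
        \<open>U1\<close> lies in \<open>U\<close>, so it splits \<open>U\<close> as well.\<close>
      define U2 where "U2 = (\<lambda>u. u - g u) ` U"
      have sU2: "?sub U2"
        unfolding U2_def by (rule HL_submodule_complement[OF assms(8) g(1,4,5) less.prems])
      note s = sub[OF less.prems] sub[OF 3(2)] sub[OF sU2]
      have "U2 \<subseteq> U" unfolding U2_def using g(2) 3(1) v.subspace_diff[OF s(1)] by blast
      have int: "U1 \<inter> U2 \<subseteq> {0}"
      proof
        fix x assume "x \<in> U1 \<inter> U2"
        then obtain u where u: "x \<in> U1" "x = u - g u" unfolding U2_def by blast
        have "g x = g u - g (g u)" unfolding u(2) by (rule v.lin_diff[OF g(1)])
        then show "x \<in> {0}" using u(1) g(2,3) by simp
      qed
      have "U2 \<noteq> U" using int 3(1,3) v.subspace_0[OF s(2)] by blast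
      then have "v.dim U1 < v.dim U" "v.dim U2 < v.dim U"
        using v.subspace_dim_less[OF fdU s(2,1)] v.subspace_dim_less[OF fdU s(3,1)] 3(1,4) \<open>U2 \<subseteq> U\<close> by blast+
      then obtain s1 W1 s2 W2 where W: "\<forall>i<s1. ?irr (W1 i)" "internal_sum s1 W1 U1"
        "\<forall>i<s2. ?irr (W2 i)" "internal_sum s2 W2 U2"
        using less.hyps 3(2) sU2 by meson
      have "\<forall>u\<in>U. \<exists>u1\<in>U1. \<exists>u2\<in>U2. u = u1 + u2"
      proof
        fix u assume "u \<in> U"
        then have "u - g u \<in> U2" "g u \<in> U1" "u = g u + (u - g u)" using g(2) by (auto simp: U2_def)
        then show "\<exists>u1\<in>U1. \<exists>u2\<in>U2. u = u1 + u2" by blast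
      qed
      from v.internal_sum_append[OF s(2,3) int 3(1) \<open>U2 \<subseteq> U\<close> this W(2,4)]
      have "internal_sum (s1 + s2) (\<lambda>i. if i < s1 then W1 i else W2 (i - s1)) U" .
      moreover have "\<forall>i<s1 + s2. ?irr (if i < s1 then W1 i else W2 (i - s1))" using W(1,3) by simp
      ultimately show ?thesis
        by (intro exI[of _ "s1 + s2"] exI[of _ "\<lambda>i. if i < s1 then W1 i else W2 (i - s1)"]) simp
    qed
  qed
  have "\<rho>V v \<in> tensor_product sV sH UNIV UNIV" for v by (rule M.V.coact_in)
  then have "?sub UNIV" by (simp add: HL_submodule_def v.subspace_UNIV)
  then obtain s W where W: "\<forall>i<s. ?irr (W i)" "internal_sum s W UNIV" using decomp by blast
  then have "direct_sum s W"
    by (intro v.direct_sum_internal_sum) (simp_all add: irreducible_HL_submodule_def HL_submodule_def)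
  with W(1) show ?thesis by blast
qed

end
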